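(* Suppose that $\mathbb{P}$ is a forcing poset which is strongly proper on a stationary set and $\mathbb{Q}$ is an $\omega_1$-closed forcing poset. Then $\mathbb{P}$ forces that $\mathbb{Q}$ is $\omega_1$-distributive.
   Context: A forcing poset is $\omega_1$-closed if every countable descending sequence of conditions has a lower bound; it is $\omega_1$-distributive if it adds no new countable sets of ordinals. For a forcing poset $\mathbb{P}$ and a set $N$ with $N \cap \mathbb{P} \neq \emptyset$, a condition $q$ is strongly $(N,\mathbb{P})$-generic if every dense subset of the forcing poset $N \cap \mathbb{P}$ is predense below $q$ (in $\mathbb{P}$). $\mathbb{P}$ is strongly proper for $N$ if every $p \in N \cap \mathbb{P}$ has an extension $q \le p$ which is strongly $(N,\mathbb{P})$-generic. $\mathbb{P}$ is strongly proper on a stationary set if for all sufficiently large cardinals $\chi \ge \omega_1$ with $\mathbb{P} \in H(\chi)$, there are stationarily many $N \in P_{\omega_1}(H(\chi))$ with $N \cap \omega_1 \in \omega_1$ such that $\mathbb{P}$ is strongly proper for $N$. *)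

theory Defs
  imports "HOL-Library.Countable_Set" "HOL-Library.Equipollence"
begin

text \<open>
  The universe of sets is a type of class \<open>zfc\<close>; \<open>elts x\<close> is the extension of the set \<open>x\<close>.
  Replacement and separation are stated for arbitrary HOL functions and predicates. The axiom of
  choice is inherited from HOL's choice operator. A consequence is that every HOL function
  between sets, and every HOL subset of a set, is represented by an element of the universe, so
  that countability, cardinality and families of subsets can be expressed by the HOL notions.
\<close>

class zfc =
  fixes elts :: "'a \<Rightarrow> 'a set"
  assumes extensionality: "elts x = elts y \<Longrightarrow> x = y"
    and foundation: "wf {(x, y). x \<in> elts y}"
    and pairing: "\<exists>z. elts z = {x, y}"
    and union: "\<exists>u. elts u = \<Union> (elts ` elts x)"
    and powerset: "\<exists>u. elts u = {y. elts y \<subseteq> elts x}"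
    and separation: "\<exists>u. elts u = {y \<in> elts x. R y}"
    and replacement: "\<exists>u. elts u = f ` elts x"
    and infinity: "\<exists>w. (\<exists>z\<in>elts w. elts z = {}) \<and>
                      (\<forall>x\<in>elts w. \<exists>y\<in>elts w. elts y = insert x (elts x))"

text \<open>Meaningful only for those \<open>A\<close> that are the extension of a set.\<close>

definition vset :: "'v::zfc set \<Rightarrow> 'v" where
  "vset A = (THE x. elts x = A)"

definition vpair :: "'v::zfc \<Rightarrow> 'v \<Rightarrow> 'v" where
  "vpair x y = vset {vset {x}, vset {x, y}}"


section \<open>Ordinals, cardinals, \<open>H(\<chi>)\<close>, stationary sets\<close>

definition transitive :: "'v::zfc \<Rightarrow> bool" where
  "transitive x \<longleftrightarrow> (\<forall>y\<in>elts x. elts y \<subseteq> elts x)"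

definition ordinal :: "'v::zfc \<Rightarrow> bool" where
  "ordinal x \<longleftrightarrow> transitive x \<and> (\<forall>y\<in>elts x. transitive y)"

definition cardinal :: "'v::zfc \<Rightarrow> bool" where
  "cardinal \<kappa> \<longleftrightarrow> ordinal \<kappa> \<and> (\<forall>\<alpha>\<in>elts \<kappa>. elts \<alpha> \<prec> elts \<kappa>)"

text \<open>The extension of the ordinal \<open>\<omega>\<^sub>1\<close>.\<close>

definition omega1 :: "'v::zfc set" where
  "omega1 = {\<alpha>. ordinal \<alpha> \<and> countable (elts \<alpha>)}"

definition trcl :: "'v::zfc \<Rightarrow> 'v set" where
  "trcl x = {y. (y, x) \<in> {(a, b). a \<in> elts b}\<^sup>+}"

definition H :: "'v::zfc \<Rightarrow> 'v set" where
  "H \<chi> = {x. trcl x \<prec> elts \<chi>}"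

definition countable_subsets :: "'a set \<Rightarrow> 'a set set" where
  "countable_subsets X = {N. N \<subseteq> X \<and> countable N}"

definition club :: "'a set \<Rightarrow> 'a set set \<Rightarrow> bool" where
  "club X C \<longleftrightarrow> C \<subseteq> countable_subsets X \<and>
     (\<forall>M\<in>countable_subsets X. \<exists>N\<in>C. M \<subseteq> N) \<and>
     (\<forall>N :: nat \<Rightarrow> 'a set. range N \<subseteq> C \<and> mono N \<longrightarrow> (\<Union>n. N n) \<in> C)"

definition stationary :: "'a set \<Rightarrow> 'a set set \<Rightarrow> bool" where
  "stationary X S \<longleftrightarrow> S \<subseteq> countable_subsets X \<and> (\<forall>C. club X C \<longrightarrow> S \<inter> C \<noteq> {})"


section \<open>Forcing posets\<close>

text \<open>
  A forcing poset is given by its underlying set \<open>P\<close> and the set \<open>le\<close> of pairs representing its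
  ordering. As usual in forcing, antisymmetry is not required.
\<close>

definition leq :: "'v::zfc \<Rightarrow> 'v \<Rightarrow> 'v \<Rightarrow> bool" where
  "leq le p q \<longleftrightarrow> vpair p q \<in> elts le"

definition forcing_poset :: "'v::zfc \<Rightarrow> 'v \<Rightarrow> bool" where
  "forcing_poset P le \<longleftrightarrow> elts P \<noteq> {} \<and>
     elts le \<subseteq> {vpair p q |p q. p \<in> elts P \<and> q \<in> elts P} \<and>
     (\<forall>p\<in>elts P. leq le p p) \<and>
     (\<forall>p\<in>elts P. \<forall>q\<in>elts P. \<forall>r\<in>elts P. leq le p q \<and> leq le q r \<longrightarrow> leq le p r)"

definition omega1_closed :: "'v::zfc \<Rightarrow> 'v \<Rightarrow> bool" where
  "omega1_closed P le \<longleftrightarrow>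
     (\<forall>p :: nat \<Rightarrow> 'v. range p \<subseteq> elts P \<and> (\<forall>n. leq le (p (Suc n)) (p n)) \<longrightarrow>
        (\<exists>q\<in>elts P. \<forall>n. leq le q (p n)))"

definition dense_in :: "'v::zfc \<Rightarrow> 'v set \<Rightarrow> 'v set \<Rightarrow> bool" where
  "dense_in le A D \<longleftrightarrow> D \<subseteq> A \<and> (\<forall>p\<in>A. \<exists>d\<in>D. leq le d p)"

definition compatible :: "'v::zfc \<Rightarrow> 'v \<Rightarrow> 'v \<Rightarrow> 'v \<Rightarrow> bool" where
  "compatible P le p q \<longleftrightarrow> (\<exists>r\<in>elts P. leq le r p \<and> leq le r q)"

definition predense_below :: "'v::zfc \<Rightarrow> 'v \<Rightarrow> 'v set \<Rightarrow> 'v \<Rightarrow> bool" where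
  "predense_below P le D q \<longleftrightarrow>
     (\<forall>r\<in>elts P. leq le r q \<longrightarrow> (\<exists>d\<in>D. compatible P le d r))"

definition strongly_generic :: "'v::zfc \<Rightarrow> 'v \<Rightarrow> 'v set \<Rightarrow> 'v \<Rightarrow> bool" where
  "strongly_generic P le N q \<longleftrightarrow> q \<in> elts P \<and>
     (\<forall>D. dense_in le (N \<inter> elts P) D \<longrightarrow> predense_below P le D q)"

definition strongly_proper_for :: "'v::zfc \<Rightarrow> 'v \<Rightarrow> 'v set \<Rightarrow> bool" where
  "strongly_proper_for P le N \<longleftrightarrow> N \<inter> elts P \<noteq> {} \<and>
     (\<forall>p\<in>N \<inter> elts P. \<exists>q\<in>elts P. leq le q p \<and> strongly_generic P le N q)"

definition strongly_proper_on_stationary :: "'v::zfc \<Rightarrow> 'v \<Rightarrow> bool" where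
  "strongly_proper_on_stationary P le \<longleftrightarrow>
     (\<exists>\<mu>. cardinal \<mu> \<and>
       (\<forall>\<chi>. cardinal \<chi> \<and> elts \<mu> \<subseteq> elts \<chi> \<and> omega1 \<subseteq> elts \<chi> \<and> vpair P le \<in> H \<chi> \<longrightarrow>
          stationary (H \<chi>)
            {N \<in> countable_subsets (H \<chi>).
               (\<exists>\<alpha>\<in>omega1. N \<inter> omega1 = elts \<alpha>) \<and> strongly_proper_for P le N}))"


section \<open>The language of set theory\<close>

text \<open>
  Formulas with parameters from the universe; bound variables are represented by HOL functions.
  A formula that is to be forced takes names as parameters.
\<close>

datatype 'v fm =
    Mem 'v 'v
  | Eq 'v 'v
  | Neg "'v fm"
  | Conj "'v fm" "'v fm"
  | Forall "'v \<Rightarrow> 'v fm"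

primrec sat :: "'v::zfc fm \<Rightarrow> bool" where
  "sat (Mem x y) \<longleftrightarrow> x \<in> elts y"
| "sat (Eq x y) \<longleftrightarrow> x = y"
| "sat (Neg \<phi>) \<longleftrightarrow> \<not> sat \<phi>"
| "sat (Conj \<phi> \<psi>) \<longleftrightarrow> sat \<phi> \<and> sat \<psi>"
| "sat (Forall F) \<longleftrightarrow> (\<forall>x. sat (F x))"

definition Disj :: "'v fm \<Rightarrow> 'v fm \<Rightarrow> 'v fm" where
  "Disj \<phi> \<psi> = Neg (Conj (Neg \<phi>) (Neg \<psi>))"

definition Imp :: "'v fm \<Rightarrow> 'v fm \<Rightarrow> 'v fm" where
  "Imp \<phi> \<psi> = Neg (Conj \<phi> (Neg \<psi>))"

definition Iff :: "'v fm \<Rightarrow> 'v fm \<Rightarrow> 'v fm" where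
  "Iff \<phi> \<psi> = Conj (Imp \<phi> \<psi>) (Imp \<psi> \<phi>)"

definition Exists :: "('v \<Rightarrow> 'v fm) \<Rightarrow> 'v fm" where
  "Exists F = Neg (Forall (\<lambda>x. Neg (F x)))"

definition BForall :: "'v \<Rightarrow> ('v \<Rightarrow> 'v fm) \<Rightarrow> 'v fm" where
  "BForall a F = Forall (\<lambda>x. Imp (Mem x a) (F x))"

definition BExists :: "'v \<Rightarrow> ('v \<Rightarrow> 'v fm) \<Rightarrow> 'v fm" where
  "BExists a F = Exists (\<lambda>x. Conj (Mem x a) (F x))"

text \<open>\<open>z = {x, y}\<close>; \<open>z = (x, y)\<close>; \<open>(x, y) \<in> r\<close>; \<open>(x, (y, z)) \<in> r\<close>\<close>

definition IsUpair :: "'v \<Rightarrow> 'v \<Rightarrow> 'v \<Rightarrow> 'v fm" where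
  "IsUpair x y z = Forall (\<lambda>w. Iff (Mem w z) (Disj (Eq w x) (Eq w y)))"

definition IsPair :: "'v \<Rightarrow> 'v \<Rightarrow> 'v \<Rightarrow> 'v fm" where
  "IsPair x y z = Exists (\<lambda>a. Exists (\<lambda>b.
     Conj (IsUpair x x a) (Conj (IsUpair x y b) (IsUpair a b z))))"

definition PairIn :: "'v \<Rightarrow> 'v \<Rightarrow> 'v \<Rightarrow> 'v fm" where
  "PairIn x y r = Exists (\<lambda>z. Conj (IsPair x y z) (Mem z r))"

definition TripleIn :: "'v \<Rightarrow> 'v \<Rightarrow> 'v \<Rightarrow> 'v \<Rightarrow> 'v fm" where
  "TripleIn x y z r = Exists (\<lambda>u. Conj (IsPair y z u) (PairIn x u r))"

definition Trans :: "'v \<Rightarrow> 'v fm" where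
  "Trans x = BForall x (\<lambda>y. BForall y (\<lambda>z. Mem z x))"

definition Ord :: "'v \<Rightarrow> 'v fm" where
  "Ord x = Conj (Trans x) (BForall x Trans)"

definition LimitOrd :: "'v \<Rightarrow> 'v fm" where
  "LimitOrd x = Conj (Ord x) (Conj (Exists (\<lambda>y. Mem y x))
     (BForall x (\<lambda>y. BExists x (\<lambda>z. Mem y z))))"

definition IsOmega :: "'v \<Rightarrow> 'v fm" where
  "IsOmega x = Conj (LimitOrd x) (BForall x (\<lambda>y. Neg (LimitOrd y)))"

text \<open>Some \<open>f\<close> restricts to an injective function from \<open>x\<close> into \<open>\<omega>\<close>.\<close>

definition Countable :: "'v \<Rightarrow> 'v fm" where
  "Countable x = Exists (\<lambda>w. Conj (IsOmega w) (Exists (\<lambda>f.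
     Conj (BForall x (\<lambda>y. BExists w (\<lambda>n. PairIn y n f)))
    (Conj (BForall x (\<lambda>y. BForall w (\<lambda>m. BForall w (\<lambda>n.
             Imp (Conj (PairIn y m f) (PairIn y n f)) (Eq m n)))))
          (BForall x (\<lambda>y. BForall x (\<lambda>z. BForall w (\<lambda>n.
             Imp (Conj (PairIn y n f) (PairIn z n f)) (Eq y z)))))))))"

definition CountableSetOfOrdinals :: "'v \<Rightarrow> 'v fm" where
  "CountableSetOfOrdinals x = Conj (BForall x Ord) (Countable x)"


section \<open>The forcing relation\<close>

text \<open>
  The formulas in this section express the forcing relation of \<open>(P, le)\<close> in the language of set
  theory. They can therefore be evaluated in the universe by \<^const>\<open>sat\<close>, but they can also
  themselves be forced by another poset. The clauses for atomic formulas are those of Kunen's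
  1980 textbook.
\<close>

definition NameClosed :: "'v \<Rightarrow> 'v \<Rightarrow> 'v fm" where
  "NameClosed P D = BForall D (\<lambda>x. BForall x (\<lambda>z.
     BExists D (\<lambda>\<sigma>. BExists P (\<lambda>p. IsPair \<sigma> p z))))"

text \<open>\<open>\<tau>\<close> is a \<open>P\<close>-name: a set of pairs \<open>(\<sigma>, p)\<close> with \<open>p \<in> P\<close> and, hereditarily, \<open>\<sigma>\<close> a
  \<open>P\<close>-name.\<close>

definition IsName :: "'v \<Rightarrow> 'v \<Rightarrow> 'v fm" where
  "IsName P \<tau> = Exists (\<lambda>D. Conj (NameClosed P D) (Mem \<tau> D))"

definition BelowForall :: "'v \<Rightarrow> 'v \<Rightarrow> 'v \<Rightarrow> ('v \<Rightarrow> 'v fm) \<Rightarrow> 'v fm" where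
  "BelowForall P le p F = BForall P (\<lambda>q. Imp (PairIn q p le) (F q))"

definition BelowExists :: "'v \<Rightarrow> 'v \<Rightarrow> 'v \<Rightarrow> ('v \<Rightarrow> 'v fm) \<Rightarrow> 'v fm" where
  "BelowExists P le p F = BExists P (\<lambda>q. Conj (PairIn q p le) (F q))"

definition DenseBelow :: "'v \<Rightarrow> 'v \<Rightarrow> 'v \<Rightarrow> ('v \<Rightarrow> 'v fm) \<Rightarrow> 'v fm" where
  "DenseBelow P le p F = BelowForall P le p (\<lambda>q. BelowExists P le q F)"

text \<open>One of the two inclusions in the recursive clause for \<open>p \<tturnstile> \<tau> = \<sigma>\<close>, where \<open>R r \<pi> \<pi>'\<close>
  stands for \<open>r \<tturnstile> \<pi> = \<pi>'\<close>: for every \<open>(\<pi>, s) \<in> \<tau>\<close>, densely many \<open>r\<close> below \<open>p\<close> satisfy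
  \<open>r \<le> s \<longrightarrow> (\<exists>(\<pi>', s') \<in> \<sigma>. r \<le> s' \<and> r \<tturnstile> \<pi> = \<pi>')\<close>.\<close>

definition ForcesSubClause ::
  "'v \<Rightarrow> 'v \<Rightarrow> ('v \<Rightarrow> 'v \<Rightarrow> 'v \<Rightarrow> 'v fm) \<Rightarrow> 'v \<Rightarrow> 'v \<Rightarrow> 'v \<Rightarrow> 'v fm" where
  "ForcesSubClause P le R p \<tau> \<sigma> =
     Forall (\<lambda>\<pi>. Forall (\<lambda>s. Imp (PairIn \<pi> s \<tau>)
       (DenseBelow P le p (\<lambda>r. Imp (PairIn r s le)
          (Exists (\<lambda>\<pi>'. Exists (\<lambda>s'. Conj (PairIn \<pi>' s' \<sigma>)
             (Conj (PairIn r s' le) (R r \<pi> \<pi>')))))))))"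

definition ForcesEqClause :: "'v \<Rightarrow> 'v \<Rightarrow> 'v \<Rightarrow> 'v \<Rightarrow> 'v \<Rightarrow> 'v \<Rightarrow> 'v fm" where
  "ForcesEqClause P le E p \<tau> \<sigma> =
     Conj (ForcesSubClause P le (\<lambda>r \<pi> \<pi>'. TripleIn r \<pi> \<pi>' E) p \<tau> \<sigma>)
          (ForcesSubClause P le (\<lambda>r \<pi>' \<pi>. TripleIn r \<pi> \<pi>' E) p \<sigma> \<tau>)"

text \<open>The recursion is expressed by the existence of a set \<open>E\<close> of triples that satisfies the
  recursive clause on a set \<open>D\<close> of names closed under subnames.\<close>

definition ForcesEq :: "'v \<Rightarrow> 'v \<Rightarrow> 'v \<Rightarrow> 'v \<Rightarrow> 'v \<Rightarrow> 'v fm" where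
  "ForcesEq P le p \<tau> \<sigma> = Exists (\<lambda>D. Exists (\<lambda>E.
     Conj (NameClosed P D) (Conj (Mem \<tau> D) (Conj (Mem \<sigma> D)
    (Conj (BForall P (\<lambda>q. BForall D (\<lambda>x. BForall D (\<lambda>y.
             Iff (TripleIn q x y E) (ForcesEqClause P le E q x y)))))
          (TripleIn p \<tau> \<sigma> E))))))"

definition ForcesMem :: "'v \<Rightarrow> 'v \<Rightarrow> 'v \<Rightarrow> 'v \<Rightarrow> 'v \<Rightarrow> 'v fm" where
  "ForcesMem P le p \<tau> \<sigma> = DenseBelow P le p (\<lambda>q.
     Exists (\<lambda>\<pi>. Exists (\<lambda>s. Conj (PairIn \<pi> s \<sigma>)
       (Conj (PairIn q s le) (ForcesEq P le q \<pi> \<tau>)))))"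

text \<open>\<open>Forces P le \<phi> p\<close> is the formula \<open>p \<tturnstile> \<phi>\<close>.\<close>

primrec Forces :: "'v \<Rightarrow> 'v \<Rightarrow> 'v fm \<Rightarrow> 'v \<Rightarrow> 'v fm" where
  "Forces P le (Mem \<tau> \<sigma>) = (\<lambda>p. ForcesMem P le p \<tau> \<sigma>)"
| "Forces P le (Eq \<tau> \<sigma>) = (\<lambda>p. ForcesEq P le p \<tau> \<sigma>)"
| "Forces P le (Neg \<phi>) = (\<lambda>p. BelowForall P le p (\<lambda>q. Neg (Forces P le \<phi> q)))"
| "Forces P le (Conj \<phi> \<psi>) = (\<lambda>p. Conj (Forces P le \<phi> p) (Forces P le \<psi> p))"
| "Forces P le (Forall F) =
     (\<lambda>p. Forall (\<lambda>\<tau>. Imp (IsName P \<tau>) (Forces P le (F \<tau>) p)))"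

definition forced :: "'v::zfc \<Rightarrow> 'v \<Rightarrow> 'v fm \<Rightarrow> bool" where
  "forced P le \<phi> \<longleftrightarrow> (\<forall>p\<in>elts P. sat (Forces P le \<phi> p))"

text \<open>The canonical \<open>P\<close>-name \<open>{(check y, p) | y \<in> x, p \<in> P}\<close> of a set \<open>x\<close>; a greatest
  condition is not assumed to exist.\<close>

definition check :: "'v::zfc \<Rightarrow> 'v \<Rightarrow> 'v" where
  "check P = wfrec {(y, x). y \<in> elts x}
     (\<lambda>f x. vset {vpair (f y) p |y p. y \<in> elts x \<and> p \<in> elts P})"

text \<open>The formula \<open>c = check P x\<close>: some \<open>f\<close> is a function on a transitive set \<open>D\<close> containing \<open>x\<close>
  that satisfies the recursive clause on \<open>D\<close> and maps \<open>x\<close> to \<open>c\<close>.\<close>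

definition IsCheck :: "'v \<Rightarrow> 'v \<Rightarrow> 'v \<Rightarrow> 'v fm" where
  "IsCheck P x c = Exists (\<lambda>D. Exists (\<lambda>f.
     Conj (Trans D) (Conj (Mem x D)
    (Conj (BForall D (\<lambda>y. Exists (\<lambda>u. Forall (\<lambda>v. Iff (PairIn y v f) (Eq v u)))))
    (Conj (BForall D (\<lambda>y. Forall (\<lambda>u. Imp (PairIn y u f)
             (Forall (\<lambda>e. Iff (Mem e u)
                (BExists y (\<lambda>z. BExists P (\<lambda>p. Exists (\<lambda>v.
                   Conj (PairIn z v f) (IsPair v p e))))))))))
          (PairIn x c f))))))"

text \<open>Every \<open>q \<in> P\<close> that forces a name \<open>\<tau>\<close> to be a countable set of ordinals also forces \<open>\<tau>\<close> to
  belong to the ground model, that is, densely many conditions below \<open>q\<close> force \<open>\<tau>\<close> to be equal to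
  the canonical name of some set.\<close>

definition Omega1Distributive :: "'v \<Rightarrow> 'v \<Rightarrow> 'v fm" where
  "Omega1Distributive P le = BForall P (\<lambda>q. Forall (\<lambda>\<tau>.
     Imp (Conj (IsName P \<tau>) (Forces P le (CountableSetOfOrdinals \<tau>) q))
         (DenseBelow P le q (\<lambda>r. Exists (\<lambda>x. Exists (\<lambda>c.
            Conj (IsCheck P x c) (Forces P le (Eq \<tau> c) r)))))))"

end

theory Submission
  imports Defs
begin

text \<open>
  A \<open>P\<close>-name for a \<open>Q\<close>-name is the same thing as a \<open>P \<times> Q\<close>-name, and \<open>p\<close> forces that \<open>q\<close> forces \<open>\<phi>\<close> iff
  \<open>(p, q)\<close> forces \<open>\<phi>\<close> for the product. It is therefore enough to find, for a \<open>P \<times> Q\<close>-name \<open>t\<close> of a countable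
  set of ordinals, densely many \<open>(p, q)\<close> such that \<open>p\<close> forces that \<open>q\<close> decides every element of \<open>t\<close>.
  Take a countable \<open>N\<close> for which \<open>P\<close> is strongly proper and which is closed under a function that extends
  a given \<open>(p, q)\<close> to a pair deciding the \<open>k\<close>-th element of \<open>t\<close>. Since \<open>N \<inter> P\<close> is countable, one descending
  sequence \<open>q\<^sub>0 \<ge> q\<^sub>1 \<ge> \<dots>\<close> in \<open>N \<inter> Q\<close> can be arranged such that for every \<open>k\<close> the set of those \<open>p \<in> N \<inter> P\<close> for
  which some \<open>(p, q\<^sub>j)\<close> decides the \<open>k\<close>-th element is dense in \<open>N \<inter> P\<close>. These sets are predense below a
  strongly \<open>N\<close>-generic condition, which thus forces that a lower bound of the \<open>q\<^sub>j\<close> decides all of \<open>t\<close>.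
\<close>

section \<open>Small sets\<close>

text \<open>Mere properness gives no hold on the sets made dense here: they are defined from the
  whole sequence of the q_j and need not belong to \<open>N\<close>, while strong genericity covers
  every dense subset of \<open>N \<inter> elts P\<close>. The closure of \<open>Q\<close> is spent
  on one sequence in the ground model, since the extension need not preserve it; this is why all
  conditions of \<open>N \<inter> elts P\<close> share one sequence. Distributivity is asserted
  inside the extension, so its witness is a set of the extension: a \<open>P\<close>-name
  \<open>x\<close> together with \<open>CQ x\<close>, which is forced to be its canonical
  \<open>Q\<close>-name. No generic filter occurs: that \<open>p\<close> forces \<open>q\<close> to
  force something is the formula \<open>Forces\<close> for \<open>Q\<close>, forced by
  \<open>P\<close>. Equality is coded there by a set of triples obeying a recursive clause, so the
  comparison with the product must show that such a set is forced to agree with product equality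
  (\<open>inner_eq_unique\<close>) and that a name for one exists (\<open>inner_eq_exists\<close>).
  Invariance under forced equality is no general property of formulas and is carried along by
  \<open>fmrel\<close> or \<open>resp\<close>.\<close>

definition small :: "'v::zfc set \<Rightarrow> bool" where
  "small A \<longleftrightarrow> (\<exists>x. elts x = A)"

lemma elts_vset [simp]: "small A \<Longrightarrow> elts (vset A) = A"
  unfolding small_def vset_def by (metis (mono_tags, lifting) extensionality theI')

lemma elts_inject: "elts x = elts y \<longleftrightarrow> x = y"
  using extensionality by blast

lemma vset_elts [simp]: "vset (elts x) = x"
  by (simp add: vset_def elts_inject)

lemma small_elts [simp, intro]: "small (elts x)"
  by (auto simp: small_def)

lemma small_subset: "small B \<Longrightarrow> A \<subseteq> B \<Longrightarrow> small A"
proof -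
  assume "small B" "A \<subseteq> B"
  then obtain x where x: "elts x = B" by (auto simp: small_def)
  obtain u where "elts u = {y \<in> elts x. y \<in> A}" using separation[of x "\<lambda>y. y \<in> A"] by blast
  with x \<open>A \<subseteq> B\<close> have "elts u = A" by auto
  then show "small A" by (auto simp: small_def)
qed

lemma small_image [intro]: "small A \<Longrightarrow> small (f ` A)" for f :: "'v::zfc \<Rightarrow> 'v"
  unfolding small_def using replacement by blast

lemma small_doubleton [simp]: "small {x, y}"
  unfolding small_def by (rule pairing)

lemma small_singleton [simp]: "small {x}"
  using small_doubleton[of x x] by simp

lemma small_empty [simp]: "small {}"
  using small_subset[OF small_singleton] by blast

lemma small_UN: "small A \<Longrightarrow> (\<And>x. x \<in> A \<Longrightarrow> small (B x)) \<Longrightarrow> small (\<Union>x\<in>A. B x)" for A :: "'v::zfc set" and B :: "'v \<Rightarrow> 'v set"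
proof -
  assume A: "small A" and B: "\<And>x. x \<in> A \<Longrightarrow> small (B x)"
  obtain u where u: "elts u = (\<lambda>x. vset (B x)) ` A"
    using small_image[OF A] unfolding small_def by blast
  obtain v where "elts v = \<Union> (elts ` elts u)" using union by blast
  then have "elts v = (\<Union>x\<in>A. B x)" using B by (auto simp: u)
  then show ?thesis by (auto simp: small_def)
qed

lemma small_Un [intro]: "small A \<Longrightarrow> small B \<Longrightarrow> small (A \<union> B)"
proof -
  assume "small A" "small B"
  then have "small (\<Union>x\<in>{vset A, vset B}. elts x)" by (intro small_UN) auto
  then show ?thesis using \<open>small A\<close> \<open>small B\<close> by simp
qed

lemma small_insert [simp]: "small A \<Longrightarrow> small (insert x A)"
  using small_Un[of "{x}" A] by simp

lemma small_image2: "small A \<Longrightarrow> small B \<Longrightarrow> small {f x y |x y. x \<in> A \<and> y \<in> B}"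
  for A :: "'v::zfc set" and f :: "'v \<Rightarrow> 'v \<Rightarrow> 'v"
proof -
  assume "small A" "small B"
  then have "small (\<Union>x\<in>A. f x ` B)" by (intro small_UN small_image)
  moreover have "(\<Union>x\<in>A. f x ` B) = {f x y |x y. x \<in> A \<and> y \<in> B}" by auto
  ultimately show ?thesis by simp
qed

lemma small_Pow: "small A \<Longrightarrow> small {x. elts x \<subseteq> A}"
  unfolding small_def using powerset by blast

lemma vset_eq_iff: "small A \<Longrightarrow> small B \<Longrightarrow> vset A = vset B \<longleftrightarrow> A = B"
  by (metis elts_vset)

lemma vpair_inject [simp]: "vpair x y = vpair x' y' \<longleftrightarrow> x = x' \<and> y = y'"
  unfolding vpair_def by (simp add: vset_eq_iff doubleton_eq_iff singleton_insert_inj_eq) metis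

lemma small_vpair_image: "small A \<Longrightarrow> small B \<Longrightarrow> small {vpair x y |x y. x \<in> A \<and> y \<in> B}"
  by (rule small_image2)

lemma elts_induct: "(\<And>x. (\<And>y. y \<in> elts x \<Longrightarrow> \<Phi> y) \<Longrightarrow> \<Phi> x) \<Longrightarrow> \<Phi> (x::'v::zfc)"
  using wf_induct_rule[OF foundation, of \<Phi> x] by blast

lemma mem_irrefl: "x \<notin> elts (x::'v::zfc)"
  using wf_not_refl[OF foundation] by blast

text \<open>The transitive closure is needed because a subname is not a member of a name: in
  \<open>vpair \<sigma> p \<in> elts x\<close> the name \<sigma> lies three membership steps below
  \<open>x\<close>.\<close>

lemma trcl_induct: "(\<And>x. (\<And>y. y \<in> trcl x \<Longrightarrow> \<Phi> y) \<Longrightarrow> \<Phi> x) \<Longrightarrow> \<Phi> (x::'v::zfc)"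
  using wf_induct_rule[OF wf_trancl[OF foundation], of \<Phi> x] by (auto simp: trcl_def)

lemma trcl_elts: "y \<in> elts x \<Longrightarrow> y \<in> trcl x"
  by (auto simp: trcl_def)

lemma trcl_trans: "z \<in> trcl y \<Longrightarrow> y \<in> trcl x \<Longrightarrow> z \<in> trcl x"
  by (auto simp: trcl_def)

lemma trcl_unfold: "trcl x = elts x \<union> (\<Union>y\<in>elts x. trcl y)"
proof -
  have "z \<in> elts x \<or> (\<exists>y\<in>elts x. z \<in> trcl y)" if "z \<in> trcl x" for z
    using that unfolding trcl_def by (auto dest: tranclD2 elim: tranclE)
  then show ?thesis by (auto intro: trcl_elts trcl_trans)
qed

lemma small_trcl: "small (trcl x)"
  by (induction x rule: elts_induct) (subst trcl_unfold, auto intro: small_UN)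

lemma vpair_mem_trcl: "vpair a b \<in> elts x \<Longrightarrow> a \<in> trcl x" "vpair a b \<in> elts x \<Longrightarrow> b \<in> trcl x"
proof -
  assume *: "vpair a b \<in> elts x"
  have "vset {a, b} \<in> elts (vpair a b)" "a \<in> elts (vset {a, b})" "b \<in> elts (vset {a, b})"
    by (auto simp: vpair_def)
  with * show "a \<in> trcl x" "b \<in> trcl x"
    by (meson trcl_elts trcl_trans)+
qed

lemma check_unfold: "check P x = vset {vpair (check P y) p |y p. y \<in> elts x \<and> p \<in> elts P}"
proof -
  have "check P x = vset {vpair (cut (check P) {(y, x). y \<in> elts x} x y) p |y p. y \<in> elts x \<and> p \<in> elts P}"
    unfolding check_def by (subst wfrec[OF foundation]) simp
  also have "{vpair (cut (check P) {(y, x). y \<in> elts x} x y) p |y p. y \<in> elts x \<and> p \<in> elts P}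
      = {vpair (check P y) p |y p. y \<in> elts x \<and> p \<in> elts P}"
    by (auto simp: cut_def; metis)
  finally show ?thesis .
qed

lemma elts_check: "elts (check P x) = {vpair (check P y) p |y p. y \<in> elts x \<and> p \<in> elts P}"
proof -
  have "small {vpair (check P y) p |y p. y \<in> elts x \<and> p \<in> elts P}"
    using small_image2[of "elts x" "elts P" "\<lambda>y p. vpair (check P y) p"] by simp
  then show ?thesis by (subst check_unfold) simp
qed

section \<open>Ordinals and cardinals\<close>

lemma ordinal_elt: "ordinal \<alpha> \<Longrightarrow> \<beta> \<in> elts \<alpha> \<Longrightarrow> ordinal \<beta>"
  unfolding ordinal_def transitive_def by blast

lemma ordinal_trans: "ordinal \<alpha> \<Longrightarrow> \<beta> \<in> elts \<alpha> \<Longrightarrow> \<gamma> \<in> elts \<beta> \<Longrightarrow> \<gamma> \<in> elts \<alpha>"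
  by (auto simp: ordinal_def transitive_def)

text \<open>Double membership induction: if \<alpha> and \<beta> were incomparable, each member of
  one would be comparable with the other and hence belong to it, so extensionality would make them
  equal.\<close>

lemma ordinal_linear: "ordinal \<alpha> \<Longrightarrow> ordinal \<beta> \<Longrightarrow> \<alpha> \<in> elts \<beta> \<or> \<alpha> = \<beta> \<or> \<beta> \<in> elts \<alpha>"
proof (induction \<alpha> arbitrary: \<beta> rule: elts_induct)
  case (1 \<alpha>)
  note IH1 = 1
  show ?case using \<open>ordinal \<beta>\<close>
  proof (induction \<beta> rule: elts_induct)
    case (1 \<beta>)
    show ?case
    proof (rule ccontr)
      assume *: "\<not> ?case"
      have "elts \<alpha> = elts \<beta>"
      proof
        show "elts \<alpha> \<subseteq> elts \<beta>"
        proof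
          fix \<gamma> assume "\<gamma> \<in> elts \<alpha>"
          then show "\<gamma> \<in> elts \<beta>"
            using IH1(1)[of \<gamma> \<beta>] IH1(2) 1(2) * by (metis ordinal_elt ordinal_trans)
        qed
        show "elts \<beta> \<subseteq> elts \<alpha>"
        proof
          fix \<gamma> assume "\<gamma> \<in> elts \<beta>"
          then show "\<gamma> \<in> elts \<alpha>"
            using 1(1)[of \<gamma>] IH1(2) 1(2) * by (metis ordinal_elt ordinal_trans)
        qed
      qed
      with * show False by (simp add: elts_inject)
    qed
  qed
qed

text \<open>Mostowski collapse of a well-order of \<open>A\<close>, which HOL's choice provides;
  smallness of \<open>A\<close> turns the collapsing values into sets.\<close>

lemma ex_ordinal_eqpoll:
  fixes A :: "'v::zfc set"
  assumes "small A"
  shows "\<exists>\<alpha>::'v. ordinal \<alpha> \<and> elts \<alpha> \<approx> A"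
proof -
  obtain r where r: "well_order_on A r" using well_order_on by blast
  define s where "s = r - Id"
  have wfs: "wf s" using r by (simp add: well_order_on_def s_def)
  have tr: "trans s" using r
    by (auto simp: s_def well_order_on_def linear_order_on_def partial_order_on_def preorder_on_def
        intro: trans_diff_Id)
  have tot: "(x, y) \<in> s \<or> (y, x) \<in> s" if "x \<in> A" "y \<in> A" "x \<noteq> y" for x y
    using r that by (auto simp: s_def well_order_on_def linear_order_on_def total_on_def)
  have sA: "x \<in> A" "y \<in> A" if "(x, y) \<in> s" for x y
    using r that by (auto simp: s_def well_order_on_def linear_order_on_def partial_order_on_def
        preorder_on_def refl_on_def)
  define f :: "'v \<Rightarrow> 'v" where "f = wfrec s (\<lambda>f x. vset (f ` {y. (y, x) \<in> s}))"
  have "f x = vset (cut f s x ` {y. (y, x) \<in> s})" for x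
    unfolding f_def by (subst wfrec[OF wfs]) simp
  moreover have "cut f s x ` {y. (y, x) \<in> s} = f ` {y. (y, x) \<in> s}" for x
    by (auto simp: cut_def)
  moreover have "small (f ` {y. (y, x) \<in> s})" for x
    using assms by (intro small_image small_subset[OF assms]) (auto dest: sA)
  ultimately have elf: "elts (f x) = f ` {y. (y, x) \<in> s}" for x by (metis elts_vset)
  have smA: "small (f ` A)" using assms by auto
  have sub: "transitive (f x)" for x
    unfolding transitive_def using transD[OF tr] by (auto simp: elf)
  have "ordinal (vset (f ` A))"
    using sub sA by (auto simp: ordinal_def smA transitive_def elf)
  \<comment> \<open>If \<open>x\<close> precedes \<open>y\<close>, then
    \<open>f x \<in> elts (f y)\<close>, so equal values would make a set a member of
    itself.\<close>
  moreover have "inj_on f A"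
  proof
    fix x y assume "x \<in> A" "y \<in> A" "f x = f y"
    then show "x = y"
      using tot[of x y] elf[of x] elf[of y] mem_irrefl[of "f x"]
      by (metis (mono_tags, lifting) image_eqI mem_Collect_eq)
  qed
  then have "f ` A \<approx> A" by (simp add: inj_on_image_eqpoll_self)
  ultimately show ?thesis using smA by (intro exI[of _ "vset (f ` A)"]) simp
qed

lemma ex_cardinal_eqpoll:
  fixes A :: "'v::zfc set"
  assumes "small A"
  shows "\<exists>\<kappa>::'v. cardinal \<kappa> \<and> elts \<kappa> \<approx> A"
proof -
  obtain \<alpha> :: 'v where "ordinal \<alpha> \<and> elts \<alpha> \<approx> A" using ex_ordinal_eqpoll[OF assms] by blast
  then have "\<alpha> \<in> {\<alpha>. ordinal \<alpha> \<and> elts \<alpha> \<approx> A}" by simp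
  from foundation[unfolded wf_eq_minimal, rule_format, OF this] obtain \<kappa> :: 'v where \<kappa>: "ordinal \<kappa> \<and> elts \<kappa> \<approx> A"
    and min: "\<And>\<beta>. \<beta> \<in> elts \<kappa> \<Longrightarrow> \<not> (ordinal \<beta> \<and> elts \<beta> \<approx> A)"
    by auto
  have "elts \<beta> \<prec> elts \<kappa>" if "\<beta> \<in> elts \<kappa>" for \<beta>
  proof -
    have "elts \<beta> \<lesssim> elts \<kappa>" using \<kappa> that
      by (auto simp: ordinal_def transitive_def intro: subset_imp_lepoll)
    moreover have "\<not> elts \<beta> \<approx> elts \<kappa>"
      using min[OF that] \<kappa> that by (meson eqpoll_trans ordinal_elt)
    ultimately show ?thesis by (simp add: lesspoll_def)
  qed
  with \<kappa> show ?thesis by (auto simp: cardinal_def)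
qed

text \<open>Cantor's theorem for the cardinal of the power set. It is available in HOL form because
  every HOL subset of a small set is the extension of a set.\<close>

lemma ex_cardinal_gt:
  fixes A :: "'v::zfc set"
  assumes "small A"
  shows "\<exists>\<kappa>::'v. cardinal \<kappa> \<and> A \<prec> elts \<kappa>"
proof -
  obtain \<kappa> :: 'v where \<kappa>: "cardinal \<kappa>" "elts \<kappa> \<approx> {x. elts x \<subseteq> A}"
    using ex_cardinal_eqpoll[OF small_Pow[OF assms]] by blast
  have "elts ` {x. elts x \<subseteq> A} = Pow A"
  proof
    show "Pow A \<subseteq> elts ` {x. elts x \<subseteq> A}"
    proof
      fix B assume "B \<in> Pow A"
      then have "elts (vset B) = B" using small_subset[OF assms] by simp
      then show "B \<in> elts ` {x. elts x \<subseteq> A}" using \<open>B \<in> Pow A\<close> by (metis (mono_tags, lifting) PowD image_eqI mem_Collect_eq)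
    qed
  qed auto
  moreover have "inj_on elts {x. elts x \<subseteq> A}" by (auto simp: inj_on_def elts_inject)
  ultimately have "{x. elts x \<subseteq> A} \<approx> Pow A" by (metis eqpoll_sym inj_on_image_eqpoll_self)
  with \<kappa> have "Pow A \<approx> elts \<kappa>" by (meson eqpoll_sym eqpoll_trans)
  then have "A \<prec> elts \<kappa>" using lesspoll_Pow_self lesspoll_trans2 by (metis eqpoll_imp_lepoll)
  with \<kappa> show ?thesis by blast
qed

section \<open>Natural numbers\<close>

primrec num :: "nat \<Rightarrow> 'v::zfc" where
  "num 0 = vset {}"
| "num (Suc n) = vset (insert (num n) (elts (num n)))"

lemma small_range_num: "small (range (num :: nat \<Rightarrow> 'v::zfc))"
proof -
  obtain w :: 'v where w: "\<exists>z\<in>elts w. elts z = {}"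
    "\<forall>x\<in>elts w. \<exists>y\<in>elts w. elts y = insert x (elts x)"
    using infinity by blast
  have "num n \<in> elts w" for n
  proof (induction n)
    case 0
    then show ?case using w(1) by (metis num.simps(1) vset_elts)
  next
    case (Suc n)
    then show ?case using w(2) by (metis num.simps(2) vset_elts)
  qed
  then show ?thesis by (intro small_subset[OF small_elts[of w]]) auto
qed

definition omega :: "'v::zfc" where
  "omega = vset (range num)"

lemma elts_omega: "elts omega = range num"
  by (simp add: omega_def small_range_num)

lemma elts_num_Suc [simp]: "elts (num (Suc n)) = insert (num n) (elts (num n))"
  by simp

lemma elts_num_subset: "elts (num n) \<subseteq> range num"
  by (induction n) auto

lemma transitive_num: "transitive (num n)"
  by (induction n) (auto simp: transitive_def)

lemma ordinal_omega: "ordinal omega"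
  using elts_num_subset transitive_num by (fastforce simp: ordinal_def transitive_def elts_omega)

lemma ordinal_subset_omega:
  assumes "ordinal \<alpha>" "omega \<notin> elts \<alpha>"
  shows "elts \<alpha> \<subseteq> range num"
  using ordinal_linear[OF assms(1) ordinal_omega] assms elts_num_subset by (auto simp: elts_omega)

section \<open>Truth in the universe\<close>

lemma sat_Disj [simp]: "sat (Disj \<phi> \<psi>) \<longleftrightarrow> sat \<phi> \<or> sat \<psi>"
  by (simp add: Disj_def)

lemma sat_Imp [simp]: "sat (Imp \<phi> \<psi>) \<longleftrightarrow> (sat \<phi> \<longrightarrow> sat \<psi>)"
  by (simp add: Imp_def)

lemma sat_Iff [simp]: "sat (Iff \<phi> \<psi>) \<longleftrightarrow> (sat \<phi> \<longleftrightarrow> sat \<psi>)"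
  by (auto simp: Iff_def)

lemma sat_Exists [simp]: "sat (Exists F) \<longleftrightarrow> (\<exists>x. sat (F x))"
  by (simp add: Exists_def)

lemma sat_BForall [simp]: "sat (BForall a F) \<longleftrightarrow> (\<forall>x\<in>elts a. sat (F x))"
  by (auto simp: BForall_def)

lemma sat_BExists [simp]: "sat (BExists a F) \<longleftrightarrow> (\<exists>x\<in>elts a. sat (F x))"
  by (auto simp: BExists_def)

lemma sat_IsUpair [simp]: "sat (IsUpair x y z) \<longleftrightarrow> z = vset {x, y}"
proof -
  have "sat (IsUpair x y z) \<longleftrightarrow> elts z = elts (vset {x, y})" by (auto simp: IsUpair_def)
  then show ?thesis by (simp only: elts_inject)
qed

lemma sat_IsPair [simp]: "sat (IsPair x y z) \<longleftrightarrow> z = vpair x y"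
  by (simp add: IsPair_def vpair_def)

lemma sat_PairIn [simp]: "sat (PairIn x y r) \<longleftrightarrow> vpair x y \<in> elts r"
  by (simp add: PairIn_def)

lemma sat_TripleIn [simp]: "sat (TripleIn x y z r) \<longleftrightarrow> vpair x (vpair y z) \<in> elts r"
  by (simp add: TripleIn_def)

lemma sat_BelowForall [simp]:
  "sat (BelowForall P le p F) \<longleftrightarrow> (\<forall>q\<in>elts P. leq le q p \<longrightarrow> sat (F q))"
  by (simp add: BelowForall_def leq_def)

lemma sat_BelowExists [simp]:
  "sat (BelowExists P le p F) \<longleftrightarrow> (\<exists>q\<in>elts P. leq le q p \<and> sat (F q))"
  by (simp add: BelowExists_def leq_def)

section \<open>The forcing relation\<close>

locale forcing =
  fixes P R :: "'v::zfc"
  assumes poset: "forcing_poset P R"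
begin

abbreviation below :: "'v \<Rightarrow> 'v \<Rightarrow> bool" (infix "\<preceq>" 50) where
  "p \<preceq> q \<equiv> leq R p q"

lemma below_cond: "p \<preceq> q \<Longrightarrow> p \<in> elts P" "p \<preceq> q \<Longrightarrow> q \<in> elts P"
proof -
  have "elts R \<subseteq> {vpair p q |p q. p \<in> elts P \<and> q \<in> elts P}"
    using poset by (simp add: forcing_poset_def)
  then show "p \<preceq> q \<Longrightarrow> p \<in> elts P" "p \<preceq> q \<Longrightarrow> q \<in> elts P"
    unfolding leq_def by force+
qed

lemma below_refl [simp]: "p \<in> elts P \<Longrightarrow> p \<preceq> p"
  using poset unfolding forcing_poset_def by blast

lemma below_trans: "p \<preceq> q \<Longrightarrow> q \<preceq> r \<Longrightarrow> p \<preceq> r"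
  using poset below_cond unfolding forcing_poset_def by blast

text \<open>Semantic counterpart of \<open>DenseBelow\<close>. No bound by \<open>elts P\<close> is
  written since \<open>leq\<close> relates only conditions; for \<open>p\<close> outside
  \<open>elts P\<close> it is vacuously true, which is why \<open>dns_ex\<close> asks for a
  condition.\<close>

definition dns :: "'v \<Rightarrow> ('v \<Rightarrow> bool) \<Rightarrow> bool" where
  "dns p \<Phi> \<longleftrightarrow> (\<forall>q. q \<preceq> p \<longrightarrow> (\<exists>r. r \<preceq> q \<and> \<Phi> r))"

lemma dnsI: "(\<And>q. q \<preceq> p \<Longrightarrow> \<exists>r. r \<preceq> q \<and> \<Phi> r) \<Longrightarrow> dns p \<Phi>"
  by (simp add: dns_def)

lemma dnsD: "dns p \<Phi> \<Longrightarrow> q \<preceq> p \<Longrightarrow> \<exists>r. r \<preceq> q \<and> \<Phi> r"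
  by (simp add: dns_def)

lemma dnsE:
  assumes "dns p \<Phi>" "q \<preceq> p"
  obtains r where "r \<preceq> q" "r \<preceq> p" "\<Phi> r"
  using dnsD[OF assms] below_trans assms(2) by blast

lemma dns_below: "dns p \<Phi> \<Longrightarrow> q \<preceq> p \<Longrightarrow> dns q \<Phi>"
  unfolding dns_def using below_trans by blast

lemma dns_dns: "dns p (\<lambda>r. dns r \<Phi>) \<Longrightarrow> dns p \<Phi>"
  unfolding dns_def using below_trans below_refl below_cond by meson

lemma dns_mono: "dns p \<Phi> \<Longrightarrow> (\<And>r. r \<preceq> p \<Longrightarrow> \<Phi> r \<Longrightarrow> \<Psi> r) \<Longrightarrow> dns p \<Psi>"
  unfolding dns_def using below_trans by meson

lemma dns_cong: "(\<And>r. r \<preceq> p \<Longrightarrow> \<Phi> r \<longleftrightarrow> \<Psi> r) \<Longrightarrow> dns p \<Phi> \<longleftrightarrow> dns p \<Psi>"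
  using dns_mono[of p \<Phi> \<Psi>] dns_mono[of p \<Psi> \<Phi>] by blast

lemma dns_all: "(\<And>r. r \<preceq> p \<Longrightarrow> \<Phi> r) \<Longrightarrow> dns p \<Phi>"
  unfolding dns_def using below_trans below_refl below_cond by meson

lemma dns_ex: "dns p \<Phi> \<Longrightarrow> p \<in> elts P \<Longrightarrow> \<exists>r. r \<preceq> p \<and> \<Phi> r"
  by (simp add: dns_def)

lemma sat_DenseBelow [simp]: "sat (DenseBelow P R p F) \<longleftrightarrow> dns p (\<lambda>r. sat (F r))"
  unfolding DenseBelow_def dns_def using below_cond by simp blast

text \<open>\<open>IsName\<close> asserts that some set closed under subnames exists; the least
  fixed point replaces that witness by a recursive description, and \<open>sat_IsName\<close> shows
  that the two agree.\<close>

inductive isname :: "'v \<Rightarrow> bool" where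
  isnameI: "(\<And>z. z \<in> elts x \<Longrightarrow> \<exists>\<sigma> p. z = vpair \<sigma> p \<and> p \<in> elts P \<and> isname \<sigma>) \<Longrightarrow> isname x"

lemma isnameD: "isname x \<Longrightarrow> z \<in> elts x \<Longrightarrow> \<exists>\<sigma> p. z = vpair \<sigma> p \<and> p \<in> elts P \<and> isname \<sigma>"
  by (erule isname.cases) blast

lemma isname_pairD: "isname x \<Longrightarrow> vpair \<sigma> p \<in> elts x \<Longrightarrow> isname \<sigma>"
  "isname x \<Longrightarrow> vpair \<sigma> p \<in> elts x \<Longrightarrow> p \<in> elts P"
  by (force dest: isnameD)+

text \<open>Source of the closed sets that \<open>IsName\<close> and \<open>ForcesEq\<close> ask
  for. The transitive closure also contains pairs and conditions, hence the restriction to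
  names.\<close>

definition subnames :: "'v \<Rightarrow> 'v set" where
  "subnames \<tau> = {x. isname x \<and> (x = \<tau> \<or> x \<in> trcl \<tau>)}"

lemma small_subnames: "small (subnames \<tau>)"
  by (rule small_subset[of "insert \<tau> (trcl \<tau>)"]) (auto simp: subnames_def small_trcl)

lemma subnames_self: "isname \<tau> \<Longrightarrow> \<tau> \<in> subnames \<tau>"
  by (simp add: subnames_def)

lemma subnames_isname: "x \<in> subnames \<tau> \<Longrightarrow> isname x"
  by (simp add: subnames_def)

lemma subnames_step: "x \<in> subnames \<tau> \<Longrightarrow> vpair y p \<in> elts x \<Longrightarrow> y \<in> subnames \<tau>"
  unfolding subnames_def using isname_pairD vpair_mem_trcl trcl_trans by blast

lemma sat_NameClosed: "sat (NameClosed P D) \<longleftrightarrow>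
    (\<forall>x\<in>elts D. \<forall>z\<in>elts x. \<exists>\<sigma>\<in>elts D. \<exists>p\<in>elts P. z = vpair \<sigma> p)"
  by (simp add: NameClosed_def)

lemma NameClosed_isname: "sat (NameClosed P D) \<Longrightarrow> x \<in> elts D \<Longrightarrow> isname x"
proof (induction x rule: trcl_induct)
  case (1 x)
  show ?case
  proof (rule isnameI)
    fix z assume z: "z \<in> elts x"
    with 1 obtain \<sigma> p where *: "\<sigma> \<in> elts D" "p \<in> elts P" "z = vpair \<sigma> p"
      unfolding sat_NameClosed by blast
    with z have "\<sigma> \<in> trcl x" by (auto intro: vpair_mem_trcl)
    with * 1 show "\<exists>\<sigma> p. z = vpair \<sigma> p \<and> p \<in> elts P \<and> isname \<sigma>" by blast
  qed
qed

lemma NameClosed_subnames: "sat (NameClosed P (vset (subnames \<tau> \<union> subnames \<sigma>)))"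
proof -
  have "small (subnames \<tau> \<union> subnames \<sigma>)" by (intro small_Un small_subnames)
  then show ?thesis
    unfolding sat_NameClosed using isnameD subnames_isname subnames_step by (simp; metis Un_iff)
qed

lemma sat_IsName [simp]: "sat (IsName P \<tau>) \<longleftrightarrow> isname \<tau>"
proof
  show "sat (IsName P \<tau>) \<Longrightarrow> isname \<tau>" by (auto simp: IsName_def NameClosed_isname)
  assume "isname \<tau>"
  moreover have "small (subnames \<tau> \<union> subnames \<tau>)" by (intro small_Un small_subnames)
  ultimately show "sat (IsName P \<tau>)"
    unfolding IsName_def using NameClosed_subnames[of \<tau> \<tau>] subnames_self by auto
qed

text \<open>Recursion on names, written as a least fixed point; the recursive calls are positive and
  concern listed subnames. Nothing requires \<open>p\<close> to be a condition, and for
  \<open>p\<close> outside \<open>elts P\<close> the relation is vacuously true.\<close>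

inductive feq :: "'v \<Rightarrow> 'v \<Rightarrow> 'v \<Rightarrow> bool" where
  feqI: "(\<And>\<pi> s q. vpair \<pi> s \<in> elts \<tau> \<Longrightarrow> q \<preceq> p \<Longrightarrow>
            \<exists>r. r \<preceq> q \<and> (r \<preceq> s \<longrightarrow> (\<exists>\<pi>' s'. vpair \<pi>' s' \<in> elts \<sigma> \<and> r \<preceq> s' \<and> feq r \<pi> \<pi>'))) \<Longrightarrow>
         (\<And>\<pi>' s' q. vpair \<pi>' s' \<in> elts \<sigma> \<Longrightarrow> q \<preceq> p \<Longrightarrow>
            \<exists>r. r \<preceq> q \<and> (r \<preceq> s' \<longrightarrow> (\<exists>\<pi> s. vpair \<pi> s \<in> elts \<tau> \<and> r \<preceq> s \<and> feq r \<pi> \<pi>'))) \<Longrightarrow>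
         feq p \<tau> \<sigma>"

definition fmem :: "'v \<Rightarrow> 'v \<Rightarrow> 'v \<Rightarrow> bool" where
  "fmem p \<tau> \<sigma> \<longleftrightarrow> dns p (\<lambda>r. \<exists>\<pi> s. vpair \<pi> s \<in> elts \<sigma> \<and> r \<preceq> s \<and> feq r \<pi> \<tau>)"

lemma feq_unfold: "feq p \<tau> \<sigma> \<longleftrightarrow>
    (\<forall>\<pi> s. vpair \<pi> s \<in> elts \<tau> \<longrightarrow>
       dns p (\<lambda>r. r \<preceq> s \<longrightarrow> (\<exists>\<pi>' s'. vpair \<pi>' s' \<in> elts \<sigma> \<and> r \<preceq> s' \<and> feq r \<pi> \<pi>'))) \<and>
    (\<forall>\<pi>' s'. vpair \<pi>' s' \<in> elts \<sigma> \<longrightarrow>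
       dns p (\<lambda>r. r \<preceq> s' \<longrightarrow> (\<exists>\<pi> s. vpair \<pi> s \<in> elts \<tau> \<and> r \<preceq> s \<and> feq r \<pi> \<pi>')))"
  by (subst feq.simps) (auto simp: dns_def)

lemma feq_sym: "feq p \<tau> \<sigma> \<Longrightarrow> feq p \<sigma> \<tau>"
proof (induction rule: feq.induct)
  case (feqI \<tau> p \<sigma>)
  show ?case
    by (rule feq.feqI) (use feqI in blast)+
qed

lemma feq_commute: "feq p \<tau> \<sigma> \<longleftrightarrow> feq p \<sigma> \<tau>"
  using feq_sym by blast

text \<open>The side condition moves out of the density statement: a \<open>q\<close> not below
  \<open>s\<close> is its own witness, and if \<open>q\<close> is below \<open>s\<close>, so are all
  its extensions.\<close>

lemma dns_imp_iff:
  "dns p (\<lambda>r. r \<preceq> s \<longrightarrow> \<Phi> r) \<longleftrightarrow> (\<forall>q. q \<preceq> p \<longrightarrow> q \<preceq> s \<longrightarrow> dns q \<Phi>)"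
proof
  assume "dns p (\<lambda>r. r \<preceq> s \<longrightarrow> \<Phi> r)"
  then show "\<forall>q. q \<preceq> p \<longrightarrow> q \<preceq> s \<longrightarrow> dns q \<Phi>"
    unfolding dns_def using below_trans by meson
next
  assume *: "\<forall>q. q \<preceq> p \<longrightarrow> q \<preceq> s \<longrightarrow> dns q \<Phi>"
  show "dns p (\<lambda>r. r \<preceq> s \<longrightarrow> \<Phi> r)"
  proof (rule dnsI)
    fix q assume q: "q \<preceq> p"
    show "\<exists>r. r \<preceq> q \<and> (r \<preceq> s \<longrightarrow> \<Phi> r)"
    proof (cases "q \<preceq> s")
      case True
      with * q show ?thesis unfolding dns_def using below_refl below_cond by blast
    next
      case False
      with q show ?thesis using below_refl below_cond by blast
    qed
  qed
qed

text \<open>Forced extensionality for the listed members. By \<open>dns_imp_iff\<close> the two-step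
  clause of the definition collapses into \<open>fmem\<close>, which behaves well under density; the
  congruence lemmas argue from this form.\<close>

lemma feq_iff: "feq p \<tau> \<sigma> \<longleftrightarrow>
    (\<forall>\<pi> s q. vpair \<pi> s \<in> elts \<tau> \<longrightarrow> q \<preceq> p \<longrightarrow> q \<preceq> s \<longrightarrow> fmem q \<pi> \<sigma>) \<and>
    (\<forall>\<pi> s q. vpair \<pi> s \<in> elts \<sigma> \<longrightarrow> q \<preceq> p \<longrightarrow> q \<preceq> s \<longrightarrow> fmem q \<pi> \<tau>)"
proof -
  have 1: "(\<exists>\<pi>' s'. vpair \<pi>' s' \<in> elts \<sigma> \<and> r \<preceq> s' \<and> feq r \<pi> \<pi>') \<longleftrightarrow>
     (\<exists>\<pi>' s'. vpair \<pi>' s' \<in> elts \<sigma> \<and> r \<preceq> s' \<and> feq r \<pi>' \<pi>)" for r \<pi> \<sigma>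
    using feq_sym by blast
  show ?thesis
    unfolding feq_unfold[of p \<tau> \<sigma>] dns_imp_iff fmem_def 1 by blast
qed

lemma feqE1: "feq p \<tau> \<sigma> \<Longrightarrow> vpair \<pi> s \<in> elts \<tau> \<Longrightarrow> q \<preceq> p \<Longrightarrow> q \<preceq> s \<Longrightarrow> fmem q \<pi> \<sigma>"
  and feqE2: "feq p \<tau> \<sigma> \<Longrightarrow> vpair \<pi> s \<in> elts \<sigma> \<Longrightarrow> q \<preceq> p \<Longrightarrow> q \<preceq> s \<Longrightarrow> fmem q \<pi> \<tau>"
  using feq_iff by blast+

lemma feq_mono: "feq p \<tau> \<sigma> \<Longrightarrow> q \<preceq> p \<Longrightarrow> feq q \<tau> \<sigma>"
  unfolding feq_iff[of _ \<tau> \<sigma>] using below_trans by blast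

lemma fmem_mono: "fmem p \<tau> \<sigma> \<Longrightarrow> q \<preceq> p \<Longrightarrow> fmem q \<tau> \<sigma>"
  unfolding fmem_def by (rule dns_below)

lemma fmem_dns: "dns p (\<lambda>r. fmem r \<tau> \<sigma>) \<Longrightarrow> fmem p \<tau> \<sigma>"
  unfolding fmem_def by (rule dns_dns)

lemma feq_dns: assumes "dns p (\<lambda>r. feq r \<tau> \<sigma>)" shows "feq p \<tau> \<sigma>"
  unfolding feq_iff
proof (intro conjI allI impI)
  fix \<pi> s q assume *: "vpair \<pi> s \<in> elts \<tau>" "q \<preceq> p" "q \<preceq> s"
  show "fmem q \<pi> \<sigma>"
    using dns_below[OF assms *(2)] *
    by (intro fmem_dns, elim dns_mono) (meson below_trans below_refl below_cond feqE1)
next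
  fix \<pi> s q assume *: "vpair \<pi> s \<in> elts \<sigma>" "q \<preceq> p" "q \<preceq> s"
  show "fmem q \<pi> \<tau>"
    using dns_below[OF assms *(2)] *
    by (intro fmem_dns, elim dns_mono) (meson below_trans below_refl below_cond feqE2)
qed

lemma feq_refl [simp]: "feq p \<tau> \<tau>"
proof (induction \<tau> arbitrary: p rule: trcl_induct)
  case (1 \<tau>)
  have "fmem q \<pi> \<tau>" if "vpair \<pi> s \<in> elts \<tau>" "q \<preceq> s" for q \<pi> s
    unfolding fmem_def using that 1[of \<pi>] vpair_mem_trcl below_trans by (intro dns_all) blast
  then show ?case by (auto simp: feq_iff[of p])
qed

lemma fmem_elt: "vpair \<pi> s \<in> elts \<tau> \<Longrightarrow> q \<preceq> s \<Longrightarrow> fmem q \<pi> \<tau>"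
  using feqE1[of q \<tau> \<tau> \<pi> s q] below_cond by simp

text \<open>The induction hypothesis is always applied with a subname of \<tau> in first position.
  For a member of \<tau> symmetry arranges this; a member of \<rho> is traced back through \<sigma>
  to a subname of \<tau>.\<close>

lemma feq_trans: "feq p \<tau> \<sigma> \<Longrightarrow> feq p \<sigma> \<rho> \<Longrightarrow> feq p \<tau> \<rho>"
proof (induction \<tau> arbitrary: p \<sigma> \<rho> rule: trcl_induct)
  case (1 \<tau>)
  show ?case
    unfolding feq_iff[of p \<tau> \<rho>]
  proof (intro conjI allI impI)
    fix \<pi> s q assume *: "vpair \<pi> s \<in> elts \<tau>" "q \<preceq> p" "q \<preceq> s"
    have "fmem q \<pi> \<sigma>" using feqE1 1(2) * by blast
    then show "fmem q \<pi> \<rho>"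
      unfolding fmem_def[of q \<pi> \<sigma>]
    proof (intro fmem_dns, elim dns_mono exE conjE)
      fix r \<pi>' s' assume r: "r \<preceq> q" "vpair \<pi>' s' \<in> elts \<sigma>" "r \<preceq> s'" "feq r \<pi>' \<pi>"
      then have "fmem r \<pi>' \<rho>" using feqE1[OF 1(3)] * below_trans by blast
      then show "fmem r \<pi> \<rho>"
        unfolding fmem_def
        using 1(1)[of \<pi>] r(4) *(1) by (elim dns_mono) (meson feq_sym feq_mono vpair_mem_trcl)
    qed
  next
    fix \<pi> s q assume *: "vpair \<pi> s \<in> elts \<rho>" "q \<preceq> p" "q \<preceq> s"
    have "fmem q \<pi> \<sigma>" using feqE2 1(3) * by blast
    then show "fmem q \<pi> \<tau>"
      unfolding fmem_def[of q \<pi> \<sigma>]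
    proof (intro fmem_dns, elim dns_mono exE conjE)
      fix r \<pi>' s' assume r: "r \<preceq> q" "vpair \<pi>' s' \<in> elts \<sigma>" "r \<preceq> s'" "feq r \<pi>' \<pi>"
      then have "fmem r \<pi>' \<tau>" using feqE2[OF 1(2)] * below_trans by blast
      then show "fmem r \<pi> \<tau>"
        unfolding fmem_def
        using 1(1) r(4) *(1) by (elim dns_mono) (meson feq_mono vpair_mem_trcl)
    qed
  qed
qed

lemma fmem_cong1: "feq p \<tau> \<tau>' \<Longrightarrow> fmem p \<tau> \<sigma> \<Longrightarrow> fmem p \<tau>' \<sigma>"
  unfolding fmem_def by (elim dns_mono) (meson feq_mono feq_trans)

lemma fmem_cong2: "feq p \<sigma> \<sigma>' \<Longrightarrow> fmem p \<tau> \<sigma> \<Longrightarrow> fmem p \<tau> \<sigma>'"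
  unfolding fmem_def[of p \<tau> \<sigma>]
  by (intro fmem_dns, elim dns_mono exE conjE) (meson feqE1 fmem_cong1)

lemma fmem_cong: "feq p \<tau> \<tau>' \<Longrightarrow> feq p \<sigma> \<sigma>' \<Longrightarrow> fmem p \<tau> \<sigma> \<longleftrightarrow> fmem p \<tau>' \<sigma>'"
  by (meson feq_sym fmem_cong1 fmem_cong2)

lemma feq_cong: "feq p \<tau> \<tau>' \<Longrightarrow> feq p \<sigma> \<sigma>' \<Longrightarrow> feq p \<tau> \<sigma> \<longleftrightarrow> feq p \<tau>' \<sigma>'"
  by (meson feq_sym feq_trans)

lemma feq_extI:
  assumes "isname \<tau>" "isname \<sigma>"
    and "\<And>\<pi> q. isname \<pi> \<Longrightarrow> q \<preceq> p \<Longrightarrow> fmem q \<pi> \<tau> \<longleftrightarrow> fmem q \<pi> \<sigma>"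
  shows "feq p \<tau> \<sigma>"
  unfolding feq_iff using assms fmem_elt isname_pairD by blast

subsection \<open>Connectives and quantifiers\<close>

abbreviation frc :: "'v \<Rightarrow> 'v fm \<Rightarrow> bool" where
  "frc p \<phi> \<equiv> sat (Forces P R \<phi> p)"

lemma sat_ForcesSubClause:
  "sat (ForcesSubClause P R K p \<tau> \<sigma>) \<longleftrightarrow> (\<forall>\<pi> s. vpair \<pi> s \<in> elts \<tau> \<longrightarrow>
     dns p (\<lambda>r. r \<preceq> s \<longrightarrow> (\<exists>\<pi>' s'. vpair \<pi>' s' \<in> elts \<sigma> \<and> r \<preceq> s' \<and> sat (K r \<pi> \<pi>'))))"
  by (simp add: ForcesSubClause_def leq_def)

text \<open>\<open>K\<close> replaces the recursive call and has to agree with \<open>feq\<close>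
  only at listed subnames and below \<open>p\<close>. In \<open>sat_ForcesEq\<close> it is
  membership in the coded set of triples.\<close>

lemma feq_unfold_rel:
  assumes "\<And>r \<pi> s \<pi>' s'. r \<preceq> p \<Longrightarrow> vpair \<pi> s \<in> elts \<tau> \<Longrightarrow> vpair \<pi>' s' \<in> elts \<sigma> \<Longrightarrow> K r \<pi> \<pi>' \<longleftrightarrow> feq r \<pi> \<pi>'"
  shows "feq p \<tau> \<sigma> \<longleftrightarrow>
    (\<forall>\<pi> s. vpair \<pi> s \<in> elts \<tau> \<longrightarrow>
       dns p (\<lambda>r. r \<preceq> s \<longrightarrow> (\<exists>\<pi>' s'. vpair \<pi>' s' \<in> elts \<sigma> \<and> r \<preceq> s' \<and> K r \<pi> \<pi>'))) \<and>
    (\<forall>\<pi>' s'. vpair \<pi>' s' \<in> elts \<sigma> \<longrightarrow>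
       dns p (\<lambda>r. r \<preceq> s' \<longrightarrow> (\<exists>\<pi> s. vpair \<pi> s \<in> elts \<tau> \<and> r \<preceq> s \<and> K r \<pi> \<pi>')))"
proof -
  have "dns p (\<lambda>r. r \<preceq> s \<longrightarrow> (\<exists>\<pi>' s'. vpair \<pi>' s' \<in> elts \<sigma> \<and> r \<preceq> s' \<and> feq r \<pi> \<pi>')) \<longleftrightarrow>
      dns p (\<lambda>r. r \<preceq> s \<longrightarrow> (\<exists>\<pi>' s'. vpair \<pi>' s' \<in> elts \<sigma> \<and> r \<preceq> s' \<and> K r \<pi> \<pi>'))"
    if "vpair \<pi> s \<in> elts \<tau>" for \<pi> s
    by (rule dns_cong) (use assms that in blast)
  moreover have "dns p (\<lambda>r. r \<preceq> s' \<longrightarrow> (\<exists>\<pi> s. vpair \<pi> s \<in> elts \<tau> \<and> r \<preceq> s \<and> feq r \<pi> \<pi>')) \<longleftrightarrow>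
      dns p (\<lambda>r. r \<preceq> s' \<longrightarrow> (\<exists>\<pi> s. vpair \<pi> s \<in> elts \<tau> \<and> r \<preceq> s \<and> K r \<pi> \<pi>'))"
    if "vpair \<pi>' s' \<in> elts \<sigma>" for \<pi>' s'
    by (rule dns_cong) (use assms that in blast)
  ultimately show ?thesis
    unfolding feq_unfold[of p \<tau> \<sigma>] by (simp cong: imp_cong)
qed

text \<open>The clause determines \<open>E\<close> on \<open>D\<close> by induction along subnames,
  so any witness computes \<open>feq\<close>; conversely the triples on which \<open>feq\<close>
  holds, over the subnames of both names, form a witness. \<open>E\<close> is constrained at
  conditions only, hence the assumption on \<open>p\<close>.\<close>

lemma sat_ForcesEq:
  assumes "p \<in> elts P"
  shows "sat (ForcesEq P R p \<tau> \<sigma>) \<longleftrightarrow> isname \<tau> \<and> isname \<sigma> \<and> feq p \<tau> \<sigma>"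
proof
  assume "sat (ForcesEq P R p \<tau> \<sigma>)"
  then obtain D E where D: "sat (NameClosed P D)" "\<tau> \<in> elts D" "\<sigma> \<in> elts D"
    and E: "\<And>q x y. q \<in> elts P \<Longrightarrow> x \<in> elts D \<Longrightarrow> y \<in> elts D \<Longrightarrow>
        vpair q (vpair x y) \<in> elts E \<longleftrightarrow> sat (ForcesEqClause P R E q x y)"
    and p: "vpair p (vpair \<tau> \<sigma>) \<in> elts E"
    unfolding ForcesEq_def by simp blast
  have Dstep: "\<pi> \<in> elts D" if "x \<in> elts D" "vpair \<pi> s \<in> elts x" for x \<pi> s
    using D(1) that by (force simp: sat_NameClosed)
  have "vpair q (vpair x y) \<in> elts E \<longleftrightarrow> feq q x y" if "q \<in> elts P" "x \<in> elts D" "y \<in> elts D" for q x y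
    using that
  proof (induction x arbitrary: q y rule: trcl_induct)
    case (1 x)
    have "vpair q (vpair x y) \<in> elts E \<longleftrightarrow> sat (ForcesEqClause P R E q x y)"
      using 1 E by blast
    also have "\<dots> \<longleftrightarrow> feq q x y"
      unfolding ForcesEqClause_def sat.simps sat_ForcesSubClause sat_TripleIn
      by (rule feq_unfold_rel[symmetric]) (meson 1 Dstep below_cond vpair_mem_trcl)
    finally show ?case .
  qed
  then show "isname \<tau> \<and> isname \<sigma> \<and> feq p \<tau> \<sigma>"
    using p D assms NameClosed_isname by blast
next
  assume *: "isname \<tau> \<and> isname \<sigma> \<and> feq p \<tau> \<sigma>"
  define D where "D = vset (subnames \<tau> \<union> subnames \<sigma>)"
  have eD: "elts D = subnames \<tau> \<union> subnames \<sigma>"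
    unfolding D_def by (intro elts_vset small_Un small_subnames)
  define T where "T = {vpair q (vpair x y) |q x y. q \<in> elts P \<and> x \<in> elts D \<and> y \<in> elts D \<and> feq q x y}"
  have "small {vpair q z |q z. q \<in> elts P \<and> z \<in> {vpair x y |x y. x \<in> elts D \<and> y \<in> elts D}}"
    by (intro small_vpair_image small_elts)
  then have "small T" by (rule small_subset) (auto simp: T_def)
  then have E: "elts (vset T) = T" by simp
  have T: "vpair q (vpair x y) \<in> T \<longleftrightarrow> q \<in> elts P \<and> x \<in> elts D \<and> y \<in> elts D \<and> feq q x y" for q x y
    by (auto simp: T_def)
  have Dstep: "\<pi> \<in> elts D" if "x \<in> elts D" "vpair \<pi> s \<in> elts x" for x \<pi> s
    using that by (auto simp: eD dest: subnames_step)
  have "vpair q (vpair x y) \<in> T \<longleftrightarrow> sat (ForcesEqClause P R (vset T) q x y)"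
    if "q \<in> elts P" "x \<in> elts D" "y \<in> elts D" for q x y
  proof -
    have "vpair q (vpair x y) \<in> T \<longleftrightarrow> feq q x y" using that by (auto simp: T)
    also have "\<dots> \<longleftrightarrow> sat (ForcesEqClause P R (vset T) q x y)"
      unfolding ForcesEqClause_def sat.simps sat_ForcesSubClause sat_TripleIn
      by (rule feq_unfold_rel) (use that Dstep below_cond in \<open>auto simp: E T\<close>)
    finally show ?thesis .
  qed
  moreover have "sat (NameClosed P D)" unfolding D_def by (rule NameClosed_subnames)
  moreover have "\<tau> \<in> elts D" "\<sigma> \<in> elts D" using * by (auto simp: eD subnames_self)
  moreover have "vpair p (vpair \<tau> \<sigma>) \<in> T"
    using * assms \<open>\<tau> \<in> elts D\<close> \<open>\<sigma> \<in> elts D\<close> by (auto simp: T)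
  ultimately show "sat (ForcesEq P R p \<tau> \<sigma>)"
    unfolding ForcesEq_def sat_Exists by (intro exI[where x = D] exI[where x = "vset T"]) (simp add: E)
qed

lemma frc_Eq: "p \<in> elts P \<Longrightarrow> frc p (Eq \<tau> \<sigma>) \<longleftrightarrow> isname \<tau> \<and> isname \<sigma> \<and> feq p \<tau> \<sigma>"
  by (simp add: sat_ForcesEq)

lemma frc_Mem: "isname \<tau> \<Longrightarrow> isname \<sigma> \<Longrightarrow> frc p (Mem \<tau> \<sigma>) \<longleftrightarrow> fmem p \<tau> \<sigma>"
  unfolding Forces.simps ForcesMem_def fmem_def sat_DenseBelow sat_Exists sat.simps sat_PairIn
  using below_cond isname_pairD
  by (intro iffI; elim dns_mono; simp add: leq_def[symmetric]; metis sat_ForcesEq below_cond)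

lemma frc_Conj: "frc p (Conj \<phi> \<psi>) \<longleftrightarrow> frc p \<phi> \<and> frc p \<psi>"
  by simp

lemma frc_Neg: "frc p (Neg \<phi>) \<longleftrightarrow> (\<forall>q. q \<preceq> p \<longrightarrow> \<not> frc q \<phi>)"
  using below_cond by auto

lemma frc_Forall: "frc p (Forall F) \<longleftrightarrow> (\<forall>\<tau>. isname \<tau> \<longrightarrow> frc p (F \<tau>))"
  by simp

declare Forces.simps [simp del]

lemma frc_mono: "frc p \<phi> \<Longrightarrow> q \<preceq> p \<Longrightarrow> frc q \<phi>"
proof (induction \<phi> arbitrary: p q)
  case (Mem \<tau> \<sigma>)
  then show ?case by (auto simp: Forces.simps ForcesMem_def intro: dns_below)
next
  case (Eq \<tau> \<sigma>)
  then show ?case using frc_Eq below_cond feq_mono by metis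
qed (auto simp: frc_Neg frc_Conj frc_Forall intro: below_trans)

text \<open>In the equality case the assumption on \<open>p\<close> provides an actual extension,
  from which it is read off that both parameters are names.\<close>

lemma frc_dns: "p \<in> elts P \<Longrightarrow> dns p (\<lambda>r. frc r \<phi>) \<Longrightarrow> frc p \<phi>"
proof (induction \<phi> arbitrary: p)
  case (Mem \<tau> \<sigma>)
  then show ?case by (auto simp: Forces.simps ForcesMem_def intro: dns_dns)
next
  case (Eq \<tau> \<sigma>)
  then have "isname \<tau> \<and> isname \<sigma>" using dns_ex frc_Eq below_cond by metis
  moreover have "dns p (\<lambda>r. feq r \<tau> \<sigma>)" using Eq(2) frc_Eq below_cond by (elim dns_mono) blast
  ultimately show ?case using Eq frc_Eq feq_dns by blast
next
  case (Neg \<phi>)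
  show ?case
    unfolding frc_Neg
  proof (intro allI impI notI)
    fix q assume q: "q \<preceq> p" "frc q \<phi>"
    then obtain r where "r \<preceq> q" "frc r (Neg \<phi>)" using Neg dnsD by blast
    then show False using q frc_mono below_refl below_cond unfolding frc_Neg by blast
  qed
next
  case (Conj \<phi> \<psi>)
  then have "dns p (\<lambda>r. frc r \<phi>)" "dns p (\<lambda>r. frc r \<psi>)" by (auto simp: frc_Conj elim: dns_mono)
  with Conj show ?case by (simp add: frc_Conj)
next
  case (Forall F)
  then show ?case unfolding frc_Forall by (metis (mono_tags, lifting) dns_mono rangeI)
qed

text \<open>\<open>Imp\<close> is a negated conjunction, which yields the consequent only densely
  below \<open>q\<close>; \<open>frc_dns\<close> closes the gap.\<close>

lemma frc_Imp: "p \<in> elts P \<Longrightarrow> frc p (Imp \<phi> \<psi>) \<longleftrightarrow> (\<forall>q. q \<preceq> p \<longrightarrow> frc q \<phi> \<longrightarrow> frc q \<psi>)"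
proof -
  assume p: "p \<in> elts P"
  show ?thesis
  proof
    assume L: "frc p (Imp \<phi> \<psi>)"
    show "\<forall>q. q \<preceq> p \<longrightarrow> frc q \<phi> \<longrightarrow> frc q \<psi>"
    proof (intro allI impI)
      fix q assume q: "q \<preceq> p" "frc q \<phi>"
      show "frc q \<psi>"
      proof (rule frc_dns)
        show "q \<in> elts P" using q below_cond by blast
        show "dns q (\<lambda>r. frc r \<psi>)"
          using L q frc_mono below_trans unfolding Imp_def frc_Neg frc_Conj by (intro dnsI) blast
      qed
    qed
  next
    assume "\<forall>q. q \<preceq> p \<longrightarrow> frc q \<phi> \<longrightarrow> frc q \<psi>"
    then show "frc p (Imp \<phi> \<psi>)"
      unfolding Imp_def frc_Neg frc_Conj using below_refl below_cond by blast
  qed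
qed

lemma frc_Disj: "frc p (Disj \<phi> \<psi>) \<longleftrightarrow> dns p (\<lambda>r. frc r \<phi> \<or> frc r \<psi>)"
  unfolding Disj_def frc_Neg frc_Conj dns_def by blast

lemma frc_Iff: "p \<in> elts P \<Longrightarrow> frc p (Iff \<phi> \<psi>) \<longleftrightarrow> (\<forall>q. q \<preceq> p \<longrightarrow> (frc q \<phi> \<longleftrightarrow> frc q \<psi>))"
  unfolding Iff_def frc_Conj by (auto simp: frc_Imp)

lemma frc_Exists: "frc p (Exists F) \<longleftrightarrow> dns p (\<lambda>r. \<exists>\<tau>. isname \<tau> \<and> frc r (F \<tau>))"
  unfolding Exists_def frc_Neg frc_Forall dns_def by blast

lemma frc_BForall: "p \<in> elts P \<Longrightarrow> isname a \<Longrightarrow>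
    frc p (BForall a F) \<longleftrightarrow> (\<forall>\<tau>. isname \<tau> \<longrightarrow> (\<forall>q. q \<preceq> p \<longrightarrow> fmem q \<tau> a \<longrightarrow> frc q (F \<tau>)))"
  unfolding BForall_def frc_Forall by (auto simp: frc_Imp frc_Mem)

lemma frc_BExists: "isname a \<Longrightarrow>
    frc p (BExists a F) \<longleftrightarrow> dns p (\<lambda>r. \<exists>\<tau>. isname \<tau> \<and> fmem r \<tau> a \<and> frc r (F \<tau>))"
  unfolding BExists_def frc_Exists frc_Conj using frc_Mem by (simp cong: conj_cong)

end

section \<open>Uniform formulas\<close>

text \<open>Bound variables are HOL functions, so an arbitrary formula need not respect forced equality.
  The relation below holds between two instances of one formula whose parameters are
  paired by \<open>E\<close>.\<close>

inductive fmrel :: "('v \<times> 'w) set \<Rightarrow> 'v fm \<Rightarrow> 'w fm \<Rightarrow> bool" where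
  fmrel_Mem: "(a, a') \<in> E \<Longrightarrow> (b, b') \<in> E \<Longrightarrow> fmrel E (Mem a b) (Mem a' b')"
| fmrel_Eq: "(a, a') \<in> E \<Longrightarrow> (b, b') \<in> E \<Longrightarrow> fmrel E (Eq a b) (Eq a' b')"
| fmrel_Neg: "fmrel E \<phi> \<phi>' \<Longrightarrow> fmrel E (Neg \<phi>) (Neg \<phi>')"
| fmrel_Conj: "fmrel E \<phi> \<phi>' \<Longrightarrow> fmrel E \<psi> \<psi>' \<Longrightarrow> fmrel E (Conj \<phi> \<psi>) (Conj \<phi>' \<psi>')"
| fmrel_Forall: "(\<And>a a'. fmrel (insert (a, a') E) (F a) (F' a')) \<Longrightarrow> fmrel E (Forall F) (Forall F')"

lemma fmrel_Imp: "fmrel E \<phi> \<phi>' \<Longrightarrow> fmrel E \<psi> \<psi>' \<Longrightarrow> fmrel E (Imp \<phi> \<psi>) (Imp \<phi>' \<psi>')"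
  unfolding Imp_def by (intro fmrel.intros)

lemma fmrel_Disj: "fmrel E \<phi> \<phi>' \<Longrightarrow> fmrel E \<psi> \<psi>' \<Longrightarrow> fmrel E (Disj \<phi> \<psi>) (Disj \<phi>' \<psi>')"
  unfolding Disj_def by (intro fmrel.intros)

lemma fmrel_Iff: "fmrel E \<phi> \<phi>' \<Longrightarrow> fmrel E \<psi> \<psi>' \<Longrightarrow> fmrel E (Iff \<phi> \<psi>) (Iff \<phi>' \<psi>')"
  unfolding Iff_def by (intro fmrel.intros fmrel_Imp)

lemma fmrel_Exists:
  "(\<And>a a'. fmrel (insert (a, a') E) (F a) (F' a')) \<Longrightarrow> fmrel E (Exists F) (Exists F')"
  unfolding Exists_def by (intro fmrel.intros)

lemma fmrel_BForall: "(b, b') \<in> E \<Longrightarrow> (\<And>a a'. fmrel (insert (a, a') E) (F a) (F' a')) \<Longrightarrow>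
    fmrel E (BForall b F) (BForall b' F')"
  unfolding BForall_def by (intro fmrel.intros fmrel_Imp) auto

lemma fmrel_BExists: "(b, b') \<in> E \<Longrightarrow> (\<And>a a'. fmrel (insert (a, a') E) (F a) (F' a')) \<Longrightarrow>
    fmrel E (BExists b F) (BExists b' F')"
  unfolding BExists_def by (intro fmrel.intros fmrel_Exists) auto

lemmas fmrel_intros = fmrel.intros fmrel_Imp fmrel_Disj fmrel_Iff fmrel_Exists fmrel_BForall
  fmrel_BExists

lemma fmrel_IsUpair: "(x, x') \<in> E \<Longrightarrow> (y, y') \<in> E \<Longrightarrow> (z, z') \<in> E \<Longrightarrow>
    fmrel E (IsUpair x y z) (IsUpair x' y' z')"
  unfolding IsUpair_def by (intro fmrel_intros) auto

lemma fmrel_IsPair: "(x, x') \<in> E \<Longrightarrow> (y, y') \<in> E \<Longrightarrow> (z, z') \<in> E \<Longrightarrow>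
    fmrel E (IsPair x y z) (IsPair x' y' z')"
  unfolding IsPair_def by (intro fmrel_intros fmrel_IsUpair) auto

lemma fmrel_PairIn: "(x, x') \<in> E \<Longrightarrow> (y, y') \<in> E \<Longrightarrow> (z, z') \<in> E \<Longrightarrow>
    fmrel E (PairIn x y z) (PairIn x' y' z')"
  unfolding PairIn_def by (intro fmrel_intros fmrel_IsPair) auto

lemma fmrel_TripleIn:
  "(x, x') \<in> E \<Longrightarrow> (y, y') \<in> E \<Longrightarrow> (z, z') \<in> E \<Longrightarrow> (w, w') \<in> E \<Longrightarrow>
    fmrel E (TripleIn x y z w) (TripleIn x' y' z' w')"
  unfolding TripleIn_def by (intro fmrel_intros fmrel_IsPair fmrel_PairIn) auto

lemma fmrel_Trans: "(x, x') \<in> E \<Longrightarrow> fmrel E (Trans x) (Trans x')"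
  unfolding Trans_def by (intro fmrel_intros) auto

lemma fmrel_Ord: "(x, x') \<in> E \<Longrightarrow> fmrel E (Ord x) (Ord x')"
  unfolding Ord_def by (intro fmrel_intros fmrel_Trans) auto

lemma fmrel_LimitOrd: "(x, x') \<in> E \<Longrightarrow> fmrel E (LimitOrd x) (LimitOrd x')"
  unfolding LimitOrd_def by (intro fmrel_intros fmrel_Ord) auto

lemma fmrel_IsOmega: "(x, x') \<in> E \<Longrightarrow> fmrel E (IsOmega x) (IsOmega x')"
  unfolding IsOmega_def by (intro fmrel_intros fmrel_LimitOrd) auto

lemma fmrel_CountableSetOfOrdinals:
  "(x, x') \<in> E \<Longrightarrow> fmrel E (CountableSetOfOrdinals x) (CountableSetOfOrdinals x')"
  unfolding CountableSetOfOrdinals_def Countable_def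
  by (intro fmrel_intros fmrel_Ord fmrel_IsOmega fmrel_PairIn) auto

lemma fmrel_BelowForall: "(P, P') \<in> E \<Longrightarrow> (le, le') \<in> E \<Longrightarrow> (p, p') \<in> E \<Longrightarrow>
    (\<And>a a'. fmrel (insert (a, a') E) (F a) (F' a')) \<Longrightarrow>
    fmrel E (BelowForall P le p F) (BelowForall P' le' p' F')"
  unfolding BelowForall_def by (intro fmrel_intros fmrel_PairIn) auto

lemma fmrel_BelowExists: "(P, P') \<in> E \<Longrightarrow> (le, le') \<in> E \<Longrightarrow> (p, p') \<in> E \<Longrightarrow>
    (\<And>a a'. fmrel (insert (a, a') E) (F a) (F' a')) \<Longrightarrow>
    fmrel E (BelowExists P le p F) (BelowExists P' le' p' F')"
  unfolding BelowExists_def by (intro fmrel_intros fmrel_PairIn) auto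

lemma fmrel_DenseBelow: "(P, P') \<in> E \<Longrightarrow> (le, le') \<in> E \<Longrightarrow> (p, p') \<in> E \<Longrightarrow>
    (\<And>b b' a a'. fmrel (insert (a, a') (insert (b, b') E)) (F a) (F' a')) \<Longrightarrow>
    fmrel E (DenseBelow P le p F) (DenseBelow P' le' p' F')"
  unfolding DenseBelow_def by (intro fmrel_BelowForall fmrel_BelowExists) auto

lemma fmrel_NameClosed: "(P, P') \<in> E \<Longrightarrow> (D, D') \<in> E \<Longrightarrow> fmrel E (NameClosed P D) (NameClosed P' D')"
  unfolding NameClosed_def by (intro fmrel_intros fmrel_IsPair) auto

lemma fmrel_ForcesEqClause:
  "(P, P') \<in> E \<Longrightarrow> (le, le') \<in> E \<Longrightarrow> (K, K') \<in> E \<Longrightarrow> (p, p') \<in> E \<Longrightarrow> (x, x') \<in> E \<Longrightarrow> (y, y') \<in> E \<Longrightarrow>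
    fmrel E (ForcesEqClause P le K p x y) (ForcesEqClause P' le' K' p' x' y')"
  unfolding ForcesEqClause_def ForcesSubClause_def
  by (intro fmrel_intros fmrel_PairIn fmrel_TripleIn fmrel_DenseBelow) auto

lemma fmrel_ForcesEq:
  "(P, P') \<in> E \<Longrightarrow> (le, le') \<in> E \<Longrightarrow> (p, p') \<in> E \<Longrightarrow> (x, x') \<in> E \<Longrightarrow> (y, y') \<in> E \<Longrightarrow>
    fmrel E (ForcesEq P le p x y) (ForcesEq P' le' p' x' y')"
  unfolding ForcesEq_def
  by (intro fmrel_intros fmrel_NameClosed fmrel_TripleIn fmrel_ForcesEqClause) auto

lemma fmrel_ForcesMem:
  "(P, P') \<in> E \<Longrightarrow> (le, le') \<in> E \<Longrightarrow> (p, p') \<in> E \<Longrightarrow> (x, x') \<in> E \<Longrightarrow> (y, y') \<in> E \<Longrightarrow>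
    fmrel E (ForcesMem P le p x y) (ForcesMem P' le' p' x' y')"
  unfolding ForcesMem_def
  by (intro fmrel_DenseBelow fmrel_intros fmrel_PairIn fmrel_ForcesEq) auto

lemma fmrel_IsCheck:
  "(P, P') \<in> E \<Longrightarrow> (x, x') \<in> E \<Longrightarrow> (c, c') \<in> E \<Longrightarrow> fmrel E (IsCheck P x c) (IsCheck P' x' c')"
  unfolding IsCheck_def
  by (intro fmrel_intros fmrel_PairIn fmrel_IsPair fmrel_Trans) auto

context forcing
begin

definition eqn :: "'v \<Rightarrow> 'v \<Rightarrow> 'v \<Rightarrow> bool" where
  "eqn p x y \<longleftrightarrow> isname x \<and> isname y \<and> feq p x y"

lemma eqn_refl [simp]: "eqn p x x \<longleftrightarrow> isname x"
  by (simp add: eqn_def)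

lemma eqn_mono: "eqn p x y \<Longrightarrow> q \<preceq> p \<Longrightarrow> eqn q x y"
  by (auto simp: eqn_def intro: feq_mono)

text \<open>At a universal quantifier the same name is put for both bound variables, so the new pair
  of \<open>E\<close> is trivially forced equal. Equality is strengthened to \<open>eqn\<close>
  because the atomic clauses are evaluated for names only.\<close>

lemma frc_cong:
  "fmrel E \<phi> \<phi>' \<Longrightarrow> p \<in> elts P \<Longrightarrow> (\<And>a a'. (a, a') \<in> E \<Longrightarrow> eqn p a a') \<Longrightarrow> frc p \<phi> \<longleftrightarrow> frc p \<phi>'"
proof (induction arbitrary: p rule: fmrel.induct)
  case (fmrel_Mem a a' E b b')
  then have "eqn p a a'" "eqn p b b'" by blast+
  then show ?case by (simp add: eqn_def frc_Mem fmem_cong)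
next
  case (fmrel_Eq a a' E b b')
  then have "eqn p a a'" "eqn p b b'" by blast+
  then show ?case using fmrel_Eq feq_cong by (simp add: eqn_def frc_Eq)
next
  case (fmrel_Neg E \<phi> \<phi>')
  have "frc q \<phi> \<longleftrightarrow> frc q \<phi>'" if "q \<preceq> p" for q
    using that fmrel_Neg eqn_mono below_cond by blast
  then show ?case by (simp add: frc_Neg)
next
  case (fmrel_Conj E \<phi> \<phi>' \<psi> \<psi>')
  then show ?case by (simp add: frc_Conj)
next
  case (fmrel_Forall E F F')
  have "frc p (F \<tau>) \<longleftrightarrow> frc p (F' \<tau>)" if "isname \<tau>" for \<tau>
    by (rule fmrel_Forall(2)) (use that fmrel_Forall(3,4) in auto)
  then show ?case by (simp add: frc_Forall)
qed

lemma dns_feq_iff: "dns p (\<lambda>r. feq r x y) \<longleftrightarrow> feq p x y"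
  using feq_dns dns_all[of p "\<lambda>r. feq r x y"] feq_mono by blast

lemma dns_fmem_iff: "dns p (\<lambda>r. fmem r x y) \<longleftrightarrow> fmem p x y"
  using fmem_dns dns_all[of p "\<lambda>r. fmem r x y"] fmem_mono by blast

section \<open>Names for pairs\<close>

text \<open>Each element is attached to every condition because no greatest condition is
  assumed.\<close>

definition upn :: "'v \<Rightarrow> 'v \<Rightarrow> 'v" where
  "upn x y = vset {vpair z p |z p. z \<in> {x, y} \<and> p \<in> elts P}"

definition opn :: "'v \<Rightarrow> 'v \<Rightarrow> 'v" where
  "opn x y = upn (upn x x) (upn x y)"

lemma elts_upn: "elts (upn x y) = {vpair z p |z p. z \<in> {x, y} \<and> p \<in> elts P}"
  unfolding upn_def by (intro elts_vset small_vpair_image) auto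

lemma isname_upn: "isname x \<Longrightarrow> isname y \<Longrightarrow> isname (upn x y)"
  by (rule isnameI) (auto simp: elts_upn)

lemma isname_opn [simp]: "isname x \<Longrightarrow> isname y \<Longrightarrow> isname (opn x y)"
  by (simp add: opn_def isname_upn)

lemma fmem_upn: "fmem p z (upn x y) \<longleftrightarrow> dns p (\<lambda>r. feq r z x \<or> feq r z y)"
  unfolding fmem_def
proof (rule dns_cong)
  fix r assume "r \<preceq> p"
  then have "r \<in> elts P" "r \<preceq> r" using below_cond below_refl by blast+
  then show "(\<exists>\<pi> s. vpair \<pi> s \<in> elts (upn x y) \<and> r \<preceq> s \<and> feq r \<pi> z) \<longleftrightarrow> feq r z x \<or> feq r z y"
    by (simp add: elts_upn feq_commute[of _ z]) (blast intro: below_refl)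
qed

lemma fmem_upn_left [simp]: "fmem p x (upn x y)" and fmem_upn_right [simp]: "fmem p y (upn x y)"
  by (auto simp: fmem_upn intro: dns_all)

lemma frc_IsUpair:
  assumes "p \<in> elts P" "isname x" "isname y" "isname z"
  shows "frc p (IsUpair x y z) \<longleftrightarrow> feq p z (upn x y)"
proof -
  have *: "frc q (Disj (Eq w x) (Eq w y)) \<longleftrightarrow> fmem q w (upn x y)" if "isname w" "q \<preceq> p" for w q
    unfolding frc_Disj fmem_upn
    by (rule dns_cong) (use that assms below_cond in \<open>auto simp: frc_Eq\<close>)
  have "frc p (IsUpair x y z) \<longleftrightarrow> (\<forall>w. isname w \<longrightarrow> (\<forall>q. q \<preceq> p \<longrightarrow> (fmem q w z \<longleftrightarrow> fmem q w (upn x y))))"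
    using assms * by (simp add: IsUpair_def frc_Forall frc_Iff frc_Mem)
  also have "\<dots> \<longleftrightarrow> feq p z (upn x y)"
  proof
    assume "\<forall>w. isname w \<longrightarrow> (\<forall>q. q \<preceq> p \<longrightarrow> (fmem q w z \<longleftrightarrow> fmem q w (upn x y)))"
    then show "feq p z (upn x y)" using assms isname_upn by (intro feq_extI) blast+
  next
    assume "feq p z (upn x y)"
    then show "\<forall>w. isname w \<longrightarrow> (\<forall>q. q \<preceq> p \<longrightarrow> (fmem q w z \<longleftrightarrow> fmem q w (upn x y)))"
      using fmem_cong[OF feq_refl] feq_mono by blast
  qed
  finally show ?thesis .
qed

lemma upn_cong: "feq p x x' \<Longrightarrow> feq p y y' \<Longrightarrow> feq p (upn x y) (upn x' y')"
proof -
  have "fmem q z (upn x' y')"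
    if "feq p x x'" "feq p y y'" "q \<preceq> p" "vpair z s \<in> elts (upn x y)" for x y x' y' q z s
  proof -
    have "z = x \<or> z = y" using that(4) by (auto simp: elts_upn)
    moreover have "feq q x' x" "feq q y' y" using that feq_mono feq_sym by blast+
    ultimately show ?thesis using fmem_cong1 fmem_upn_left fmem_upn_right by blast
  qed
  note * = this
  assume "feq p x x'" "feq p y y'"
  then show ?thesis unfolding feq_iff[of p "upn x y"] using * feq_sym by blast
qed

lemma opn_cong: "feq p x x' \<Longrightarrow> feq p y y' \<Longrightarrow> feq p (opn x y) (opn x' y')"
  unfolding opn_def by (intro upn_cong)

lemma frc_IsPair:
  assumes "p \<in> elts P" "isname x" "isname y" "isname z"
  shows "frc p (IsPair x y z) \<longleftrightarrow> feq p z (opn x y)"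
proof -
  have *: "(\<exists>a. isname a \<and> dns r (\<lambda>r. \<exists>b. isname b \<and> feq r a (upn x x) \<and> feq r b (upn x y) \<and> feq r z (upn a b)))
       \<longleftrightarrow> feq r z (opn x y)" if "r \<preceq> p" for r
  proof
    assume "\<exists>a. isname a \<and> dns r (\<lambda>r. \<exists>b. isname b \<and> feq r a (upn x x) \<and> feq r b (upn x y) \<and> feq r z (upn a b))"
    then obtain a where "dns r (\<lambda>r. \<exists>b. isname b \<and> feq r a (upn x x) \<and> feq r b (upn x y) \<and> feq r z (upn a b))"
      by blast
    then show "feq r z (opn x y)"
      unfolding opn_def by (intro feq_dns, elim dns_mono) (meson feq_trans upn_cong)
  next
    assume *: "feq r z (opn x y)"
    have "dns r (\<lambda>r. isname (upn x y) \<and> feq r (upn x x) (upn x x) \<and> feq r (upn x y) (upn x y) \<and>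
        feq r z (upn (upn x x) (upn x y)))"
      using * assms by (intro dns_all) (auto simp: isname_upn opn_def intro: feq_mono)
    then have "dns r (\<lambda>r. \<exists>b. isname b \<and> feq r (upn x x) (upn x x) \<and> feq r b (upn x y) \<and>
        feq r z (upn (upn x x) b))"
      by (rule dns_mono) blast
    then show "\<exists>a. isname a \<and> dns r (\<lambda>r. \<exists>b. isname b \<and> feq r a (upn x x) \<and> feq r b (upn x y) \<and> feq r z (upn a b))"
      using assms isname_upn by blast
  qed
  have **: "frc q (Exists (\<lambda>b. Conj (IsUpair x x a) (Conj (IsUpair x y b) (IsUpair a b z)))) \<longleftrightarrow>
      dns q (\<lambda>r. \<exists>b. isname b \<and> feq r a (upn x x) \<and> feq r b (upn x y) \<and> feq r z (upn a b))"
    if "isname a" for a q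
    unfolding frc_Exists
    by (rule dns_cong) (use that assms below_cond in \<open>auto simp: frc_Conj frc_IsUpair\<close>)
  have "frc p (IsPair x y z) \<longleftrightarrow> dns p (\<lambda>r. feq r z (opn x y))"
    unfolding IsPair_def frc_Exists[where p = p]
  proof (rule dns_cong)
    fix r assume "r \<preceq> p"
    have "(\<exists>a. isname a \<and> frc r (Exists (\<lambda>b. Conj (IsUpair x x a) (Conj (IsUpair x y b) (IsUpair a b z))))) \<longleftrightarrow>
       (\<exists>a. isname a \<and> dns r (\<lambda>r. \<exists>b. isname b \<and> feq r a (upn x x) \<and> feq r b (upn x y) \<and> feq r z (upn a b)))"
      using **[of _ r] by blast
    also have "\<dots> \<longleftrightarrow> feq r z (opn x y)" by (rule *[OF \<open>r \<preceq> p\<close>])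
    finally show "(\<exists>a. isname a \<and> frc r (Exists (\<lambda>b. Conj (IsUpair x x a) (Conj (IsUpair x y b) (IsUpair a b z))))) \<longleftrightarrow>
       feq r z (opn x y)" .
  qed
  also have "\<dots> \<longleftrightarrow> feq p z (opn x y)" by (rule dns_feq_iff)
  finally show ?thesis .
qed

lemma frc_PairIn:
  assumes "p \<in> elts P" "isname x" "isname y" "isname z"
  shows "frc p (PairIn x y z) \<longleftrightarrow> fmem p (opn x y) z"
proof -
  have "frc p (PairIn x y z) \<longleftrightarrow> dns p (\<lambda>r. fmem r (opn x y) z)"
    unfolding PairIn_def frc_Exists
  proof (rule dns_cong)
    fix r assume "r \<preceq> p"
    then have "frc r (Conj (IsPair x y u) (Mem u z)) \<longleftrightarrow> feq r u (opn x y) \<and> fmem r u z" if "isname u" for u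
      using that assms below_cond by (simp add: frc_Conj frc_Mem frc_IsPair)
    then show "(\<exists>u. isname u \<and> frc r (Conj (IsPair x y u) (Mem u z))) \<longleftrightarrow> fmem r (opn x y) z"
      using assms fmem_cong1 isname_opn feq_refl by meson
  qed
  also have "\<dots> \<longleftrightarrow> fmem p (opn x y) z" by (rule dns_fmem_iff)
  finally show ?thesis .
qed

lemma frc_TripleIn:
  assumes "p \<in> elts P" "isname x" "isname y" "isname z" "isname w"
  shows "frc p (TripleIn x y z w) \<longleftrightarrow> fmem p (opn x (opn y z)) w"
proof -
  have "frc p (TripleIn x y z w) \<longleftrightarrow> dns p (\<lambda>r. fmem r (opn x (opn y z)) w)"
    unfolding TripleIn_def frc_Exists
  proof (rule dns_cong)
    fix r assume "r \<preceq> p"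
    then have "frc r (Conj (IsPair y z u) (PairIn x u w)) \<longleftrightarrow> feq r u (opn y z) \<and> fmem r (opn x u) w"
      if "isname u" for u
      using that assms below_cond by (simp add: frc_Conj frc_PairIn frc_IsPair)
    then show "(\<exists>u. isname u \<and> frc r (Conj (IsPair y z u) (PairIn x u w))) \<longleftrightarrow> fmem r (opn x (opn y z)) w"
      using assms fmem_cong1 opn_cong isname_opn feq_refl by meson
  qed
  also have "\<dots> \<longleftrightarrow> fmem p (opn x (opn y z)) w" by (rule dns_fmem_iff)
  finally show ?thesis .
qed

lemma fmem_upn_self: "fmem p z (upn x x) \<longleftrightarrow> feq p z x"
  by (simp add: fmem_upn dns_feq_iff)

lemma upn_singleton_eqD:
  assumes "feq p (upn x x) (upn x' y')"
  shows "feq p x x' \<and> feq p x y'"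
proof -
  have "fmem p x' (upn x x)" "fmem p y' (upn x x)"
    using fmem_cong2[OF feq_sym[OF assms]] by simp_all
  then show ?thesis using feq_sym unfolding fmem_upn_self by blast
qed

text \<open>Kuratowski's argument, with each case distinction replaced by a dense one: which of two
  sets a member equals is decided only by stronger conditions.\<close>

lemma opn_inj:
  assumes "feq p (opn x y) (opn x' y')"
  shows "feq p x x'" "feq p y y'"
proof -
  have X: "feq p x x'" if "feq p (opn x y) (opn x' y')" for p x y x' y'
  proof -
    have "fmem p (upn x x) (opn x' y')"
      using that fmem_cong2 fmem_upn_left unfolding opn_def by blast
    then have "dns p (\<lambda>r. feq r x x')"
      unfolding opn_def fmem_upn by (elim dns_mono) (auto dest: upn_singleton_eqD)
    then show ?thesis by (rule feq_dns)
  qed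
  \<comment> \<open>Applied to both orders of the pairs. If \<open>y\<close> equals \<open>x\<close>
    and \<open>y'\<close> equals \<open>x'\<close>, then \<open>y\<close> equals \<open>y'\<close>
    through the equality of the first coordinates.\<close>
  have Y: "dns p (\<lambda>r. feq r y y' \<or> feq r y x)" if "feq p (opn x y) (opn x' y')" for p x y x' y'
  proof -
    have "fmem p (upn x y) (opn x' y')"
      using that fmem_cong2 fmem_upn_right unfolding opn_def by blast
    then have "dns p (\<lambda>r. feq r (upn x y) (upn x' x') \<or> feq r (upn x y) (upn x' y'))"
      unfolding opn_def fmem_upn .
    then have "dns p (\<lambda>r. fmem r y (upn x' y'))"
    proof (rule dns_mono)
      fix r assume "r \<preceq> p" "feq r (upn x y) (upn x' x') \<or> feq r (upn x y) (upn x' y')"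
      then have "fmem r y (upn x' x') \<or> fmem r y (upn x' y')"
        using fmem_cong2 fmem_upn_right by blast
      then show "fmem r y (upn x' y')"
        using fmem_upn_self fmem_upn_left fmem_cong1 feq_sym by meson
    qed
    then have "dns p (\<lambda>r. feq r y x' \<or> feq r y y')" using fmem_dns fmem_upn by blast
    then show ?thesis
      by (rule dns_mono) (meson X[OF that] feq_mono feq_sym feq_trans)
  qed
  show x: "feq p x x'" by (rule X[OF assms])
  have "dns p (\<lambda>r. feq r y y' \<or> feq r y x)" by (rule Y[OF assms])
  then have "dns p (\<lambda>r. dns r (\<lambda>r. feq r y y'))"
  proof (rule dns_mono)
    fix r assume r: "r \<preceq> p" "feq r y y' \<or> feq r y x"
    have "dns r (\<lambda>r. feq r y' y \<or> feq r y' x')" using Y feq_sym assms feq_mono r(1) by blast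
    then show "dns r (\<lambda>r. feq r y y')"
      by (rule dns_mono) (meson r x feq_mono feq_sym feq_trans below_trans)
  qed
  then show "feq p y y'" using dns_dns feq_dns by blast
qed

section \<open>Canonical names\<close>

lemma isname_check [simp]: "isname (check P x)"
  by (induction x rule: elts_induct) (auto intro!: isnameI simp: elts_check)

lemma fmem_check: "fmem p \<tau> (check P x) \<longleftrightarrow> dns p (\<lambda>r. \<exists>y\<in>elts x. feq r \<tau> (check P y))"
  unfolding fmem_def
proof (rule dns_cong)
  fix r assume "r \<preceq> p"
  then have "r \<in> elts P" "r \<preceq> r" using below_cond below_refl by blast+
  then show "(\<exists>\<pi> s. vpair \<pi> s \<in> elts (check P x) \<and> r \<preceq> s \<and> feq r \<pi> \<tau>) \<longleftrightarrow>
      (\<exists>y\<in>elts x. feq r \<tau> (check P y))"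
    by (simp add: elts_check feq_commute[of _ \<tau>]) (blast intro: below_refl)
qed

lemma fmem_checkI: "y \<in> elts x \<Longrightarrow> fmem p (check P y) (check P x)"
  unfolding fmem_check by (rule dns_all) (metis feq_refl)

text \<open>Membership in a canonical name is densely equality with a canonical name of a member, so
  induction applies. A condition is needed since \<open>feq\<close> is vacuous elsewhere.\<close>

lemma feq_check_iff: "p \<in> elts P \<Longrightarrow> feq p (check P x) (check P y) \<longleftrightarrow> x = y"
proof (induction x arbitrary: p y rule: elts_induct)
  case (1 x)
  show ?case
  proof
    assume eq: "feq p (check P x) (check P y)"
    have "elts x = elts y"
    proof
      show "elts x \<subseteq> elts y"
      proof
        fix z assume z: "z \<in> elts x"
        then have "fmem p (check P z) (check P x)" by (rule fmem_checkI)
        then have "fmem p (check P z) (check P y)" using eq fmem_cong2 by blast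
        then obtain r u where "r \<preceq> p" "u \<in> elts y" "feq r (check P z) (check P u)"
          unfolding fmem_check using dns_ex 1(2) by blast
        then show "z \<in> elts y" using 1(1)[OF z] below_cond by metis
      qed
      show "elts y \<subseteq> elts x"
      proof
        fix z assume z: "z \<in> elts y"
        then have "fmem p (check P z) (check P y)" by (rule fmem_checkI)
        then have "fmem p (check P z) (check P x)" using eq fmem_cong2 feq_sym by blast
        then obtain r u where "r \<preceq> p" "u \<in> elts x" "feq r (check P z) (check P u)"
          unfolding fmem_check using dns_ex 1(2) by blast
        then show "z \<in> elts x" using 1(1)[of u r z] below_cond feq_sym by metis
      qed
    qed
    then show "x = y" by (simp add: elts_inject)
  qed simp
qed

lemma fmem_check_iff: "p \<in> elts P \<Longrightarrow> fmem p (check P x) (check P y) \<longleftrightarrow> x \<in> elts y"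
proof
  assume "p \<in> elts P" "fmem p (check P x) (check P y)"
  then obtain r u where "r \<preceq> p" "u \<in> elts y" "feq r (check P x) (check P u)"
    unfolding fmem_check using dns_ex by blast
  then show "x \<in> elts y" using feq_check_iff below_cond by metis
qed (rule fmem_checkI)

text \<open>An identity of names and not only a forced equality: \<open>upn\<close> and
  \<open>check\<close> both attach every condition. Forced statements about pairs of canonical names
  thus become statements about ground-model pairs.\<close>

lemma upn_check: "upn (check P x) (check P y) = check P (vset {x, y})"
  by (rule extensionality) (auto simp: elts_upn elts_check)

lemma opn_check: "opn (check P x) (check P y) = check P (vpair x y)"
  by (simp add: opn_def upn_check vpair_def)

lemma frc_PairIn_check:
  "p \<in> elts P \<Longrightarrow> frc p (PairIn (check P x) (check P y) (check P z)) \<longleftrightarrow> vpair x y \<in> elts z"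
  by (simp add: frc_PairIn opn_check fmem_check_iff)

end

text \<open>Burali-Forti: otherwise the ordinals would form a set, which would be an ordinal
  belonging to itself.\<close>

lemma ex_ordinal_notin:
  fixes B :: "'v::zfc set"
  assumes "small B"
  shows "\<exists>\<gamma>. ordinal \<gamma> \<and> \<gamma> \<notin> B"
proof (rule ccontr)
  assume *: "\<not> ?thesis"
  define U :: "'v set" where "U = {\<alpha>. ordinal \<alpha>}"
  have "small U" by (rule small_subset[OF assms]) (use * in \<open>auto simp: U_def\<close>)
  then have e: "elts (vset U) = U" by simp
  have "transitive (vset U)" unfolding transitive_def e by (auto simp: U_def intro: ordinal_elt)
  moreover have "\<forall>y\<in>elts (vset U). transitive y" unfolding e by (auto simp: U_def ordinal_def)
  ultimately have "ordinal (vset U)" by (simp add: ordinal_def)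
  then have "vset U \<in> elts (vset U)" unfolding e by (simp add: U_def)
  then show False using mem_irrefl by blast
qed

context forcing
begin

section \<open>Forced ordinals\<close>

text \<open>A name and a condition determine at most one value, so the values are an image of
  \<open>A\<close> times \<open>P\<close>. This bounds the ordinals that can be forced into a given
  name.\<close>

lemma small_check_values:
  assumes "small A"
  shows "small {x. \<exists>\<pi>\<in>A. \<exists>r\<in>elts P. feq r \<pi> (check P x)}"
proof (rule small_subset)
  show "small {(THE x. feq r \<pi> (check P x)) |\<pi> r. \<pi> \<in> A \<and> r \<in> elts P}"
    using assms by (intro small_image2) auto
  show "{x. \<exists>\<pi>\<in>A. \<exists>r\<in>elts P. feq r \<pi> (check P x)} \<subseteq>
      {(THE x. feq r \<pi> (check P x)) |\<pi> r. \<pi> \<in> A \<and> r \<in> elts P}"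
  proof clarify
    fix x \<pi> r assume *: "\<pi> \<in> A" "r \<in> elts P" "feq r \<pi> (check P x)"
    then have "(THE x. feq r \<pi> (check P x)) = x"
      by (intro the_equality) (auto dest: feq_sym feq_trans simp: feq_check_iff[symmetric, of r])
    with * show "\<exists>\<pi>' r'. x = (THE x. feq r' \<pi>' (check P x)) \<and> \<pi>' \<in> A \<and> r' \<in> elts P" by metis
  qed
qed

lemma frc_BForallD:
  assumes "frc p (BForall a F)" "isname a" "isname \<tau>" "q \<preceq> p" "fmem q \<tau> a"
  shows "frc q (F \<tau>)"
  using assms below_cond by (simp add: frc_BForall)

text \<open>Supplies the parameters that stay fixed: \<open>fmrel\<close> admits only paired
  parameters, and a fixed name is paired with itself.\<close>

definition Idn :: "('v \<times> 'v) set" where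
  "Idn = {(b, b) |b. isname b}"

lemma Idn_iff [simp]: "(a, b) \<in> Idn \<longleftrightarrow> a = b \<and> isname a"
  by (auto simp: Idn_def)

lemma frc_cong1:
  assumes "\<And>a a'. fmrel (insert (a, a') Idn) (F a) (F a')" "p \<in> elts P" "eqn p x y"
  shows "frc p (F x) \<longleftrightarrow> frc p (F y)"
  by (rule frc_cong[OF assms(1,2)]) (use assms(3) in auto)

text \<open>A name forced into \<open>check P x\<close> is only densely equal to a canonical name;
  uniformity of \<open>F\<close> carries the forced instance over to it.\<close>

lemma frc_BForall_check:
  assumes F: "\<And>a a'. fmrel (insert (a, a') Idn) (F a) (F a')" and p: "p \<in> elts P"
  shows "frc p (BForall (check P x) F) \<longleftrightarrow> (\<forall>y\<in>elts x. frc p (F (check P y)))"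
proof
  assume "frc p (BForall (check P x) F)"
  then show "\<forall>y\<in>elts x. frc p (F (check P y))"
    using p fmem_checkI below_refl by (simp add: frc_BForall)
next
  assume *: "\<forall>y\<in>elts x. frc p (F (check P y))"
  have "frc q (F \<tau>)" if q: "isname \<tau>" "q \<preceq> p" "fmem q \<tau> (check P x)" for \<tau> q
  proof (rule frc_dns)
    show "q \<in> elts P" using that below_cond by blast
    show "dns q (\<lambda>r. frc r (F \<tau>))"
      using that(3) unfolding fmem_check
    proof (rule dns_mono)
      fix r assume r: "r \<preceq> q" "\<exists>y\<in>elts x. feq r \<tau> (check P y)"
      then obtain y where y: "y \<in> elts x" "eqn r \<tau> (check P y)" using q by (auto simp: eqn_def)
      have "frc r (F (check P y))" using * y r that frc_mono below_trans by blast
      then show "frc r (F \<tau>)" using frc_cong1[OF F _ y(2)] r below_cond by blast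
    qed
  qed
  then show "frc p (BForall (check P x) F)" using p by (simp add: frc_BForall)
qed

lemma frc_BExists_check:
  assumes F: "\<And>a a'. fmrel (insert (a, a') Idn) (F a) (F a')"
  shows "frc p (BExists (check P x) F) \<longleftrightarrow> dns p (\<lambda>r. \<exists>y\<in>elts x. frc r (F (check P y)))"
proof
  assume "frc p (BExists (check P x) F)"
  then have "dns p (\<lambda>r. dns r (\<lambda>r. \<exists>y\<in>elts x. frc r (F (check P y))))"
    unfolding frc_BExists[OF isname_check]
  proof (elim dns_mono exE conjE)
    fix r \<tau> assume r: "r \<preceq> p" "isname \<tau>" "fmem r \<tau> (check P x)" "frc r (F \<tau>)"
    show "dns r (\<lambda>r. \<exists>y\<in>elts x. frc r (F (check P y)))"
      using r(3) unfolding fmem_check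
    proof (rule dns_mono)
      fix s assume s: "s \<preceq> r" "\<exists>y\<in>elts x. feq s \<tau> (check P y)"
      then obtain y where y: "y \<in> elts x" "eqn s \<tau> (check P y)" using r by (auto simp: eqn_def)
      have "frc s (F (check P y))" using frc_cong1[OF F _ y(2)] s r frc_mono below_cond by blast
      then show "\<exists>y\<in>elts x. frc s (F (check P y))" using y by blast
    qed
  qed
  then show "dns p (\<lambda>r. \<exists>y\<in>elts x. frc r (F (check P y)))" by (rule dns_dns)
next
  assume "dns p (\<lambda>r. \<exists>y\<in>elts x. frc r (F (check P y)))"
  then show "frc p (BExists (check P x) F)"
    unfolding frc_BExists[OF isname_check] using fmem_checkI isname_check
    by (elim dns_mono) blast
qed

lemma frc_Trans_check:
  assumes "p \<in> elts P" "transitive x"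
  shows "frc p (Trans (check P x))"
proof -
  have R1: "fmrel (insert (a, a') Idn) (Mem a (check P x)) (Mem a' (check P x))" for a a'
    by (intro fmrel_intros) auto
  have R2: "fmrel (insert (a, a') Idn) (BForall a (\<lambda>z. Mem z (check P x)))
      (BForall a' (\<lambda>z. Mem z (check P x)))" for a a'
    by (intro fmrel_intros) auto
  show ?thesis
    unfolding Trans_def frc_BForall_check[OF R2 assms(1)] frc_BForall_check[OF R1 assms(1)]
    using assms by (auto simp: frc_Mem fmem_check_iff transitive_def)
qed

lemma frc_Ord_check:
  assumes "p \<in> elts P" "ordinal x"
  shows "frc p (Ord (check P x))"
proof -
  have "fmrel (insert (a, a') Idn) (Trans a) (Trans a')" for a a'
    by (intro fmrel_Trans) auto
  from frc_BForall_check[OF this assms(1)] show ?thesis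
    using assms by (simp add: Ord_def frc_Conj frc_Trans_check ordinal_def)
qed

text \<open>Bounds every name forced to satisfy \<open>IsOmega\<close>: with
  \<open>check P omega\<close> as a member it would have a limit ordinal as a member.\<close>

lemma frc_LimitOrd_omega:
  assumes "p \<in> elts P"
  shows "frc p (LimitOrd (check P omega))"
proof -
  have "fmem q (check P (num 0)) (check P omega)" for q
    by (rule fmem_checkI) (simp add: elts_omega del: num.simps)
  then have "frc p (Exists (\<lambda>y. Mem y (check P omega)))"
    unfolding frc_Exists using frc_Mem isname_check by (intro dns_all) blast
  moreover have "frc p (BExists (check P omega) (Mem (check P (num n))))" for n
  proof -
    have "fmrel (insert (a, a') Idn) (Mem (check P (num n)) a) (Mem (check P (num n)) a')" for a a'
      by (intro fmrel_intros) auto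
    moreover have "frc q (Mem (check P (num n)) (check P (num (Suc n))))" for q
      using fmem_checkI[of "num n" "num (Suc n)"] by (simp add: frc_Mem del: num.simps)
    moreover have "num (Suc n) \<in> elts omega" by (simp add: elts_omega del: num.simps)
    ultimately show ?thesis by (subst frc_BExists_check) (blast intro: dns_all)+
  qed
  moreover have "fmrel (insert (a, a') Idn) (BExists (check P omega) (Mem a))
      (BExists (check P omega) (Mem a'))" for a a'
    by (intro fmrel_intros) auto
  note frc_BForall_check[OF this assms, of omega]
  ultimately show ?thesis
    using assms by (simp add: LimitOrd_def frc_Conj frc_Ord_check ordinal_omega elts_omega)
qed

lemma frc_TransD:
  assumes "frc p (Trans x)" "isname x" "isname y" "isname z" "q \<preceq> p" "fmem q y x" "fmem q z y"
  shows "fmem q z x"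
proof -
  have "frc q (BForall y (\<lambda>z. Mem z x))"
    using assms below_cond unfolding Trans_def by (simp add: frc_BForall)
  then show ?thesis using assms below_cond below_refl by (simp add: frc_BForall frc_Mem)
qed

lemma frc_Ord_elt:
  assumes "frc p (Ord x)" "isname x" "isname y" "q \<preceq> p" "fmem q y x"
  shows "frc q (Ord y)"
proof -
  have *: "frc p (Trans x)" "frc p (BForall x Trans)" using assms by (auto simp: Ord_def frc_Conj)
  have T: "frc r (Trans z)" if "isname z" "r \<preceq> p" "fmem r z x" for r z
    using * that assms below_cond by (simp add: frc_BForall)
  have "frc r (Trans z)" if z: "isname z" "r \<preceq> q" "fmem r z y" for r z
  proof -
    have r: "r \<preceq> p" "fmem r y x" using z assms below_trans fmem_mono by blast+
    then have "fmem r z x" using frc_TransD[OF *(1) assms(2,3) z(1)] z(3) by blast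
    then show ?thesis using T z r by blast
  qed
  then have "frc q (BForall y Trans)" using assms below_cond by (simp add: frc_BForall)
  then show ?thesis using T assms by (simp add: Ord_def frc_Conj)
qed

text \<open>Forcing adds no ordinals. By induction the members of \<tau> densely have ground-model
  values; the least ordinal that some extension of \<open>q\<close> excludes from \<tau> is then the
  value of \<tau> below that extension.\<close>

lemma frc_Ord_dns_check:
  "isname \<tau> \<Longrightarrow> frc p (Ord \<tau>) \<Longrightarrow> dns p (\<lambda>r. \<exists>\<alpha>. ordinal \<alpha> \<and> feq r \<tau> (check P \<alpha>))"
proof (induction \<tau> arbitrary: p rule: trcl_induct)
  case (1 \<tau>)
  have T: "frc p (Trans \<tau>)" using 1 by (simp add: Ord_def frc_Conj)
  have elt: "dns q (\<lambda>r. \<exists>\<beta>. ordinal \<beta> \<and> feq r \<pi> (check P \<beta>))"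
    if "isname \<pi>" "q \<preceq> p" "fmem q \<pi> \<tau>" for \<pi> q
  proof -
    have "dns q (\<lambda>r. dns r (\<lambda>r. \<exists>\<beta>. ordinal \<beta> \<and> feq r \<pi> (check P \<beta>)))"
      using that(3) unfolding fmem_def
    proof (elim dns_mono exE conjE)
      fix r \<pi>' s' assume r: "r \<preceq> q" "vpair \<pi>' s' \<in> elts \<tau>" "r \<preceq> s'" "feq r \<pi>' \<pi>"
      have n: "isname \<pi>'" "\<pi>' \<in> trcl \<tau>" using r 1 isname_pairD vpair_mem_trcl by blast+
      have "frc r (Ord \<pi>')"
        using frc_Ord_elt[OF 1(3,2) n(1)] fmem_elt r that below_trans by blast
      from 1(1)[OF n(2,1) this] show "dns r (\<lambda>r. \<exists>\<beta>. ordinal \<beta> \<and> feq r \<pi> (check P \<beta>))"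
        by (rule dns_mono) (meson r(4) feq_mono feq_sym feq_trans)
    qed
    then show ?thesis by (rule dns_dns)
  qed
  \<comment> \<open>The possible values of listed members form a set, so some ordinal is excluded
    from \<tau> by every condition. It makes \<open>M\<close> below nonempty.\<close>
  obtain \<gamma> where \<gamma>: "ordinal \<gamma>" "\<gamma> \<notin> {x. \<exists>\<pi>\<in>trcl \<tau>. \<exists>r\<in>elts P. feq r \<pi> (check P x)}"
    using ex_ordinal_notin[OF small_check_values[OF small_trcl]] by blast
  have \<gamma>n: "\<not> fmem q (check P \<gamma>) \<tau>" if q: "q \<in> elts P" for q
  proof
    assume "fmem q (check P \<gamma>) \<tau>"
    then obtain r \<pi> s where "vpair \<pi> s \<in> elts \<tau>" "r \<preceq> q" "feq r \<pi> (check P \<gamma>)"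
      unfolding fmem_def using dns_ex q by blast
    then show False using \<gamma>(2) vpair_mem_trcl below_cond by blast
  qed
  show ?case
  proof (rule dnsI)
    fix q assume q: "q \<preceq> p"
    define M where "M = {\<delta>. ordinal \<delta> \<and> (\<exists>r. r \<preceq> q \<and> (\<forall>r'. r' \<preceq> r \<longrightarrow> \<not> fmem r' (check P \<delta>) \<tau>))}"
    have "\<gamma> \<in> M" using \<gamma>(1) \<gamma>n q below_cond below_refl unfolding M_def by blast
    from foundation[unfolded wf_eq_minimal, rule_format, OF this]
    obtain \<delta> where \<delta>: "\<delta> \<in> M" and min: "\<And>\<beta>. \<beta> \<in> elts \<delta> \<Longrightarrow> \<beta> \<notin> M" by auto
    obtain r where r: "r \<preceq> q" and rn: "\<And>r'. r' \<preceq> r \<Longrightarrow> \<not> fmem r' (check P \<delta>) \<tau>" and ord: "ordinal \<delta>"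
      using \<delta> unfolding M_def by blast
    \<comment> \<open>An ordinal outside \<open>M\<close> is excluded by no extension of
      \<open>q\<close>, hence it is densely, and so outright, forced into \<tau>.\<close>
    have below: "fmem q (check P \<beta>) \<tau>" if "\<beta> \<in> elts \<delta>" for \<beta>
      using min[OF that] ordinal_elt[OF ord that] unfolding M_def
      by (intro fmem_dns dnsI) blast
    have "feq r \<tau> (check P \<delta>)"
    proof (rule feq_extI)
      fix \<pi> q' assume q': "isname \<pi>" "q' \<preceq> r"
      then have q'p: "q' \<preceq> p" using r q below_trans by blast
      show "fmem q' \<pi> \<tau> \<longleftrightarrow> fmem q' \<pi> (check P \<delta>)"
      proof
        assume m: "fmem q' \<pi> \<tau>"
        show "fmem q' \<pi> (check P \<delta>)"
          unfolding fmem_check using elt[OF q'(1) q'p m]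
        proof (elim dns_mono exE conjE)
          fix u \<beta> assume u: "u \<preceq> q'" "ordinal \<beta>" "feq u \<pi> (check P \<beta>)"
          then have mu: "fmem u (check P \<beta>) \<tau>" using m fmem_mono fmem_cong1 by blast
          have up: "u \<preceq> p" "u \<preceq> r" using u q'p q' below_trans by blast+
          have "\<beta> \<noteq> \<delta>" using mu rn up by blast
          \<comment> \<open>Otherwise the forced transitivity of \<tau> would put \<delta> into
            \<tau>.\<close>
          moreover have "\<delta> \<notin> elts \<beta>"
            using frc_TransD[OF T 1(2) _ _ up(1) mu, of "check P \<delta>"] fmem_checkI rn up isname_check
            by blast
          ultimately have "\<beta> \<in> elts \<delta>" using ordinal_linear u(2) ord by blast
          with u show "\<exists>y\<in>elts \<delta>. feq u \<pi> (check P y)" by blast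
        qed
      next
        assume "fmem q' \<pi> (check P \<delta>)"
        then show "fmem q' \<pi> \<tau>"
          unfolding fmem_check
        proof (intro fmem_dns, elim dns_mono bexE)
          fix u \<beta> assume u: "u \<preceq> q'" "\<beta> \<in> elts \<delta>" "feq u \<pi> (check P \<beta>)"
          have "fmem u (check P \<beta>) \<tau>"
            using below[OF u(2)] u(1) q'(2) r below_trans fmem_mono by blast
          then show "fmem u \<pi> \<tau>" using u feq_sym fmem_cong1 by blast
        qed
      qed
    qed (use 1 in auto)
    then show "\<exists>r. r \<preceq> q \<and> (\<exists>\<alpha>. ordinal \<alpha> \<and> feq r \<tau> (check P \<alpha>))" using r ord by blast
  qed
qed

text \<open>The name \<open>w\<close> densely has an ordinal value. If \<omega> belonged to that
  value, \<open>w\<close> would have a limit member, so every element of the value is a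
  numeral.\<close>

lemma frc_IsOmega_elt:
  assumes "frc p (IsOmega w)" "isname w" "isname n" "fmem p n w"
  shows "dns p (\<lambda>r. \<exists>k. feq r n (check P (num k)))"
proof -
  have L: "frc p (LimitOrd w)" "frc p (BForall w (\<lambda>y. Neg (LimitOrd y)))"
    using assms(1) by (auto simp: IsOmega_def frc_Conj)
  then have "frc p (Ord w)" by (simp add: LimitOrd_def frc_Conj)
  from frc_Ord_dns_check[OF assms(2) this]
  have "dns p (\<lambda>r. dns r (\<lambda>r. \<exists>k. feq r n (check P (num k))))"
  proof (elim dns_mono exE conjE)
    fix r \<alpha> assume r: "r \<preceq> p" "ordinal \<alpha>" "feq r w (check P \<alpha>)"
    have "omega \<notin> elts \<alpha>"
    proof
      assume "omega \<in> elts \<alpha>"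
      then have "fmem r (check P omega) w" using fmem_checkI fmem_cong2 feq_sym r by blast
      moreover have "r \<in> elts P" "p \<in> elts P" using r below_cond by blast+
      ultimately have "frc r (Neg (LimitOrd (check P omega)))"
        using L(2) r(1) assms by (simp add: frc_BForall)
      then show False using frc_LimitOrd_omega \<open>r \<in> elts P\<close> below_refl unfolding frc_Neg by blast
    qed
    then have sub: "elts \<alpha> \<subseteq> range num" using ordinal_subset_omega r by blast
    have "fmem r n (check P \<alpha>)" using assms r fmem_mono fmem_cong2 by blast
    then show "dns r (\<lambda>r. \<exists>k. feq r n (check P (num k)))"
      unfolding fmem_check by (rule dns_mono) (use sub in blast)
  qed
  then show ?thesis by (rule dns_dns)
qed

text \<open>\<open>G q k \<alpha>\<close> expresses that \<open>q\<close> forces \<open>\<alpha>\<close> to be the element of \<open>t\<close> with index \<open>k\<close> in a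
  fixed enumeration.\<close>

lemma frc_CountableSetOfOrdinals_enum:
  assumes "frc p (CountableSetOfOrdinals t)" "isname t" "p \<in> elts P"
  shows "\<exists>r G. r \<preceq> p \<and>
    (\<forall>q q' k \<alpha>. G q k \<alpha> \<longrightarrow> q' \<preceq> q \<longrightarrow> G q' k \<alpha>) \<and>
    (\<forall>q k \<alpha>. G q k \<alpha> \<longrightarrow> fmem q (check P \<alpha>) t) \<and>
    (\<forall>q y. q \<preceq> r \<longrightarrow> isname y \<longrightarrow> fmem q y t \<longrightarrow>
       dns q (\<lambda>s. \<exists>k \<alpha>. feq s y (check P \<alpha>) \<and> G s k \<alpha>)) \<and>
    (\<forall>q k \<alpha> \<beta>. q \<preceq> r \<longrightarrow> G q k \<alpha> \<longrightarrow> G q (k::nat) \<beta> \<longrightarrow> \<alpha> = \<beta>)"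
proof -
  have ord: "frc p (BForall t Ord)" and cnt: "frc p (Countable t)"
    using assms by (auto simp: CountableSetOfOrdinals_def frc_Conj)
  obtain r0 w where r0: "r0 \<preceq> p" "isname w" "frc r0 (IsOmega w)"
     and ex: "frc r0 (Exists (\<lambda>f.
     Conj (BForall t (\<lambda>y. BExists w (\<lambda>n. PairIn y n f)))
    (Conj (BForall t (\<lambda>y. BForall w (\<lambda>m. BForall w (\<lambda>n.
             Imp (Conj (PairIn y m f) (PairIn y n f)) (Eq m n)))))
          (BForall t (\<lambda>y. BForall t (\<lambda>z. BForall w (\<lambda>n.
             Imp (Conj (PairIn y n f) (PairIn z n f)) (Eq y z))))))))"
    using dns_ex[OF cnt[unfolded Countable_def frc_Exists[where p = p]] assms(3)]
    by (auto simp: frc_Conj)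
  have r0P: "r0 \<in> elts P" using r0 below_cond by blast
  obtain r f where r: "r \<preceq> r0" "isname f"
    and total: "frc r (BForall t (\<lambda>y. BExists w (\<lambda>n. PairIn y n f)))"
    and inj: "frc r (BForall t (\<lambda>y. BForall t (\<lambda>z. BForall w (\<lambda>n.
             Imp (Conj (PairIn y n f) (PairIn z n f)) (Eq y z)))))"
    using dns_ex[OF ex[unfolded frc_Exists[where p = r0]] r0P] by (auto simp: frc_Conj)
  have rP: "r \<in> elts P" "r \<preceq> p" using r r0 below_cond below_trans by blast+
  \<comment> \<open>The memberships in \<open>t\<close> and \<open>w\<close> are recorded along with
    the pair in \<open>f\<close>, since the forced injectivity of \<open>f\<close> is stated by
    quantifiers bounded by \<open>t\<close> and \<open>w\<close>.\<close>
  define G where "G = (\<lambda>q k \<alpha>. q \<in> elts P \<and> fmem q (check P \<alpha>) t \<and> fmem q (check P (num k)) w \<and>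
      fmem q (opn (check P \<alpha>) (check P (num k))) f)"
  have "G q' k \<alpha>" if "G q k \<alpha>" "q' \<preceq> q" for q q' k \<alpha>
    using that fmem_mono below_cond unfolding G_def by blast
  moreover have "fmem q (check P \<alpha>) t" if "G q k \<alpha>" for q k \<alpha>
    using that by (simp add: G_def)
  moreover have "dns q (\<lambda>s. \<exists>k \<alpha>. feq s y (check P \<alpha>) \<and> G s k \<alpha>)"
    if q: "q \<preceq> r" "isname y" "fmem q y t" for q y
  proof -
    have qP: "q \<in> elts P" "q \<preceq> p" using q rP below_cond below_trans by blast+
    have "frc q (Ord y)" using ord q qP assms by (simp add: frc_BForall)
    then have d1: "dns q (\<lambda>s. \<exists>\<alpha>. ordinal \<alpha> \<and> feq s y (check P \<alpha>))" using frc_Ord_dns_check q by blast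
    have d2: "dns q (\<lambda>s. \<exists>n. isname n \<and> fmem s n w \<and> frc s (PairIn y n f))"
      using total q rP assms r0 by (simp add: frc_BForall frc_BExists)
    show ?thesis
    proof (rule dnsI)
      fix q1 assume q1: "q1 \<preceq> q"
      obtain q2 \<alpha> where q2: "q2 \<preceq> q1" "q2 \<preceq> q" "feq q2 y (check P \<alpha>)" using dnsE[OF d1 q1] by blast
      obtain q3 n where q3: "q3 \<preceq> q2" "q3 \<preceq> q" "isname n" "fmem q3 n w" "frc q3 (PairIn y n f)"
        using dnsE[OF d2 q2(2)] by blast
      have "frc q3 (IsOmega w)" using frc_mono r0(3) r(1) q(1) q3(2) below_trans by blast
      from dns_ex[OF frc_IsOmega_elt[OF this r0(2) q3(3,4)]]
      obtain q4 k where q4: "q4 \<preceq> q3" "feq q4 n (check P (num k))" using q3 below_cond by blast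
      have q4P: "q4 \<in> elts P" "q3 \<in> elts P" using q4 below_cond by blast+
      have "fmem q4 (opn y n) f"
        using q3 q4 q4P r q fmem_mono by (simp add: frc_PairIn)
      moreover have fy: "feq q4 y (check P \<alpha>)" using q2 q3 q4 feq_mono by blast
      ultimately have "fmem q4 (opn (check P \<alpha>) (check P (num k))) f"
        using opn_cong q4 fmem_cong1 by blast
      moreover have "fmem q4 (check P \<alpha>) t"
        using fy q(3) q3 q4 fmem_mono fmem_cong1 by blast
      moreover have "fmem q4 (check P (num k)) w" using q3 q4 fmem_mono fmem_cong1 by blast
      ultimately have "G q4 k \<alpha>" using q4P by (simp add: G_def)
      moreover have "q4 \<preceq> q1" using q4 q3 q2 below_trans by blast
      ultimately show "\<exists>s. s \<preceq> q1 \<and> (\<exists>k \<alpha>. feq s y (check P \<alpha>) \<and> G s k \<alpha>)" using fy by blast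
    qed
  qed
  moreover have "\<alpha> = \<beta>" if q: "q \<preceq> r" "G q k \<alpha>" "G q k \<beta>" for q k \<alpha> \<beta>
  proof -
    have qP: "q \<in> elts P" "q \<preceq> q" using q below_cond below_refl by blast+
    from q have m: "fmem q (check P \<alpha>) t" "fmem q (check P \<beta>) t" "fmem q (check P (num k)) w"
      by (simp_all add: G_def)
    note frc_BForallD[OF inj assms(2) isname_check q(1) m(1)]
    from frc_BForallD[OF this assms(2) isname_check qP(2) m(2)]
    have "frc q (BForall w (\<lambda>n. Imp (Conj (PairIn (check P \<alpha>) n f) (PairIn (check P \<beta>) n f))
        (Eq (check P \<alpha>) (check P \<beta>))))" .
    from frc_BForallD[OF this r0(2) isname_check qP(2) m(3)]
    have "frc q (Imp (Conj (PairIn (check P \<alpha>) (check P (num k)) f)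
        (PairIn (check P \<beta>) (check P (num k)) f)) (Eq (check P \<alpha>) (check P \<beta>)))" .
    from this[unfolded frc_Imp[OF qP(1)], rule_format, OF qP(2)]
    have "feq q (check P \<alpha>) (check P \<beta>)"
      using q qP r by (simp add: frc_Imp frc_Conj frc_PairIn frc_Eq G_def)
    then show ?thesis using feq_check_iff qP by blast
  qed
  ultimately show ?thesis using rP(2) by blast
qed

end

section \<open>Invariance in one variable and quantifiers over the conditions of a named
  poset\<close>

context forcing
begin

text \<open>The fragment of uniformity that concerns one variable. It follows from
  \<open>fmrel\<close> where that is at hand, but also covers \<open>Forces\<close> applied to a
  general formula, for which it is proved directly.\<close>

definition resp :: "'v \<Rightarrow> ('v \<Rightarrow> 'v fm) \<Rightarrow> bool" where
  "resp p F \<longleftrightarrow> (\<forall>q x y. q \<preceq> p \<longrightarrow> eqn q x y \<longrightarrow> frc q (F x) \<longrightarrow> frc q (F y))"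

lemma respI_fmrel: "(\<And>a a'. fmrel (insert (a, a') Idn) (F a) (F a')) \<Longrightarrow> resp p F"
  unfolding resp_def using frc_cong1 below_cond by metis

lemma respD: "resp p F \<Longrightarrow> q \<preceq> p \<Longrightarrow> isname x \<Longrightarrow> isname y \<Longrightarrow> feq q x y \<Longrightarrow> frc q (F x) \<Longrightarrow> frc q (F y)"
  unfolding resp_def eqn_def by blast

lemma frc_PairIn_cong2:
  assumes "eqn p y y'" "p \<in> elts P" "isname x" "isname z" "q \<preceq> p"
  shows "frc q (PairIn x y z) \<longleftrightarrow> frc q (PairIn x y' z)"
proof -
  have "frc q (PairIn x y z) \<longleftrightarrow> fmem q (opn x y) z" "frc q (PairIn x y' z) \<longleftrightarrow> fmem q (opn x y') z"
    using assms below_cond by (auto simp: frc_PairIn eqn_def)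
  moreover have "feq q (opn x y) (opn x y')" using assms by (auto simp: eqn_def intro: opn_cong feq_mono)
  ultimately show ?thesis using fmem_cong feq_refl by blast
qed

lemma frc_BelowForall:
  assumes "p \<in> elts P" "isname A"
  shows "frc p (BelowForall A L x F) \<longleftrightarrow>
    (\<forall>\<tau> q. isname \<tau> \<longrightarrow> q \<preceq> p \<longrightarrow> fmem q \<tau> A \<longrightarrow> frc q (PairIn \<tau> x L) \<longrightarrow> frc q (F \<tau>))" (is "?l \<longleftrightarrow> ?r")
proof -
  have "?l \<longleftrightarrow> (\<forall>\<tau>. isname \<tau> \<longrightarrow> (\<forall>q. q \<preceq> p \<longrightarrow> fmem q \<tau> A \<longrightarrow>
      (\<forall>r. r \<preceq> q \<longrightarrow> frc r (PairIn \<tau> x L) \<longrightarrow> frc r (F \<tau>))))"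
    unfolding BelowForall_def frc_BForall[OF assms]
    by (intro all_cong1 imp_cong refl) (simp add: frc_Imp below_cond)
  also have "\<dots> \<longleftrightarrow> ?r" using below_trans below_refl below_cond fmem_mono by meson
  finally show ?thesis .
qed

lemma frc_BelowExists:
  assumes "isname A"
  shows "frc p (BelowExists A L x F) \<longleftrightarrow>
    dns p (\<lambda>r. \<exists>\<tau>. isname \<tau> \<and> fmem r \<tau> A \<and> frc r (PairIn \<tau> x L) \<and> frc r (F \<tau>))"
  unfolding BelowExists_def frc_BExists[OF assms] frc_Conj ..

lemma frc_BelowForall_cong:
  assumes "eqn p x y" "p \<in> elts P" "isname A" "isname L"
  shows "frc p (BelowForall A L x F) \<longleftrightarrow> frc p (BelowForall A L y F)"
  unfolding frc_BelowForall[OF assms(2,3)]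
  using frc_PairIn_cong2[OF assms(1,2) _ assms(4)] by blast

lemma frc_BelowExists_cong:
  assumes "eqn p x y" "p \<in> elts P" "isname A" "isname L"
  shows "frc p (BelowExists A L x F) \<longleftrightarrow> frc p (BelowExists A L y F)"
  unfolding frc_BelowExists[OF assms(3)]
  by (rule dns_cong) (use frc_PairIn_cong2[OF assms(1,2) _ assms(4)] in blast)

end

section \<open>Product posets\<close>

definition prod_set :: "'v::zfc \<Rightarrow> 'v \<Rightarrow> 'v" where
  "prod_set P Q = vset {vpair p q |p q. p \<in> elts P \<and> q \<in> elts Q}"

definition prod_le :: "'v::zfc \<Rightarrow> 'v \<Rightarrow> 'v \<Rightarrow> 'v \<Rightarrow> 'v" where
  "prod_le P leP Q leQ = vset {vpair (vpair p q) (vpair p' q') |p q p' q'.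
     p \<in> elts P \<and> q \<in> elts Q \<and> p' \<in> elts P \<and> q' \<in> elts Q \<and> leq leP p p' \<and> leq leQ q q'}"

lemma elts_prod_set: "elts (prod_set P Q) = {vpair p q |p q. p \<in> elts P \<and> q \<in> elts Q}"
  unfolding prod_set_def by (intro elts_vset small_vpair_image small_elts)

lemma elts_prod_le: "elts (prod_le P leP Q leQ) = {vpair (vpair p q) (vpair p' q') |p q p' q'.
     p \<in> elts P \<and> q \<in> elts Q \<and> p' \<in> elts P \<and> q' \<in> elts Q \<and> leq leP p p' \<and> leq leQ q q'}" (is "_ = ?S")
proof -
  have "small {vpair c d |c d. c \<in> elts (prod_set P Q) \<and> d \<in> elts (prod_set P Q)}"
    by (intro small_vpair_image small_elts)
  then have "small ?S" by (rule small_subset) (auto simp: elts_prod_set)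
  then show ?thesis unfolding prod_le_def by simp
qed

locale two_forcing = P: forcing P leP + Q: forcing Q leQ for P leP Q leQ :: "'v::zfc"
begin

abbreviation PQ where "PQ \<equiv> prod_set P Q"
abbreviation lePQ where "lePQ \<equiv> prod_le P leP Q leQ"

lemma vpair_PQ [simp]: "vpair p q \<in> elts PQ \<longleftrightarrow> p \<in> elts P \<and> q \<in> elts Q"
  by (auto simp: elts_prod_set)

lemma leq_PQ [simp]: "leq lePQ (vpair p q) (vpair p' q') \<longleftrightarrow> leq leP p p' \<and> leq leQ q q'"
  using P.below_cond Q.below_cond by (auto simp: leq_def[of lePQ] elts_prod_le)

lemma PQ_cases: "c \<in> elts PQ \<Longrightarrow> (\<And>p q. c = vpair p q \<Longrightarrow> p \<in> elts P \<Longrightarrow> q \<in> elts Q \<Longrightarrow> thesis) \<Longrightarrow> thesis"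
  by (auto simp: elts_prod_set)

lemma leq_PQ_cond: "leq lePQ c d \<Longrightarrow> c \<in> elts PQ" "leq lePQ c d \<Longrightarrow> d \<in> elts PQ"
  by (auto simp: leq_def[of lePQ] elts_prod_le)

lemma leq_PQ_cases:
  assumes "leq lePQ c (vpair p q)"
  obtains p' q' where "c = vpair p' q'" "leq leP p' p" "leq leQ q' q"
proof -
  from leq_PQ_cond(1)[OF assms] obtain p' q' where "c = vpair p' q'" by (rule PQ_cases)
  with assms that show thesis by simp
qed

lemma forcing_poset_PQ: "forcing_poset PQ lePQ"
proof -
  obtain p q where "p \<in> elts P" "q \<in> elts Q"
    using P.poset Q.poset unfolding forcing_poset_def by blast
  then have "vpair p q \<in> elts PQ" by simp
  then have "elts PQ \<noteq> {}" by blast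
  moreover have "elts lePQ \<subseteq> {vpair c d |c d. c \<in> elts PQ \<and> d \<in> elts PQ}"
    by (auto simp: elts_prod_le)
  moreover have "\<forall>c\<in>elts PQ. leq lePQ c c"
    by (auto elim!: PQ_cases)
  moreover have "\<forall>c\<in>elts PQ. \<forall>d\<in>elts PQ. \<forall>e\<in>elts PQ. leq lePQ c d \<and> leq lePQ d e \<longrightarrow> leq lePQ c e"
    by (auto elim!: PQ_cases intro: P.below_trans Q.below_trans)
  ultimately show ?thesis unfolding forcing_poset_def by blast
qed

sublocale PQ: forcing PQ lePQ
  by unfold_locales (rule forcing_poset_PQ)

lemma PQ_dns: "PQ.dns (vpair p q) \<Phi> \<longleftrightarrow>
    (\<forall>p' q'. leq leP p' p \<longrightarrow> leq leQ q' q \<longrightarrow>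
      (\<exists>p'' q''. leq leP p'' p' \<and> leq leQ q'' q' \<and> \<Phi> (vpair p'' q'')))"
proof
  assume *: "PQ.dns (vpair p q) \<Phi>"
  show "\<forall>p' q'. leq leP p' p \<longrightarrow> leq leQ q' q \<longrightarrow>
      (\<exists>p'' q''. leq leP p'' p' \<and> leq leQ q'' q' \<and> \<Phi> (vpair p'' q''))"
  proof (intro allI impI)
    fix p' q' assume "leq leP p' p" "leq leQ q' q"
    then obtain c where "leq lePQ c (vpair p' q')" "\<Phi> c" using PQ.dnsD[OF *, of "vpair p' q'"] by auto
    then show "\<exists>p'' q''. leq leP p'' p' \<and> leq leQ q'' q' \<and> \<Phi> (vpair p'' q'')"
      by (metis leq_PQ_cases)
  qed
next
  assume *: "\<forall>p' q'. leq leP p' p \<longrightarrow> leq leQ q' q \<longrightarrow>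
      (\<exists>p'' q''. leq leP p'' p' \<and> leq leQ q'' q' \<and> \<Phi> (vpair p'' q''))"
  show "PQ.dns (vpair p q) \<Phi>"
  proof (rule PQ.dnsI)
    fix c assume "leq lePQ c (vpair p q)"
    then obtain p' q' where c: "c = vpair p' q'" "leq leP p' p" "leq leQ q' q" by (rule leq_PQ_cases)
    then obtain p'' q'' where "leq leP p'' p' \<and> leq leQ q'' q' \<and> \<Phi> (vpair p'' q'')" using * by blast
    then show "\<exists>d. leq lePQ d c \<and> \<Phi> d" using c by (intro exI[of _ "vpair p'' q''"]) simp
  qed
qed

lemma PQ_isnameD:
  "PQ.isname a \<Longrightarrow> z \<in> elts a \<Longrightarrow>
    \<exists>b p q. z = vpair b (vpair p q) \<and> p \<in> elts P \<and> q \<in> elts Q \<and> PQ.isname b"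
  by (metis PQ.isnameD PQ_cases)

lemma PQ_isname_pairD:
  assumes "PQ.isname a" "vpair b (vpair p q) \<in> elts a"
  shows "PQ.isname b" "p \<in> elts P" "q \<in> elts Q"
  using PQ.isname_pairD[OF assms] by simp_all

section \<open>Product names as names for names\<close>

text \<open>\<open>st a\<close> is a \<open>P\<close>-name for the \<open>Q\<close>-name that results from the \<open>P \<times> Q\<close>-name \<open>a\<close> by evaluating only the
  first coordinates of its conditions.\<close>

definition st :: "'v \<Rightarrow> 'v" where
  "st = wfrec ({(x, y). x \<in> elts y}\<^sup>+)
     (\<lambda>f a. vset {vpair (P.opn (f b) (check P q)) p |b p q. vpair b (vpair p q) \<in> elts a})"

end

text \<open>All three components lie in the transitive closure of \<open>a\<close>, whether or not
  \<open>a\<close> is a name; the recursion equation of \<open>st\<close> therefore needs no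
  hypothesis.\<close>

lemma small_triples:
  fixes a :: "'v::zfc" and g :: "'v \<Rightarrow> 'v \<Rightarrow> 'v \<Rightarrow> 'v"
  shows "small {g b p q |b p q. vpair b (vpair p q) \<in> elts a}"
proof (rule small_subset)
  show "small (\<Union>b\<in>trcl a. {g b p q |p q. p \<in> trcl a \<and> q \<in> trcl a})"
    by (intro small_UN small_image2 small_trcl)
  have vp: "vpair p q \<in> trcl a \<Longrightarrow> p \<in> trcl a \<and> q \<in> trcl a" for p q
  proof -
    assume "vpair p q \<in> trcl a"
    moreover have "vset {p, q} \<in> elts (vpair p q)" "p \<in> elts (vset {p, q})" "q \<in> elts (vset {p, q})"
      by (auto simp: vpair_def)
    ultimately show ?thesis by (meson trcl_elts trcl_trans)
  qed
  show "{g b p q |b p q. vpair b (vpair p q) \<in> elts a} \<subseteq>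
      (\<Union>b\<in>trcl a. {g b p q |p q. p \<in> trcl a \<and> q \<in> trcl a})"
  proof clarify
    fix b p q assume "vpair b (vpair p q) \<in> elts a"
    then have "b \<in> trcl a" "p \<in> trcl a" "q \<in> trcl a" using vpair_mem_trcl vp by metis+
    then show "g b p q \<in> (\<Union>b\<in>trcl a. {g b p q |p q. p \<in> trcl a \<and> q \<in> trcl a})" by auto
  qed
qed

context two_forcing
begin

lemma elts_st: "elts (st a) = {vpair (P.opn (st b) (check P q)) p |b p q. vpair b (vpair p q) \<in> elts a}"
proof -
  let ?R = "{(x, y). x \<in> elts y}\<^sup>+ :: ('v \<times> 'v) set"
  have "st a = vset {vpair (P.opn (cut st ?R a b) (check P q)) p |b p q. vpair b (vpair p q) \<in> elts a}"
    unfolding st_def by (subst wfrec[OF wf_trancl[OF foundation]]) simp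
  also have "{vpair (P.opn (cut st ?R a b) (check P q)) p |b p q. vpair b (vpair p q) \<in> elts a} =
      {vpair (P.opn (st b) (check P q)) p |b p q. vpair b (vpair p q) \<in> elts a}"
  proof -
    have "cut st ?R a b = st b" if "vpair b c \<in> elts a" for b c
      using vpair_mem_trcl(1)[OF that] by (simp add: cut_def trcl_def)
    then show ?thesis by (intro Collect_cong ex_cong1) auto
  qed
  finally show ?thesis
    using small_triples[of "\<lambda>b p q. vpair (P.opn (st b) (check P q)) p" a] by simp
qed

lemma isname_st: "PQ.isname a \<Longrightarrow> P.isname (st a)"
proof (induction a rule: trcl_induct)
  case (1 a)
  show ?case
  proof (rule P.isnameI)
    fix z assume "z \<in> elts (st a)"
    then obtain b p q where z: "z = vpair (P.opn (st b) (check P q)) p" "vpair b (vpair p q) \<in> elts a"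
      by (auto simp: elts_st)
    then have "P.isname (st b)" "p \<in> elts P" using 1 PQ_isname_pairD vpair_mem_trcl by blast+
    then show "\<exists>\<sigma> p. z = vpair \<sigma> p \<and> p \<in> elts P \<and> P.isname \<sigma>" using z by auto
  qed
qed

lemma fmem_st: "P.fmem p \<tau> (st a) \<longleftrightarrow> P.dns p (\<lambda>r. \<exists>b s t. vpair b (vpair s t) \<in> elts a \<and> leq leP r s \<and>
    P.feq r \<tau> (P.opn (st b) (check P t)))"
  unfolding P.fmem_def by (rule P.dns_cong) (auto simp: elts_st P.feq_commute[of _ \<tau>]; metis)

text \<open>Injectivity of forced pairs allows the two coordinates to be compared
  separately.\<close>

lemma fmem_pair_st: "P.fmem p (P.opn \<pi> \<sigma>) (st a) \<longleftrightarrow>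
   P.dns p (\<lambda>r. \<exists>b s t. vpair b (vpair s t) \<in> elts a \<and> leq leP r s \<and> P.feq r \<pi> (st b) \<and> P.feq r \<sigma> (check P t))"
  unfolding fmem_st by (rule P.dns_cong) (metis P.opn_cong P.opn_inj)

lemma fmem_st_elt: "vpair b (vpair s t) \<in> elts a \<Longrightarrow> leq leP p s \<Longrightarrow> P.fmem p (P.opn (st b) (check P t)) (st a)"
  by (rule P.fmem_elt) (auto simp: elts_st)

text \<open>If \<open>P\<close> forces the two \<open>Q\<close>-names to be the same set, every
  listed pair of one is densely a listed pair of the other, with the same condition of
  \<open>Q\<close>. This makes the name built in \<open>inner_eq_exists\<close> independent of
  representatives.\<close>

lemma feq_of_feq_st:
  "PQ.isname a \<Longrightarrow> PQ.isname b \<Longrightarrow> P.feq p (st a) (st b) \<Longrightarrow> q \<in> elts Q \<Longrightarrow> PQ.feq (vpair p q) a b"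
proof (induction a arbitrary: p q b rule: trcl_induct)
  case (1 a)
  \<comment> \<open>The induction hypothesis enters as a premise so that both inclusions share the
    argument. The induction is along subnames of \<open>a\<close>, which are on the right-hand side
    in the second inclusion.\<close>
  have fwd: "PQ.fmem (vpair p' q') c b'"
    if c: "vpair c (vpair s t) \<in> elts a'" "leq leP p' p" "leq leP p' s" "leq leQ q' t"
      and eq: "P.feq p (st a') (st b')"
      and IH: "\<And>d c' r x. vpair c (vpair s t) \<in> elts a' \<Longrightarrow> vpair d c' \<in> elts b' \<Longrightarrow>
          P.feq r (st c) (st d) \<Longrightarrow> x \<in> elts Q \<Longrightarrow> PQ.feq (vpair r x) c d"
    for a' b' c s t p' q'
  proof -
    have "P.fmem p' (P.opn (st c) (check P t)) (st b')"
      using fmem_st_elt[OF c(1,3)] eq c(2) P.feq_mono P.fmem_cong2 by blast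
    then have d: "P.dns p' (\<lambda>r. \<exists>d u t'. vpair d (vpair u t') \<in> elts b' \<and> leq leP r u \<and>
        P.feq r (st c) (st d) \<and> P.feq r (check P t) (check P t'))"
      unfolding fmem_pair_st .
    show ?thesis
      unfolding PQ.fmem_def PQ_dns
    proof (intro allI impI)
      fix p1 q1 assume p1: "leq leP p1 p'" "leq leQ q1 q'"
      obtain r d u t' where r: "leq leP r p1" "vpair d (vpair u t') \<in> elts b'" "leq leP r u"
        "P.feq r (st c) (st d)" "P.feq r (check P t) (check P t')"
        using P.dnsD[OF d p1(1)] by blast
      have "t = t'" using r P.feq_check_iff P.below_cond by metis
      have q1: "q1 \<in> elts Q" "leq leQ q1 q1" "leq leQ q1 t'"
        using p1 c \<open>t = t'\<close> Q.below_cond Q.below_refl Q.below_trans by blast+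
      have "PQ.feq (vpair r q1) d c" using IH[OF c(1) r(2) r(4) q1(1)] PQ.feq_sym by blast
      then have "\<exists>\<pi> s. vpair \<pi> s \<in> elts b' \<and> leq lePQ (vpair r q1) s \<and> PQ.feq (vpair r q1) \<pi> c"
        using r q1 by (intro exI[of _ d] exI[of _ "vpair u t'"]) simp
      then show "\<exists>p'' q''. leq leP p'' p1 \<and> leq leQ q'' q1 \<and>
         (\<exists>\<pi> s. vpair \<pi> s \<in> elts b' \<and> leq lePQ (vpair p'' q'') s \<and> PQ.feq (vpair p'' q'') \<pi> c)"
        using r q1 by blast
    qed
  qed
  show ?case
    unfolding PQ.feq_iff
  proof (intro conjI allI impI)
    fix c x y assume *: "vpair c x \<in> elts a" "leq lePQ y (vpair p q)" "leq lePQ y x"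
    obtain s t where x: "x = vpair s t" using PQ_isnameD[OF 1(2) *(1)] by auto
    obtain p' q' where y: "y = vpair p' q'" "leq leP p' p" "leq leQ q' q" using *(2) by (rule leq_PQ_cases)
    show "PQ.fmem y c b"
      unfolding y(1)
    proof (rule fwd[of c s t a])
      fix d c' r x' assume d: "vpair c (vpair s t) \<in> elts a" "vpair d c' \<in> elts b"
        "P.feq r (st c) (st d)" "x' \<in> elts Q"
      show "PQ.feq (vpair r x') c d"
        using 1(1)[OF vpair_mem_trcl(1)[OF d(1)] PQ.isname_pairD(1)[OF 1(2) d(1)] PQ.isname_pairD(1)[OF 1(3) d(2)] d(3,4)] .
    qed (use * x y 1 in auto)
  next
    fix c x y assume *: "vpair c x \<in> elts b" "leq lePQ y (vpair p q)" "leq lePQ y x"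
    obtain s t where x: "x = vpair s t" using PQ_isnameD[OF 1(3) *(1)] by auto
    obtain p' q' where y: "y = vpair p' q'" "leq leP p' p" "leq leQ q' q" using *(2) by (rule leq_PQ_cases)
    show "PQ.fmem y c a"
      unfolding y(1)
    proof (rule fwd[of c s t b])
      fix d c' r x' assume d: "vpair c (vpair s t) \<in> elts b" "vpair d c' \<in> elts a"
        "P.feq r (st c) (st d)" "x' \<in> elts Q"
      show "PQ.feq (vpair r x') c d"
        using 1(1)[OF vpair_mem_trcl(1)[OF d(2)] PQ.isname_pairD(1)[OF 1(2) d(2)] PQ.isname_pairD(1)[OF 1(3) d(1)]
            P.feq_sym[OF d(3)] d(4)] PQ.feq_sym by blast
    next
      show "P.feq p (st b) (st a)" using 1 P.feq_sym by blast
    qed (use * x y 1 in auto)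
  qed
qed

section \<open>The inner forcing relation\<close>

abbreviation cQ where "cQ \<equiv> check P Q"
abbreviation cL where "cL \<equiv> check P leQ"

text \<open>Each name for a condition of \<open>Q\<close> is densely a canonical name, the ordering
  between canonical names is absolute, and \<open>resp\<close> transfers \<open>F\<close> between
  the two.\<close>

lemma frc_BelowForall_cQ:
  assumes "p \<in> elts P" "P.resp p F"
  shows "P.frc p (BelowForall cQ cL (check P q) F) \<longleftrightarrow> (\<forall>x. leq leQ x q \<longrightarrow> P.frc p (F (check P x)))"
proof
  assume *: "P.frc p (BelowForall cQ cL (check P q) F)"
  show "\<forall>x. leq leQ x q \<longrightarrow> P.frc p (F (check P x))"
  proof (intro allI impI)
    fix x assume "leq leQ x q"
    then have "P.fmem p (check P x) cQ" "P.frc p (PairIn (check P x) (check P q) cL)"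
      using assms Q.below_cond by (auto simp: P.frc_PairIn_check leq_def intro: P.fmem_checkI)
    then show "P.frc p (F (check P x))"
      using *[unfolded P.frc_BelowForall[OF assms(1) P.isname_check]] P.isname_check assms(1) P.below_refl
      by blast
  qed
next
  assume *: "\<forall>x. leq leQ x q \<longrightarrow> P.frc p (F (check P x))"
  show "P.frc p (BelowForall cQ cL (check P q) F)"
    unfolding P.frc_BelowForall[OF assms(1) P.isname_check]
  proof (intro allI impI)
    fix \<tau> p' assume t: "P.isname \<tau>" "leq leP p' p" "P.fmem p' \<tau> cQ" "P.frc p' (PairIn \<tau> (check P q) cL)"
    show "P.frc p' (F \<tau>)"
    proof (rule P.frc_dns)
      show "p' \<in> elts P" using t P.below_cond by blast
      show "P.dns p' (\<lambda>r. P.frc r (F \<tau>))"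
        using t(3) unfolding P.fmem_check
      proof (elim P.dns_mono bexE)
        fix r x assume r: "leq leP r p'" "x \<in> elts Q" "P.feq r \<tau> (check P x)"
        have rP: "r \<in> elts P" "leq leP r p" using r t P.below_cond P.below_trans by blast+
        have "P.fmem r (P.opn \<tau> (check P q)) cL"
          using P.frc_mono[OF t(4) r(1)] rP t by (simp add: P.frc_PairIn)
        then have "P.fmem r (P.opn (check P x) (check P q)) cL"
          using r(3) P.opn_cong P.feq_refl P.fmem_cong1 by blast
        then have "leq leQ x q" using rP by (simp add: P.opn_check P.fmem_check_iff leq_def)
        then have "P.frc r (F (check P x))" using * rP P.frc_mono by blast
        then show "P.frc r (F \<tau>)"
          using P.respD[OF assms(2) rP(2) P.isname_check t(1) P.feq_sym[OF r(3)]] by blast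
      qed
    qed
  qed
qed

lemma frc_BelowExists_cQ:
  assumes "P.resp p F"
  shows "P.frc p (BelowExists cQ cL (check P q) F) \<longleftrightarrow>
    P.dns p (\<lambda>r. \<exists>x. leq leQ x q \<and> P.frc r (F (check P x)))"
proof
  assume "P.frc p (BelowExists cQ cL (check P q) F)"
  then have "P.dns p (\<lambda>r. P.dns r (\<lambda>r. \<exists>x. leq leQ x q \<and> P.frc r (F (check P x))))"
    unfolding P.frc_BelowExists[OF P.isname_check]
  proof (elim P.dns_mono exE conjE)
    fix p' \<tau> assume t: "leq leP p' p" "P.isname \<tau>" "P.fmem p' \<tau> cQ" "P.frc p' (PairIn \<tau> (check P q) cL)"
      "P.frc p' (F \<tau>)"
    show "P.dns p' (\<lambda>r. \<exists>x. leq leQ x q \<and> P.frc r (F (check P x)))"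
        using t(3) unfolding P.fmem_check
    proof (elim P.dns_mono bexE)
      fix r x assume r: "leq leP r p'" "x \<in> elts Q" "P.feq r \<tau> (check P x)"
      have rP: "r \<in> elts P" "leq leP r p" using r t P.below_cond P.below_trans by blast+
      have "P.fmem r (P.opn \<tau> (check P q)) cL"
        using P.frc_mono[OF t(4) r(1)] rP t by (simp add: P.frc_PairIn)
      then have "P.fmem r (P.opn (check P x) (check P q)) cL"
        using r(3) P.opn_cong P.feq_refl P.fmem_cong1 by blast
      then have "leq leQ x q" using rP by (simp add: P.opn_check P.fmem_check_iff leq_def)
      moreover have "P.frc r (F (check P x))"
        using P.respD[OF assms rP(2)] r t P.frc_mono by auto
      ultimately show "\<exists>x. leq leQ x q \<and> P.frc r (F (check P x))" by blast
    qed
  qed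
  then show "P.dns p (\<lambda>r. \<exists>x. leq leQ x q \<and> P.frc r (F (check P x)))" by (rule P.dns_dns)
next
  assume "P.dns p (\<lambda>r. \<exists>x. leq leQ x q \<and> P.frc r (F (check P x)))"
  then show "P.frc p (BelowExists cQ cL (check P q) F)"
    unfolding P.frc_BelowExists[OF P.isname_check]
  proof (elim P.dns_mono exE conjE)
    fix r x assume r: "leq leP r p" "leq leQ x q" "P.frc r (F (check P x))"
    then have "P.fmem r (check P x) cQ" "P.frc r (PairIn (check P x) (check P q) cL)"
      using P.below_cond Q.below_cond by (auto simp: P.frc_PairIn_check leq_def intro: P.fmem_checkI)
    then show "\<exists>\<tau>. P.isname \<tau> \<and> P.fmem r \<tau> cQ \<and> P.frc r (PairIn \<tau> (check P q) cL) \<and> P.frc r (F \<tau>)"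
      using r P.isname_check by blast
  qed
qed

lemma resp_BelowExists: "P.resp p (\<lambda>x. BelowExists cQ cL x F)"
  unfolding P.resp_def using P.frc_BelowExists_cong P.isname_check P.below_cond by blast

text \<open>Two layers of density fuse: for each extension of \<open>q\<close>, densely many
  conditions of \<open>P\<close> provide a further extension, which is density in the product below
  \<open>(p, q)\<close>.\<close>

lemma frc_DenseBelow_cQ:
  assumes "p \<in> elts P" "P.resp p F"
  shows "P.frc p (DenseBelow cQ cL (check P q) F) \<longleftrightarrow>
    PQ.dns (vpair p q) (\<lambda>c. \<exists>r x. c = vpair r x \<and> P.frc r (F (check P x)))"
proof -
  have "P.frc p (DenseBelow cQ cL (check P q) F) \<longleftrightarrow>
      (\<forall>x. leq leQ x q \<longrightarrow> P.dns p (\<lambda>r. \<exists>y. leq leQ y x \<and> P.frc r (F (check P y))))"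
    unfolding DenseBelow_def frc_BelowForall_cQ[OF assms(1) resp_BelowExists]
      frc_BelowExists_cQ[OF assms(2)] ..
  then show ?thesis unfolding PQ_dns P.dns_def vpair_inject by blast
qed

end

context forcing
begin

text \<open>A name for the set of those \<open>x \<in> A\<close> for which some condition \<open>p\<close> in the generic filter satisfies
  \<open>\<Theta> x p\<close>.\<close>

definition pn :: "'v set \<Rightarrow> ('v \<Rightarrow> 'v \<Rightarrow> bool) \<Rightarrow> 'v" where
  "pn A \<Theta> = vset {vpair x p |x p. x \<in> A \<and> p \<in> elts P \<and> \<Theta> x p}"

lemma elts_pn: "small A \<Longrightarrow> elts (pn A \<Theta>) = {vpair x p |x p. x \<in> A \<and> p \<in> elts P \<and> \<Theta> x p}"
  unfolding pn_def
  by (rule elts_vset, rule small_subset[OF small_vpair_image[of A "elts P"]]) auto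

lemma isname_pn: "small A \<Longrightarrow> (\<And>x. x \<in> A \<Longrightarrow> isname x) \<Longrightarrow> isname (pn A \<Theta>)"
  by (rule isnameI) (auto simp: elts_pn)

lemma fmem_pn:
  assumes "small A" "\<And>x p q. \<Theta> x p \<Longrightarrow> q \<preceq> p \<Longrightarrow> \<Theta> x q"
  shows "fmem p \<tau> (pn A \<Theta>) \<longleftrightarrow> dns p (\<lambda>r. \<exists>x\<in>A. \<Theta> x r \<and> feq r \<tau> x)"
  unfolding fmem_def
proof (rule dns_cong)
  fix r assume "r \<preceq> p"
  then have "r \<in> elts P" using below_cond by blast
  then show "(\<exists>\<pi> s. vpair \<pi> s \<in> elts (pn A \<Theta>) \<and> r \<preceq> s \<and> feq r \<pi> \<tau>) \<longleftrightarrow> (\<exists>x\<in>A. \<Theta> x r \<and> feq r \<tau> x)"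
    using assms(2) by (simp add: elts_pn[OF assms(1)] feq_commute[of _ \<tau>]) (metis below_refl)
qed

end

section \<open>Equality of \<open>Q\<close>-names in the extension: the recursive clause\<close>

context two_forcing
begin

text \<open>Any pair of names forced into \<open>st b\<close> is densely equal to a listed pair of
  some \<open>st d\<close> and a canonical name, so the two quantifiers over \<open>P\<close>-names
  become one over the members of \<open>b\<close>.\<close>

lemma frc_Exists_pair_st:
  assumes b: "PQ.isname b" and p: "p \<in> elts P" and K: "P.resp p K"
  shows "P.frc p (Exists (\<lambda>\<pi>. Exists (\<lambda>s. Conj (PairIn \<pi> s (st b))
       (Conj (PairIn (check P x) s cL) (K \<pi>))))) \<longleftrightarrow>
    P.dns p (\<lambda>r. \<exists>d s t. vpair d (vpair s t) \<in> elts b \<and> leq leP r s \<and> leq leQ x t \<and> P.frc r (K (st d)))"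
    (is "?l \<longleftrightarrow> P.dns p ?\<Psi>")
proof
  assume ?l
  then have "P.dns p (\<lambda>r. P.dns r ?\<Psi>)"
    unfolding P.frc_Exists[where p = p]
  proof (elim P.dns_mono exE conjE)
    fix r1 \<pi> assume r1: "leq leP r1 p" "P.isname \<pi>"
      and "P.frc r1 (Exists (\<lambda>s. Conj (PairIn \<pi> s (st b)) (Conj (PairIn (check P x) s cL) (K \<pi>))))"
    from this(3) have "P.dns r1 (\<lambda>r. P.dns r ?\<Psi>)"
      unfolding P.frc_Exists[where p = r1]
    proof (elim P.dns_mono exE conjE)
      fix r2 s assume r2: "leq leP r2 r1" "P.isname s"
        and "P.frc r2 (Conj (PairIn \<pi> s (st b)) (Conj (PairIn (check P x) s cL) (K \<pi>)))"
      moreover have r2P: "r2 \<in> elts P" using r2 P.below_cond by blast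
      ultimately have m: "P.fmem r2 (P.opn \<pi> s) (st b)" "P.fmem r2 (P.opn (check P x) s) cL" "P.frc r2 (K \<pi>)"
        using r1 isname_st[OF b] by (simp_all add: P.frc_Conj P.frc_PairIn)
      show "P.dns r2 ?\<Psi>"
        using m(1) unfolding fmem_pair_st
      proof (elim P.dns_mono exE conjE)
        fix r d u t assume r: "leq leP r r2" "vpair d (vpair u t) \<in> elts b" "leq leP r u"
          "P.feq r \<pi> (st d)" "P.feq r s (check P t)"
        have rP: "r \<in> elts P" "leq leP r p" using r r1 r2 P.below_cond P.below_trans by blast+
        have "P.fmem r (P.opn (check P x) (check P t)) cL"
          using m(2) r(1,5) P.fmem_mono P.opn_cong P.feq_refl P.fmem_cong1 by blast
        then have "leq leQ x t" using rP by (simp add: P.opn_check P.fmem_check_iff leq_def)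
        moreover have "P.frc r (K (st d))"
          using P.respD[OF K rP(2) r1(2) isname_st[OF PQ_isname_pairD(1)[OF b r(2)]] r(4)]
            P.frc_mono[OF m(3) r(1)] by blast
        ultimately show "?\<Psi> r" using r by blast
      qed
    qed
    then show "P.dns r1 ?\<Psi>" by (rule P.dns_dns)
  qed
  then show "P.dns p ?\<Psi>" by (rule P.dns_dns)
next
  assume "P.dns p ?\<Psi>"
  then show ?l
    unfolding P.frc_Exists[where p = p]
  proof (elim P.dns_mono exE conjE)
    fix r d s t assume r: "leq leP r p" "vpair d (vpair s t) \<in> elts b" "leq leP r s" "leq leQ x t"
      "P.frc r (K (st d))"
    have nd: "P.isname (st d)" using isname_st PQ_isname_pairD(1)[OF b r(2)] by blast
    have "P.frc r' (Conj (PairIn (st d) (check P t) (st b)) (Conj (PairIn (check P x) (check P t) cL) (K (st d))))"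
      if r': "leq leP r' r" for r'
    proof -
      have r'P: "r' \<in> elts P" "leq leP r' s" using r r' P.below_cond P.below_trans by blast+
      have "P.fmem r' (P.opn (st d) (check P t)) (st b)" using fmem_st_elt r r'P by blast
      moreover have "P.frc r' (K (st d))" using r r' P.frc_mono by blast
      ultimately show ?thesis
        using r'P r nd isname_st[OF b] by (simp add: P.frc_Conj P.frc_PairIn P.opn_check P.fmem_check_iff leq_def)
    qed
    then have "P.frc r (Exists (\<lambda>s. Conj (PairIn (st d) s (st b)) (Conj (PairIn (check P x) s cL) (K (st d)))))"
      unfolding P.frc_Exists using P.isname_check by (intro P.dns_all) blast
    with nd show "\<exists>\<pi>. P.isname \<pi> \<and> P.frc r (Exists (\<lambda>s. Conj (PairIn \<pi> s (st b)) (Conj (PairIn (check P x) s cL) (K \<pi>))))"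
      by blast
  qed
qed

text \<open>\<open>K\<close> stands for either orientation of the triple predicate and
  \<open>\<kappa>\<close> for its product counterpart. Their agreement is assumed only at listed
  subnames and stronger conditions, which is what an induction hypothesis can give.\<close>

lemma inner_subclause:
  assumes a: "PQ.isname a" and b: "PQ.isname b" and p: "p \<in> elts P" and q: "q \<in> elts Q"
    and En: "P.isname En"
    and Kfm: "\<And>E' r r' \<pi> \<pi>' \<rho> \<rho>'. (r, r') \<in> E' \<Longrightarrow> (\<pi>, \<pi>') \<in> E' \<Longrightarrow> (\<rho>, \<rho>') \<in> E' \<Longrightarrow> (En, En) \<in> E' \<Longrightarrow>
      fmrel E' (K r \<pi> \<rho>) (K r' \<pi>' \<rho>')"
    and H: "\<And>p' x c s t d s' t'. leq leP p' p \<Longrightarrow> leq leQ x q \<Longrightarrow> vpair c (vpair s t) \<in> elts a \<Longrightarrow>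
      vpair d (vpair s' t') \<in> elts b \<Longrightarrow> leq leP p' s \<Longrightarrow> leq leP p' s' \<Longrightarrow>
      P.frc p' (K (check P x) (st c) (st d)) \<longleftrightarrow> \<kappa> (vpair p' x) c d"
  shows "P.frc p (ForcesSubClause cQ cL K (check P q) (st a) (st b)) \<longleftrightarrow>
    (\<forall>c u. vpair c u \<in> elts a \<longrightarrow> PQ.dns (vpair p q) (\<lambda>w. leq lePQ w u \<longrightarrow>
       (\<exists>d u'. vpair d u' \<in> elts b \<and> leq lePQ w u' \<and> \<kappa> w c d)))"
    (is "?l \<longleftrightarrow> ?r")
proof -
  define Bd where "Bd = (\<lambda>\<pi> x. Exists (\<lambda>\<pi>'. Exists (\<lambda>s'. Conj (PairIn \<pi>' s' (st b))
       (Conj (PairIn x s' cL) (K x \<pi> \<pi>')))))"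
  define F where "F = (\<lambda>\<pi> s x. Imp (PairIn x s cL) (Bd \<pi> x))"
  note na = isname_st[OF a] and nb = isname_st[OF b]
  have nsub: "P.isname (st c)" if "vpair c u \<in> elts a" for c u
    using that isname_st PQ.isname_pairD[OF a] by blast
  have l: "?l \<longleftrightarrow> P.frc p (Forall (\<lambda>\<pi>. Forall (\<lambda>s. Imp (PairIn \<pi> s (st a)) (DenseBelow cQ cL (check P q) (F \<pi> s)))))"
    by (simp add: ForcesSubClause_def F_def Bd_def)
  have respF: "P.resp p' (F \<pi> s)" if "P.isname \<pi>" "P.isname s" for p' \<pi> s
    unfolding F_def Bd_def
    by (rule P.respI_fmrel, intro fmrel_intros fmrel_PairIn Kfm) (use that nb En in auto)
  have body: "P.frc p' (Bd (st c) (check P x)) \<longleftrightarrow>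
      P.dns p' (\<lambda>r. \<exists>d s' t'. vpair d (vpair s' t') \<in> elts b \<and> leq leP r s' \<and> leq leQ x t' \<and> \<kappa> (vpair r x) c d)"
    if c: "vpair c (vpair s t) \<in> elts a" "leq leP p' p" "leq leP p' s" "leq leQ x q" for p' c s t x
  proof -
    have "P.resp p' (K (check P x) (st c))"
      by (rule P.respI_fmrel, intro Kfm) (use nsub[OF c(1)] En in auto)
    from frc_Exists_pair_st[OF b P.below_cond(1)[OF c(2)] this]
    have "P.frc p' (Bd (st c) (check P x)) \<longleftrightarrow> P.dns p' (\<lambda>r. \<exists>d s' t'. vpair d (vpair s' t') \<in> elts b \<and>
        leq leP r s' \<and> leq leQ x t' \<and> P.frc r (K (check P x) (st c) (st d)))"
      unfolding Bd_def .
    also have "\<dots> \<longleftrightarrow> P.dns p' (\<lambda>r. \<exists>d s' t'. vpair d (vpair s' t') \<in> elts b \<and> leq leP r s' \<and> leq leQ x t' \<and> \<kappa> (vpair r x) c d)"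
    proof (rule P.dns_cong)
      fix r assume r: "leq leP r p'"
      then have "leq leP r p" "leq leP r s" using c P.below_trans by blast+
      then have "P.frc r (K (check P x) (st c) (st d)) \<longleftrightarrow> \<kappa> (vpair r x) c d"
        if "vpair d (vpair s' t') \<in> elts b" "leq leP r s'" for d s' t'
        using H[OF _ c(4,1) that(1) _ that(2)] by blast
      then show "(\<exists>d s' t'. vpair d (vpair s' t') \<in> elts b \<and>
        leq leP r s' \<and> leq leQ x t' \<and> P.frc r (K (check P x) (st c) (st d))) \<longleftrightarrow>
        (\<exists>d s' t'. vpair d (vpair s' t') \<in> elts b \<and> leq leP r s' \<and> leq leQ x t' \<and> \<kappa> (vpair r x) c d)"
        by blast
    qed
    finally show ?thesis .
  qed
  show ?thesis
    unfolding l
  proof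
    assume L: "P.frc p (Forall (\<lambda>\<pi>. Forall (\<lambda>s. Imp (PairIn \<pi> s (st a)) (DenseBelow cQ cL (check P q) (F \<pi> s)))))"
    show ?r
    proof (intro allI impI)
      fix c u assume cu: "vpair c u \<in> elts a"
      obtain s t where u: "u = vpair s t" using PQ_isnameD[OF a cu] by auto
      show "PQ.dns (vpair p q) (\<lambda>w. leq lePQ w u \<longrightarrow> (\<exists>d u'. vpair d u' \<in> elts b \<and> leq lePQ w u' \<and> \<kappa> w c d))"
        unfolding PQ.dns_imp_iff
      proof (intro allI impI)
        fix w assume w: "leq lePQ w (vpair p q)" "leq lePQ w u"
        obtain p' q' where w': "w = vpair p' q'" "leq leP p' p" "leq leQ q' q" using w(1) by (rule leq_PQ_cases)
        have st: "leq leP p' s" "leq leQ q' t" using w(2) w' u by auto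
        have p'P: "p' \<in> elts P" "leq leP p' p'" using w' P.below_cond P.below_refl by blast+
        have "P.frc p' (PairIn (st c) (check P t) (st a))"
          using fmem_st_elt cu u st p'P na nsub by (simp add: P.frc_PairIn)
        then have "P.frc p' (DenseBelow cQ cL (check P q) (F (st c) (check P t)))"
          using L w'(2) nsub[OF cu] p unfolding P.frc_Forall by (simp add: P.frc_Imp)
        then have D: "PQ.dns (vpair p' q) (\<lambda>c'. \<exists>r x. c' = vpair r x \<and> P.frc r (F (st c) (check P t) (check P x)))"
          using frc_DenseBelow_cQ[OF p'P(1) respF] nsub[OF cu] by simp
        show "PQ.dns w (\<lambda>w. \<exists>d u'. vpair d u' \<in> elts b \<and> leq lePQ w u' \<and> \<kappa> w c d)"
          unfolding w' PQ_dns
        proof (intro allI impI)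
          fix p1 q1 assume p1: "leq leP p1 p'" "leq leQ q1 q'"
          then have "leq leQ q1 q" using w' Q.below_trans by blast
          then obtain p2 q2 where p2: "leq leP p2 p1" "leq leQ q2 q1" "P.frc p2 (F (st c) (check P t) (check P q2))"
            using D[unfolded PQ_dns] p1 by (metis vpair_inject)
          have p2': "p2 \<in> elts P" "leq leP p2 p2" "leq leP p2 p" "leq leP p2 s" "leq leQ q2 q" "leq leQ q2 t"
            using p2 p1 w' st P.below_cond P.below_refl P.below_trans Q.below_trans by meson+
          have "P.frc p2 (PairIn (check P q2) (check P t) cL)"
            using p2' by (simp add: P.frc_PairIn_check leq_def)
          then have "P.frc p2 (Bd (st c) (check P q2))"
            using p2(3) p2' unfolding F_def P.frc_Imp[OF p2'(1)] by blast
          then obtain p3 d s' t' where p3: "leq leP p3 p2" "vpair d (vpair s' t') \<in> elts b" "leq leP p3 s'"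
            "leq leQ q2 t'" "\<kappa> (vpair p3 q2) c d"
            unfolding body[OF cu[unfolded u] p2'(3,4,5)] using P.dns_ex p2'(1) by blast
          have "leq lePQ (vpair p3 q2) (vpair s' t')" using p3 by simp
          moreover have "leq leP p3 p1" using p3 p2 P.below_trans by blast
          ultimately show "\<exists>p'' q''. leq leP p'' p1 \<and> leq leQ q'' q1 \<and> (\<exists>d u'. vpair d u' \<in> elts b \<and>
              leq lePQ (vpair p'' q'') u' \<and> \<kappa> (vpair p'' q'') c d)"
            using p3 p2 by blast
        qed
      qed
    qed
  next
    assume R: ?r
    have main: "P.frc p1 (DenseBelow cQ cL (check P q) (F \<pi> s))"
      if ps: "P.isname \<pi>" "P.isname s" "leq leP p1 p" "P.frc p1 (PairIn \<pi> s (st a))" for \<pi> s p1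
    proof (rule P.frc_dns)
      show p1P: "p1 \<in> elts P" using ps P.below_cond by blast
      have "P.fmem p1 (P.opn \<pi> s) (st a)" using ps p1P na by (simp add: P.frc_PairIn)
      then show "P.dns p1 (\<lambda>r. P.frc r (DenseBelow cQ cL (check P q) (F \<pi> s)))"
        unfolding fmem_pair_st
      proof (elim P.dns_mono exE conjE)
        fix p2 c u t assume p2: "leq leP p2 p1" "vpair c (vpair u t) \<in> elts a" "leq leP p2 u"
          "P.feq p2 \<pi> (st c)" "P.feq p2 s (check P t)"
        have p2P: "p2 \<in> elts P" "leq leP p2 p" using p2 ps P.below_cond P.below_trans by blast+
        have nc: "P.isname (st c)" using nsub p2 by blast
        have "P.frc p2 (DenseBelow cQ cL (check P q) (F (st c) (check P t)))"
          unfolding frc_DenseBelow_cQ[OF p2P(1) respF[OF nc P.isname_check]] PQ_dns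
        proof (intro allI impI)
          fix p3 x assume p3: "leq leP p3 p2" "leq leQ x q"
          have p3P: "p3 \<in> elts P" "leq leP p3 p3" "leq leP p3 p" "leq leP p3 u"
            using p3 p2 p2P P.below_cond P.below_refl P.below_trans by meson+
          show "\<exists>p'' q''. leq leP p'' p3 \<and> leq leQ q'' x \<and>
            (\<exists>r y. vpair p'' q'' = vpair r y \<and> P.frc r (F (st c) (check P t) (check P y)))"
          \<comment> \<open>If \<open>x\<close> and \<open>t\<close> have a common extension, it
            replaces \<open>x\<close> and the product clause applies. If not, \<open>x\<close> is
            not below \<open>t\<close>, and the implication in \<open>F\<close> is vacuous at
            \<open>x\<close> itself.\<close>
          proof (cases "\<exists>y. leq leQ y x \<and> leq leQ y t")
            case True
            then obtain y where y: "leq leQ y x" "leq leQ y t" by blast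
            have "leq leQ y q" using y p3 Q.below_trans by blast
            then have "leq lePQ (vpair p3 y) (vpair p q)" "leq lePQ (vpair p3 y) (vpair u t)"
              using p3P y by auto
            then have "PQ.dns (vpair p3 y) (\<lambda>w. \<exists>d u'. vpair d u' \<in> elts b \<and> leq lePQ w u' \<and> \<kappa> w c d)"
              using R[rule_format, OF p2(2), unfolded PQ.dns_imp_iff] by blast
            then obtain p4 y4 d u' where p4: "leq leP p4 p3" "leq leQ y4 y" "vpair d u' \<in> elts b"
              "leq lePQ (vpair p4 y4) u'" "\<kappa> (vpair p4 y4) c d"
              unfolding PQ_dns using p3P(2) y(1) Q.below_refl Q.below_cond(1) by metis
            obtain s' t' where u': "u' = vpair s' t'" using PQ_isnameD[OF b p4(3)] by auto
            have y4: "leq leQ y4 q" "leq leQ y4 x" using p4 y p3 Q.below_trans by blast+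
            have p4P: "p4 \<in> elts P" "leq leP p4 p" "leq leP p4 u" using p4 p3P P.below_cond P.below_trans by blast+
            have nd: "vpair d (vpair s' t') \<in> elts b" "leq leP p4 s'" "leq leQ y4 t'" using p4 u' by auto
            have "P.frc p4 (K (check P y4) (st c) (st d))"
              using H[OF p4P(2) y4(1) p2(2) nd(1) p4P(3) nd(2)] p4 by blast
            \<comment> \<open>\<open>\<kappa>\<close> is not assumed to persist to stronger
              conditions; it is carried down by translating to \<open>K\<close> through
              \<open>H\<close>, using monotonicity of forcing, and translating back.\<close>
            then have "P.frc p4 (Bd (st c) (check P y4))"
              unfolding body[OF p2(2) p4P(2,3) y4(1)]
              using H[OF _ y4(1) p2(2) nd(1)] nd p4P P.frc_mono P.below_trans
              by (intro P.dns_all) meson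
            then have "P.frc p4 (F (st c) (check P t) (check P y4))"
              unfolding F_def P.frc_Imp[OF p4P(1)] using P.frc_mono by blast
            then show ?thesis using p4(1) y4(2) by blast
          next
            case False
            have "\<not> leq leQ x t" using False p3 Q.below_refl Q.below_cond by blast
            then have "P.frc p3 (F (st c) (check P t) (check P x))"
              unfolding F_def P.frc_Imp[OF p3P(1)] using P.below_cond by (simp add: P.frc_PairIn_check leq_def)
            then show ?thesis using p3P p3 Q.below_refl Q.below_cond by blast
          qed
        qed
        moreover have "P.frc p2 (DenseBelow cQ cL (check P q) (F \<pi> s)) \<longleftrightarrow>
            P.frc p2 (DenseBelow cQ cL (check P q) (F (st c) (check P t)))"
          unfolding F_def Bd_def
          by (rule P.frc_cong[where E = "insert (\<pi>, st c) (insert (s, check P t) P.Idn)"],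
              intro fmrel_DenseBelow fmrel_intros fmrel_PairIn Kfm)
            (use ps nc nb En p2 p2P in \<open>auto simp: P.eqn_def\<close>)
        ultimately show "P.frc p2 (DenseBelow cQ cL (check P q) (F \<pi> s))" by blast
      qed
    qed
    show "P.frc p (Forall (\<lambda>\<pi>. Forall (\<lambda>s. Imp (PairIn \<pi> s (st a)) (DenseBelow cQ cL (check P q) (F \<pi> s)))))"
      unfolding P.frc_Forall P.frc_Imp[OF p] using main by blast
  qed
qed

text \<open>The second half of the clause reverses the last two entries of the triple, hence a
  second instance of \<open>inner_subclause\<close> with \<open>a\<close> and \<open>b\<close>
  exchanged.\<close>

lemma inner_clause:
  assumes a: "PQ.isname a" and b: "PQ.isname b" and p: "p \<in> elts P" and q: "q \<in> elts Q"
    and En: "P.isname En"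
    and H: "\<And>p' x c s t d s' t'. leq leP p' p \<Longrightarrow> leq leQ x q \<Longrightarrow> vpair c (vpair s t) \<in> elts a \<Longrightarrow>
      vpair d (vpair s' t') \<in> elts b \<Longrightarrow> leq leP p' s \<Longrightarrow> leq leP p' s' \<Longrightarrow>
      P.fmem p' (P.opn (check P x) (P.opn (st c) (st d))) En \<longleftrightarrow> PQ.feq (vpair p' x) c d"
  shows "P.frc p (ForcesEqClause cQ cL En (check P q) (st a) (st b)) \<longleftrightarrow> PQ.feq (vpair p q) a b"
proof -
  have T: "P.frc p' (TripleIn (check P x) (st c) (st d) En) \<longleftrightarrow> PQ.feq (vpair p' x) c d"
    if *: "leq leP p' p" "leq leQ x q" "vpair c (vpair s t) \<in> elts a"
      "vpair d (vpair s' t') \<in> elts b" "leq leP p' s" "leq leP p' s'" for p' x c s t d s' t'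
  proof -
    have "P.isname (st c)" "P.isname (st d)" using * a b PQ.isname_pairD isname_st by blast+
    then show ?thesis using H[OF *] En P.below_cond(1)[OF *(1)] by (simp add: P.frc_TripleIn)
  qed
  have 1: "P.frc p (ForcesSubClause cQ cL (\<lambda>r \<pi> \<pi>'. TripleIn r \<pi> \<pi>' En) (check P q) (st a) (st b)) \<longleftrightarrow>
    (\<forall>c u. vpair c u \<in> elts a \<longrightarrow> PQ.dns (vpair p q) (\<lambda>w. leq lePQ w u \<longrightarrow>
       (\<exists>d u'. vpair d u' \<in> elts b \<and> leq lePQ w u' \<and> PQ.feq w c d)))"
    by (rule inner_subclause[OF a b p q En], rule fmrel_TripleIn, assumption+, rule T, assumption+)
  have 2: "P.frc p (ForcesSubClause cQ cL (\<lambda>r \<pi>' \<pi>. TripleIn r \<pi> \<pi>' En) (check P q) (st b) (st a)) \<longleftrightarrow>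
    (\<forall>c u. vpair c u \<in> elts b \<longrightarrow> PQ.dns (vpair p q) (\<lambda>w. leq lePQ w u \<longrightarrow>
       (\<exists>d u'. vpair d u' \<in> elts a \<and> leq lePQ w u' \<and> PQ.feq w d c)))"
    by (rule inner_subclause[OF b a p q En], rule fmrel_TripleIn, assumption+, rule T, assumption+)
  show ?thesis
    unfolding ForcesEqClause_def P.frc_Conj 1 2 PQ.feq_unfold[of "vpair p q" a b] ..
qed

end

section \<open>Equality of \<open>Q\<close>-names in the extension: uniqueness and existence of the
  recursion\<close>

context two_forcing
begin

text \<open>Closure puts some first coordinate of the listed pair into \<open>D\<close>, and
  injectivity of pairs identifies it with \<open>st e\<close>. This keeps an induction on product
  names inside \<open>D\<close>.\<close>

lemma NameClosed_st_elt:
  assumes nc: "P.frc p (NameClosed cQ D)" and D: "P.isname D" and c: "PQ.isname c" and p: "p \<in> elts P"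
    and cD: "P.fmem p (st c) D" and e: "vpair e (vpair s t) \<in> elts c" and ps: "leq leP p s"
  shows "P.fmem p (st e) D"
proof -
  let ?z = "P.opn (st e) (check P t)"
  have pp: "leq leP p p" using p by simp
  have n: "P.isname (st c)" "P.isname (st e)" "P.isname ?z"
    using c e PQ_isname_pairD isname_st by auto
  have z: "P.fmem p ?z (st c)" using fmem_st_elt[OF e ps] .
  from P.frc_BForallD[OF nc[unfolded NameClosed_def] D n(1) pp cD]
  have "P.frc p (BForall (st c) (\<lambda>z. BExists D (\<lambda>\<sigma>. BExists cQ (\<lambda>p. IsPair \<sigma> p z))))" .
  from P.frc_BForallD[OF this n(1,3) pp z]
  have "P.frc p (BExists D (\<lambda>\<sigma>. BExists cQ (\<lambda>p. IsPair \<sigma> p ?z)))" .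
  then have "P.dns p (\<lambda>r. P.fmem r (st e) D)"
    unfolding P.frc_BExists[OF D]
  proof (elim P.dns_mono exE conjE)
    fix r \<sigma> assume r: "leq leP r p" "P.isname \<sigma>" "P.fmem r \<sigma> D" "P.frc r (BExists cQ (\<lambda>p. IsPair \<sigma> p ?z))"
    from r(4) have "P.dns r (\<lambda>r. P.fmem r (st e) D)"
      unfolding P.frc_BExists[OF P.isname_check]
    proof (elim P.dns_mono exE conjE)
      fix r' \<rho> assume r': "leq leP r' r" "P.isname \<rho>" "P.frc r' (IsPair \<sigma> \<rho> ?z)"
      then have "P.feq r' ?z (P.opn \<sigma> \<rho>)" using r n P.below_cond by (simp add: P.frc_IsPair)
      then have "P.feq r' (st e) \<sigma>" by (rule P.opn_inj)
      then show "P.fmem r' (st e) D" using r r' P.fmem_mono P.fmem_cong1 P.feq_sym by blast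
    qed
    then show "P.fmem r (st e) D" by (rule P.fmem_dns)
  qed
  then show ?thesis by (rule P.fmem_dns)
qed

text \<open>The condition on filters is constantly true, so every generic filter evaluates this to
  the set of all translations of members of \<open>A\<close>.\<close>

definition Dn :: "'v set \<Rightarrow> 'v" where
  "Dn A = P.pn (st ` A) (\<lambda>_ _. True)"

definition closed_names :: "'v set \<Rightarrow> bool" where
  "closed_names A \<longleftrightarrow> small A \<and> (\<forall>c\<in>A. PQ.isname c \<and> (\<forall>e u. vpair e u \<in> elts c \<longrightarrow> e \<in> A))"

lemma closed_names_subnames: "closed_names (PQ.subnames a \<union> PQ.subnames b)"
  unfolding closed_names_def
  using PQ.subnames_step PQ.subnames_isname PQ.small_subnames by blast

lemma isname_Dn: "closed_names A \<Longrightarrow> P.isname (Dn A)"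
  unfolding Dn_def closed_names_def by (intro P.isname_pn) (auto simp: isname_st)

lemma fmem_Dn: "closed_names A \<Longrightarrow> P.fmem p \<tau> (Dn A) \<longleftrightarrow> P.dns p (\<lambda>r. \<exists>c\<in>A. P.feq r \<tau> (st c))"
  unfolding Dn_def closed_names_def by (subst P.fmem_pn) auto

lemma fmem_DnI: "closed_names A \<Longrightarrow> c \<in> A \<Longrightarrow> P.fmem p (st c) (Dn A)"
  unfolding fmem_Dn by (rule P.dns_all) (metis P.feq_refl)

lemma frc_NameClosed_Dn:
  assumes A: "closed_names A" and p: "p \<in> elts P"
  shows "P.frc p (NameClosed cQ (Dn A))"
proof -
  have main: "P.frc p2 (BExists (Dn A) (\<lambda>\<sigma>. BExists cQ (\<lambda>p. IsPair \<sigma> p z)))"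
    if xz: "P.isname x" "leq leP p1 p" "P.fmem p1 x (Dn A)" "P.isname z" "leq leP p2 p1" "P.fmem p2 z x"
    for x z p1 p2
    unfolding P.frc_BExists[OF isname_Dn[OF A]]
  proof (rule P.dnsI)
    fix p3 assume p3: "leq leP p3 p2"
    then have "leq leP p3 p1" using xz P.below_trans by blast
    then obtain p4 c where p4: "leq leP p4 p3" "c \<in> A" "P.feq p4 x (st c)"
      using P.dnsD[OF xz(3)[unfolded fmem_Dn[OF A]]] by blast
    then have "P.fmem p4 z (st c)" using xz p3 P.fmem_mono P.fmem_cong2 by blast
    moreover have "p4 \<in> elts P" using p4 P.below_cond by blast
    ultimately obtain p5 e s t where p5: "leq leP p5 p4" "vpair e (vpair s t) \<in> elts c"
      "P.feq p5 z (P.opn (st e) (check P t))"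
      unfolding fmem_st using P.dns_ex by blast
    have e: "e \<in> A" "PQ.isname e" "t \<in> elts Q"
      using A p4(2) p5(2) PQ_isname_pairD unfolding closed_names_def by blast+
    have "P.frc p5 (BExists cQ (\<lambda>p. IsPair (st e) p z))"
      unfolding P.frc_BExists[OF P.isname_check]
    proof (rule P.dns_all)
      fix r assume r: "leq leP r p5"
      then have "P.frc r (IsPair (st e) (check P t) z)"
        using e xz p5 P.below_cond P.feq_mono isname_st by (simp add: P.frc_IsPair)
      then show "\<exists>\<tau>. P.isname \<tau> \<and> P.fmem r \<tau> cQ \<and> P.frc r (IsPair (st e) \<tau> z)"
        using e P.fmem_checkI P.isname_check by blast
    qed
    moreover have "P.fmem p5 (st e) (Dn A)" using fmem_DnI[OF A e(1)] .
    moreover have "leq leP p5 p3" using p5 p4 P.below_trans by blast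
    ultimately show "\<exists>r. leq leP r p3 \<and> (\<exists>\<tau>. P.isname \<tau> \<and> P.fmem r \<tau> (Dn A) \<and>
        P.frc r (BExists cQ (\<lambda>p. IsPair \<tau> p z)))"
      using isname_st e by blast
  qed
  show ?thesis
    unfolding NameClosed_def P.frc_BForall[OF p isname_Dn[OF A]]
  proof (intro allI impI)
    fix x p1 assume x: "P.isname x" "leq leP p1 p" "P.fmem p1 x (Dn A)"
    show "P.frc p1 (BForall x (\<lambda>z. BExists (Dn A) (\<lambda>\<sigma>. BExists cQ (\<lambda>p. IsPair \<sigma> p z))))"
      unfolding P.frc_BForall[OF P.below_cond(1)[OF x(2)] x(1)] using main[OF x] by blast
  qed
qed

lemma frc_IsName_st:
  assumes "PQ.isname a" "p \<in> elts P"
  shows "P.frc p (IsName cQ (st a))"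
proof -
  let ?A = "PQ.subnames a \<union> PQ.subnames a"
  have A: "closed_names ?A" by (rule closed_names_subnames)
  have "P.frc r (Conj (NameClosed cQ (Dn ?A)) (Mem (st a) (Dn ?A)))" if "leq leP r p" for r
  proof -
    have "P.fmem r (st a) (Dn ?A)" using fmem_DnI[OF A] PQ.subnames_self assms by blast
    then show ?thesis
      using frc_NameClosed_Dn[OF A] P.below_cond(1)[OF that] isname_st[OF assms(1)] isname_Dn[OF A]
      by (simp add: P.frc_Conj P.frc_Mem)
  qed
  then show ?thesis
    unfolding IsName_def P.frc_Exists using isname_Dn[OF A] by (intro P.dns_all) blast
qed

lemma PQ_feq_dns_left:
  assumes "P.dns p (\<lambda>r. PQ.feq (vpair r q) a b)"
  shows "PQ.feq (vpair p q) a b"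
proof (rule PQ.feq_dns)
  show "PQ.dns (vpair p q) (\<lambda>r. PQ.feq r a b)"
    unfolding PQ_dns
  proof (intro allI impI)
    fix p' q' assume *: "leq leP p' p" "leq leQ q' q"
    obtain r where r: "leq leP r p'" "PQ.feq (vpair r q) a b" using P.dnsD[OF assms *(1)] by blast
    have "leq lePQ (vpair r q') (vpair r q)" "leq leQ q' q'" using * r P.below_cond Q.below_cond by auto
    then show "\<exists>p'' q''. leq leP p'' p' \<and> leq leQ q'' q' \<and> PQ.feq (vpair p'' q'') a b"
      using r PQ.feq_mono by blast
  qed
qed

text \<open>Induction on product names: \<open>inner_clause\<close> needs agreement at listed
  subnames, and these stay in \<open>D\<close> by \<open>NameClosed_st_elt\<close>, so the induction
  hypothesis applies to them.\<close>

lemma inner_eq_unique: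
  assumes D: "P.isname D" and En: "P.isname En" and nc: "P.frc r (NameClosed cQ D)"
    and rec: "P.frc r (BForall cQ (\<lambda>q. BForall D (\<lambda>x. BForall D (\<lambda>y.
             Iff (TripleIn q x y En) (ForcesEqClause cQ cL En q x y)))))"
  shows "PQ.isname c \<Longrightarrow> PQ.isname d \<Longrightarrow> leq leP p r \<Longrightarrow> q \<in> elts Q \<Longrightarrow> P.fmem p (st c) D \<Longrightarrow>
    P.fmem p (st d) D \<Longrightarrow> P.fmem p (P.opn (check P q) (P.opn (st c) (st d))) En \<longleftrightarrow> PQ.feq (vpair p q) c d"
proof (induction c arbitrary: p q d rule: trcl_induct)
  case (1 c)
  note c = 1(2) and d = 1(3) and p = 1(4) and q = 1(5) and cD = 1(6) and dD = 1(7)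
  have pP: "p \<in> elts P" "leq leP p p" using p P.below_cond P.below_refl by blast+
  note n = isname_st[OF c] isname_st[OF d]
  have "P.fmem p (check P q) cQ" using q by (rule P.fmem_checkI)
  from P.frc_BForallD[OF rec P.isname_check P.isname_check p this]
  have "P.frc p (BForall D (\<lambda>x. BForall D (\<lambda>y.
             Iff (TripleIn (check P q) x y En) (ForcesEqClause cQ cL En (check P q) x y))))" .
  from P.frc_BForallD[OF this D n(1) pP(2) cD]
  have "P.frc p (BForall D (\<lambda>y.
             Iff (TripleIn (check P q) (st c) y En) (ForcesEqClause cQ cL En (check P q) (st c) y)))" .
  from P.frc_BForallD[OF this D n(2) pP(2) dD]
  have "P.frc p (Iff (TripleIn (check P q) (st c) (st d) En) (ForcesEqClause cQ cL En (check P q) (st c) (st d)))" .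
  then have "P.frc p (TripleIn (check P q) (st c) (st d) En) \<longleftrightarrow>
      P.frc p (ForcesEqClause cQ cL En (check P q) (st c) (st d))"
    unfolding P.frc_Iff[OF pP(1)] using pP(2) by blast
  also have "\<dots> \<longleftrightarrow> PQ.feq (vpair p q) c d"
  proof (rule inner_clause[OF c d pP(1) q En])
    fix p' x e s t f s' t'
    assume *: "leq leP p' p" "leq leQ x q" "vpair e (vpair s t) \<in> elts c"
      "vpair f (vpair s' t') \<in> elts d" "leq leP p' s" "leq leP p' s'"
    have p': "p' \<in> elts P" "leq leP p' r" using * p P.below_cond P.below_trans by blast+
    have nc': "P.frc p' (NameClosed cQ D)" using nc p' P.frc_mono by blast
    have "P.fmem p' (st e) D"
      using NameClosed_st_elt[OF nc' D c p'(1) _ *(3,5)] P.fmem_mono[OF cD *(1)] by blast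
    moreover have "P.fmem p' (st f) D"
      using NameClosed_st_elt[OF nc' D d p'(1) _ *(4,6)] P.fmem_mono[OF dD *(1)] by blast
    moreover have "PQ.isname e" "PQ.isname f" using c d * PQ.isname_pairD by blast+
    moreover have "x \<in> elts Q" using * Q.below_cond by blast
    ultimately show "P.fmem p' (P.opn (check P x) (P.opn (st e) (st f))) En \<longleftrightarrow> PQ.feq (vpair p' x) e f"
      using 1(1)[OF vpair_mem_trcl(1)[OF *(3)]] p'(2) by blast
  qed
  finally show ?case using n En pP(1) by (simp add: P.frc_TripleIn)
qed

text \<open>A triple of names is put under every condition \<open>p\<close> for which the product
  forces the equality. The difficulty is that the same triple of the extension may be listed through
  other product names.\<close>

lemma inner_eq_exists:
  assumes A: "closed_names A"
  shows "\<exists>En. P.isname En \<and> (\<forall>p q c d. p \<in> elts P \<longrightarrow> q \<in> elts Q \<longrightarrow> c \<in> A \<longrightarrow> d \<in> A \<longrightarrow>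
      (P.fmem p (P.opn (check P q) (P.opn (st c) (st d))) En \<longleftrightarrow> PQ.feq (vpair p q) c d))"
proof -
  define T where "T = (\<Union>q\<in>elts Q. {P.opn (check P q) (P.opn (st c) (st d)) |c d. c \<in> A \<and> d \<in> A})"
  define \<Theta> where "\<Theta> = (\<lambda>y p. \<exists>q c d. q \<in> elts Q \<and> c \<in> A \<and> d \<in> A \<and>
     y = P.opn (check P q) (P.opn (st c) (st d)) \<and> PQ.feq (vpair p q) c d)"
  have sT: "small T" unfolding T_def
    using A unfolding closed_names_def by (intro small_UN small_image2) auto
  have nT: "P.isname y" if "y \<in> T" for y
    using that A isname_st by (auto simp: T_def closed_names_def)
  have mono: "\<Theta> y p'" if y: "\<Theta> y p" "leq leP p' p" for y p p'
  proof -
    obtain q c d where *: "q \<in> elts Q" "c \<in> A" "d \<in> A" "y = P.opn (check P q) (P.opn (st c) (st d))"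
      "PQ.feq (vpair p q) c d"
      using y(1) unfolding \<Theta>_def by blast
    then have "PQ.feq (vpair p' q) c d"
      using PQ.feq_mono[OF *(5), of "vpair p' q"] y(2) by simp
    with * show ?thesis unfolding \<Theta>_def by blast
  qed
  have fm: "P.fmem p \<tau> (P.pn T \<Theta>) \<longleftrightarrow> P.dns p (\<lambda>r. \<exists>x\<in>T. \<Theta> x r \<and> P.feq r \<tau> x)" for p \<tau>
    by (rule P.fmem_pn[OF sT]) (rule mono)
  have "P.fmem p (P.opn (check P q) (P.opn (st c) (st d))) (P.pn T \<Theta>) \<longleftrightarrow> PQ.feq (vpair p q) c d"
    if *: "p \<in> elts P" "q \<in> elts Q" "c \<in> A" "d \<in> A" for p q c d
  proof
    assume "P.fmem p (P.opn (check P q) (P.opn (st c) (st d))) (P.pn T \<Theta>)"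
    then have "P.dns p (\<lambda>r. PQ.feq (vpair r q) c d)"
      unfolding fm
    proof (elim P.dns_mono bexE conjE)
      fix r y assume r: "leq leP r p" "\<Theta> y r" "P.feq r (P.opn (check P q) (P.opn (st c) (st d))) y"
      obtain q' c' d' where y: "c' \<in> A" "d' \<in> A" "y = P.opn (check P q') (P.opn (st c') (st d'))"
        "PQ.feq (vpair r q') c' d'" using r(2) unfolding \<Theta>_def by blast
      from r(3) have "P.feq r (check P q) (check P q')" "P.feq r (P.opn (st c) (st d)) (P.opn (st c') (st d'))"
        unfolding y(3) by (auto dest: P.opn_inj)
      then have eq: "q = q'" "P.feq r (st c) (st c')" "P.feq r (st d) (st d')"
        using P.feq_check_iff P.below_cond(1)[OF r(1)] P.opn_inj by blast+
      \<comment> \<open>Representatives of the same triple have translations forced equal, so by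
        \<open>feq_of_feq_st\<close> the product forces the same equalities for them.\<close>
      have "PQ.feq (vpair r q) c c'" "PQ.feq (vpair r q) d d'"
        using eq * y A feq_of_feq_st unfolding closed_names_def by blast+
      then show "PQ.feq (vpair r q) c d"
        using y(4) eq(1) PQ.feq_trans PQ.feq_sym by blast
    qed
    then show "PQ.feq (vpair p q) c d" by (rule PQ_feq_dns_left)
  next
    assume f: "PQ.feq (vpair p q) c d"
    have "\<Theta> (P.opn (check P q) (P.opn (st c) (st d))) p" using f * unfolding \<Theta>_def by blast
    moreover have "P.opn (check P q) (P.opn (st c) (st d)) \<in> T" using * by (auto simp: T_def)
    ultimately show "P.fmem p (P.opn (check P q) (P.opn (st c) (st d))) (P.pn T \<Theta>)"
      unfolding fm using mono P.feq_refl by (intro P.dns_all) blast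
  qed
  then show ?thesis using P.isname_pn[OF sT nT] by blast
qed

lemma inner_eq:
  assumes a: "PQ.isname a" and b: "PQ.isname b" and p: "p \<in> elts P" and q: "q \<in> elts Q"
  shows "P.frc p (ForcesEq cQ cL (check P q) (st a) (st b)) \<longleftrightarrow> PQ.feq (vpair p q) a b"
proof -
  note n = isname_st[OF a] isname_st[OF b]
  define W where "W = (\<lambda>D En. Conj (NameClosed cQ D) (Conj (Mem (st a) D) (Conj (Mem (st b) D)
    (Conj (BForall cQ (\<lambda>q. BForall D (\<lambda>x. BForall D (\<lambda>y.
             Iff (TripleIn q x y En) (ForcesEqClause cQ cL En q x y)))))
          (TripleIn (check P q) (st a) (st b) En)))))"
  have FE: "ForcesEq cQ cL (check P q) (st a) (st b) = Exists (\<lambda>D. Exists (W D))"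
    by (simp add: ForcesEq_def W_def)
  show ?thesis
  proof
    assume "P.frc p (ForcesEq cQ cL (check P q) (st a) (st b))"
    then have "P.dns p (\<lambda>r. PQ.feq (vpair r q) a b)"
      unfolding FE P.frc_Exists[where p = p]
    proof (elim P.dns_mono exE conjE)
      fix r D assume r: "leq leP r p" "P.isname D"
        and ex: "P.frc r (Exists (\<lambda>E. W D E))"
      from ex have "P.dns r (\<lambda>r. PQ.feq (vpair r q) a b)"
        unfolding P.frc_Exists[where p = r]
      proof (elim P.dns_mono exE conjE)
        fix r' En assume r': "leq leP r' r" "P.isname En"
          and cj: "P.frc r' (W D En)"
        have r'P: "r' \<in> elts P" "leq leP r' r'" using r' P.below_cond P.below_refl by blast+
        show "PQ.feq (vpair r' q) a b"
          using cj inner_eq_unique[OF r(2) r'(2) _ _ a b r'P(2) q] n r r' r'P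
          unfolding W_def P.frc_Conj by (simp add: P.frc_Mem P.frc_TripleIn)
      qed
      then show "PQ.feq (vpair r q) a b" by (rule PQ_feq_dns_left)
    qed
    then show "PQ.feq (vpair p q) a b" by (rule PQ_feq_dns_left)
  next
    assume ab: "PQ.feq (vpair p q) a b"
    define A where "A = PQ.subnames a \<union> PQ.subnames b"
    have A: "closed_names A" unfolding A_def by (rule closed_names_subnames)
    have abA: "a \<in> A" "b \<in> A" using a b PQ.subnames_self by (auto simp: A_def)
    note nD = isname_Dn[OF A]
    obtain En where En: "P.isname En" and EnI: "\<And>p q c d. p \<in> elts P \<Longrightarrow> q \<in> elts Q \<Longrightarrow> c \<in> A \<Longrightarrow> d \<in> A \<Longrightarrow>
        (P.fmem p (P.opn (check P q) (P.opn (st c) (st d))) En \<longleftrightarrow> PQ.feq (vpair p q) c d)"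
      using inner_eq_exists[OF A] by blast
    have Anames: "PQ.isname c" "P.isname (st c)" if "c \<in> A" for c
      using that A isname_st unfolding closed_names_def by blast+
    have iff: "P.frc r (Iff (TripleIn (check P x) (st c) (st d) En) (ForcesEqClause cQ cL En (check P x) (st c) (st d)))"
      if *: "r \<in> elts P" "x \<in> elts Q" "c \<in> A" "d \<in> A" for r x c d
      unfolding P.frc_Iff[OF *(1)]
    proof (intro allI impI)
      fix r' assume r': "leq leP r' r"
      then have r'P: "r' \<in> elts P" using P.below_cond by blast
      have "P.frc r' (ForcesEqClause cQ cL En (check P x) (st c) (st d)) \<longleftrightarrow> PQ.feq (vpair r' x) c d"
      proof (rule inner_clause[OF Anames(1)[OF *(3)] Anames(1)[OF *(4)] r'P *(2) En])
        fix p' y e s t f s' t'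
        assume h: "leq leP p' r'" "leq leQ y x" "vpair e (vpair s t) \<in> elts c"
          "vpair f (vpair s' t') \<in> elts d" "leq leP p' s" "leq leP p' s'"
        have "e \<in> A" "f \<in> A" using h * A unfolding closed_names_def by blast+
        then show "P.fmem p' (P.opn (check P y) (P.opn (st e) (st f))) En \<longleftrightarrow> PQ.feq (vpair p' y) e f"
          using EnI h P.below_cond Q.below_cond by blast
      qed
      then show "P.frc r' (TripleIn (check P x) (st c) (st d) En) \<longleftrightarrow>
          P.frc r' (ForcesEqClause cQ cL En (check P x) (st c) (st d))"
        using EnI[OF r'P *(2,3,4)] Anames * En r'P by (simp add: P.frc_TripleIn)
    qed
    have rec: "P.frc r (BForall cQ (\<lambda>q. BForall (Dn A) (\<lambda>x. BForall (Dn A) (\<lambda>y.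
               Iff (TripleIn q x y En) (ForcesEqClause cQ cL En q x y)))))" if r: "r \<in> elts P" for r
    proof -
      \<comment> \<open>Arbitrary names for a condition and two members of \<open>Dn A\<close> are
        brought by three successive extensions to the form treated in \<open>iff\<close>; uniformity
        of the clause allows the replacement.\<close>
      have leaf: "P.frc r3 (Iff (TripleIn u x y En) (ForcesEqClause cQ cL En u x y))"
        if u: "P.isname u" "P.isname x" "P.isname y" "P.fmem r3 u cQ" "P.fmem r3 x (Dn A)" "P.fmem r3 y (Dn A)"
          "r3 \<in> elts P" for r3 u x y
      proof (rule P.frc_dns[OF u(7)], rule P.dnsI)
        fix r4 assume r4: "leq leP r4 r3"
        obtain r5 x' where r5: "leq leP r5 r4" "x' \<in> elts Q" "P.feq r5 u (check P x')"
          using P.dnsD[OF u(4)[unfolded P.fmem_check] r4] by blast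
        have r53: "leq leP r5 r3" using r5 r4 P.below_trans by blast
        obtain r6 c where r6: "leq leP r6 r5" "c \<in> A" "P.feq r6 x (st c)"
          using P.dnsD[OF u(5)[unfolded fmem_Dn[OF A]] r53] by blast
        have r63: "leq leP r6 r3" using r6 r53 P.below_trans by blast
        obtain r7 d where r7: "leq leP r7 r6" "d \<in> A" "P.feq r7 y (st d)"
          using P.dnsD[OF u(6)[unfolded fmem_Dn[OF A]] r63] by blast
        have r7': "r7 \<in> elts P" "leq leP r7 r5" "leq leP r7 r4" using r7 r6 r5 P.below_cond P.below_trans by blast+
        have "P.eqn r7 u (check P x')" "P.eqn r7 x (st c)" "P.eqn r7 y (st d)"
          using r5 r6 r7 r7' u Anames P.feq_mono by (auto simp: P.eqn_def)
        then have "P.frc r7 (Iff (TripleIn u x y En) (ForcesEqClause cQ cL En u x y)) \<longleftrightarrow>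
            P.frc r7 (Iff (TripleIn (check P x') (st c) (st d) En) (ForcesEqClause cQ cL En (check P x') (st c) (st d)))"
          by (intro P.frc_cong[where E = "insert (u, check P x') (insert (x, st c) (insert (y, st d) P.Idn))"]
              fmrel_intros fmrel_TripleIn fmrel_ForcesEqClause)
            (use En r7' in auto)
        then show "\<exists>r. leq leP r r4 \<and> P.frc r (Iff (TripleIn u x y En) (ForcesEqClause cQ cL En u x y))"
          using iff[OF r7'(1) r5(2) r6(2) r7(2)] r7'(3) by blast
      qed
      show ?thesis
        unfolding P.frc_BForall[OF r P.isname_check]
      proof (intro allI impI)
        fix u r1 assume u: "P.isname u" "leq leP r1 r" "P.fmem r1 u cQ"
        show "P.frc r1 (BForall (Dn A) (\<lambda>x. BForall (Dn A) (\<lambda>y.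
               Iff (TripleIn u x y En) (ForcesEqClause cQ cL En u x y))))"
          unfolding P.frc_BForall[OF P.below_cond(1)[OF u(2)] nD]
        proof (intro allI impI)
          fix x r2 assume x: "P.isname x" "leq leP r2 r1" "P.fmem r2 x (Dn A)"
          show "P.frc r2 (BForall (Dn A) (\<lambda>y. Iff (TripleIn u x y En) (ForcesEqClause cQ cL En u x y)))"
            unfolding P.frc_BForall[OF P.below_cond(1)[OF x(2)] nD]
          proof (intro allI impI)
            fix y r3 assume y: "P.isname y" "leq leP r3 r2" "P.fmem r3 y (Dn A)"
            have "P.fmem r3 u cQ" "P.fmem r3 x (Dn A)" "r3 \<in> elts P"
              using u x y P.fmem_mono P.below_cond by blast+
            then show "P.frc r3 (Iff (TripleIn u x y En) (ForcesEqClause cQ cL En u x y))"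
              using leaf u x y by blast
          qed
        qed
      qed
    qed
    have "P.frc r (W (Dn A) En)" if r: "leq leP r p" for r
    proof -
      have rP: "r \<in> elts P" using r P.below_cond by blast
      have "PQ.feq (vpair r q) a b" using PQ.feq_mono[OF ab, of "vpair r q"] r q by simp
      then show ?thesis
        using frc_NameClosed_Dn[OF A rP] rec[OF rP] fmem_DnI[OF A] abA n nD En rP q EnI
        unfolding W_def P.frc_Conj by (simp add: P.frc_Mem P.frc_TripleIn)
    qed
    note conj = this
    show "P.frc p (ForcesEq cQ cL (check P q) (st a) (st b))"
      unfolding FE P.frc_Exists[where p = p]
    proof (rule P.dns_all)
      fix r assume r: "leq leP r p"
      have "P.frc r (Exists (\<lambda>En. W (Dn A) En))"
        unfolding P.frc_Exists
      proof (rule P.dns_all)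
        fix r' assume "leq leP r' r"
        then have "leq leP r' p" using r P.below_trans by blast
        from conj[OF this] En show "\<exists>En. P.isname En \<and> P.frc r' (W (Dn A) En)" by blast
      qed
      with nD show "\<exists>D. P.isname D \<and> P.frc r (Exists (\<lambda>En. W D En))" by blast
    qed
  qed
qed

end

section \<open>From equality to membership and to arbitrary uniform formulas\<close>

context two_forcing
begin

lemma inner_mem:
  assumes a: "PQ.isname a" and b: "PQ.isname b" and p: "p \<in> elts P" and q: "q \<in> elts Q"
  shows "P.frc p (ForcesMem cQ cL (check P q) (st a) (st b)) \<longleftrightarrow> PQ.fmem (vpair p q) a b"
proof -
  note n = isname_st[OF a] isname_st[OF b]
  define Bd where "Bd = (\<lambda>x. Exists (\<lambda>\<pi>. Exists (\<lambda>s. Conj (PairIn \<pi> s (st b))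
       (Conj (PairIn x s cL) (ForcesEq cQ cL x \<pi> (st a))))))"
  have body: "P.frc r (Bd (check P x)) \<longleftrightarrow> P.dns r (\<lambda>r. \<exists>d u. vpair d u \<in> elts b \<and>
      leq lePQ (vpair r x) u \<and> PQ.feq (vpair r x) d a)" if rx: "r \<in> elts P" "x \<in> elts Q" for r x
  proof -
    have "P.resp r (\<lambda>\<pi>. ForcesEq cQ cL (check P x) \<pi> (st a))"
      by (rule P.respI_fmrel, intro fmrel_ForcesEq) (use n in auto)
    from frc_Exists_pair_st[OF b rx(1) this]
    have "P.frc r (Bd (check P x)) \<longleftrightarrow> P.dns r (\<lambda>r. \<exists>d s t. vpair d (vpair s t) \<in> elts b \<and>
       leq leP r s \<and> leq leQ x t \<and> P.frc r (ForcesEq cQ cL (check P x) (st d) (st a)))"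
      unfolding Bd_def .
    also have "\<dots> \<longleftrightarrow> P.dns r (\<lambda>r. \<exists>d u. vpair d u \<in> elts b \<and>
      leq lePQ (vpair r x) u \<and> PQ.feq (vpair r x) d a)"
    proof (rule P.dns_cong)
      fix r' assume r': "leq leP r' r"
      then have r'P: "r' \<in> elts P" using P.below_cond by blast
      have "P.frc r' (ForcesEq cQ cL (check P x) (st d) (st a)) \<longleftrightarrow> PQ.feq (vpair r' x) d a"
        if "vpair d u \<in> elts b" for d u
        using inner_eq[OF PQ.isname_pairD(1)[OF b that] a r'P rx(2)] .
      moreover have "\<exists>s t. u = vpair s t" if "vpair d u \<in> elts b" for d u
        using PQ_isnameD[OF b that] by auto
      ultimately show "(\<exists>d s t. vpair d (vpair s t) \<in> elts b \<and>
       leq leP r' s \<and> leq leQ x t \<and> P.frc r' (ForcesEq cQ cL (check P x) (st d) (st a))) \<longleftrightarrow>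
       (\<exists>d u. vpair d u \<in> elts b \<and> leq lePQ (vpair r' x) u \<and> PQ.feq (vpair r' x) d a)"
        by (metis leq_PQ)
    qed
    finally show ?thesis .
  qed
  have "P.resp p Bd"
    unfolding Bd_def
    by (rule P.respI_fmrel, intro fmrel_intros fmrel_PairIn fmrel_ForcesEq) (use n in auto)
  from frc_DenseBelow_cQ[OF p this]
  have l: "P.frc p (ForcesMem cQ cL (check P q) (st a) (st b)) \<longleftrightarrow>
    PQ.dns (vpair p q) (\<lambda>c. \<exists>r x. c = vpair r x \<and> P.frc r (Bd (check P x)))"
    unfolding ForcesMem_def Bd_def .
  show ?thesis
    unfolding l
  proof
    assume L: "PQ.dns (vpair p q) (\<lambda>c. \<exists>r x. c = vpair r x \<and> P.frc r (Bd (check P x)))"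
    show "PQ.fmem (vpair p q) a b"
      unfolding PQ.fmem_def PQ_dns
    proof (intro allI impI)
      fix p' q' assume "leq leP p' p" "leq leQ q' q"
      then obtain r x where r: "leq leP r p'" "leq leQ x q'" "P.frc r (Bd (check P x))"
        using L[unfolded PQ_dns] by (metis vpair_inject)
      have rx: "r \<in> elts P" "x \<in> elts Q" using r P.below_cond Q.below_cond by blast+
      obtain r' where r': "leq leP r' r" "\<exists>d u. vpair d u \<in> elts b \<and> leq lePQ (vpair r' x) u \<and> PQ.feq (vpair r' x) d a"
        using P.dns_ex[OF r(3)[unfolded body[OF rx]] rx(1)] by blast
      then show "\<exists>p'' q''. leq leP p'' p' \<and> leq leQ q'' q' \<and>
          (\<exists>\<pi> s. vpair \<pi> s \<in> elts b \<and> leq lePQ (vpair p'' q'') s \<and> PQ.feq (vpair p'' q'') \<pi> a)"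
        using r P.below_trans by blast
    qed
  next
    assume R: "PQ.fmem (vpair p q) a b"
    show "PQ.dns (vpair p q) (\<lambda>c. \<exists>r x. c = vpair r x \<and> P.frc r (Bd (check P x)))"
      unfolding PQ_dns
    proof (intro allI impI)
      fix p' q' assume "leq leP p' p" "leq leQ q' q"
      then obtain r x d u where r: "leq leP r p'" "leq leQ x q'" "vpair d u \<in> elts b"
        "leq lePQ (vpair r x) u" "PQ.feq (vpair r x) d a"
        using R[unfolded PQ.fmem_def PQ_dns] by blast
      have rx: "r \<in> elts P" "x \<in> elts Q" "leq leQ x x" using r P.below_cond Q.below_cond Q.below_refl by blast+
      have "P.frc r (Bd (check P x))"
        unfolding body[OF rx(1,2)]
      proof (rule P.dns_all)
        fix r' assume "leq leP r' r"
        then have "leq lePQ (vpair r' x) (vpair r x)" using rx by simp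
        then show "\<exists>d u. vpair d u \<in> elts b \<and> leq lePQ (vpair r' x) u \<and> PQ.feq (vpair r' x) d a"
          using r PQ.below_trans PQ.feq_mono by blast
      qed
      then show "\<exists>p'' q''. leq leP p'' p' \<and> leq leQ q'' q' \<and>
          (\<exists>r x. vpair p'' q'' = vpair r x \<and> P.frc r (Bd (check P x)))"
        using r by blast
    qed
  qed
qed

text \<open>Here the formula is fixed and the name of the condition varies. The relation to \<phi>
  serves as an induction principle that keeps the parameters of \<open>\<phi>'\<close> names, which
  the atomic cases need for \<open>frc_cong\<close>.\<close>

lemma frc_Forces_cong:
  "fmrel E \<phi> \<phi>' \<Longrightarrow> p \<in> elts P \<Longrightarrow> (\<And>a b. (a, b) \<in> E \<Longrightarrow> P.isname b) \<Longrightarrow> P.eqn p x y \<Longrightarrow>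
    P.frc p (Forces cQ cL \<phi>' x) \<longleftrightarrow> P.frc p (Forces cQ cL \<phi>' y)"
proof (induction arbitrary: p rule: fmrel.induct)
  case (fmrel_Mem a a' E b b')
  have "fmrel (insert (x, y) P.Idn) (ForcesMem cQ cL x a' b') (ForcesMem cQ cL y a' b')"
    by (rule fmrel_ForcesMem) (use fmrel_Mem in auto)
  then have "P.frc p (ForcesMem cQ cL x a' b') \<longleftrightarrow> P.frc p (ForcesMem cQ cL y a' b')"
    by (rule P.frc_cong) (use fmrel_Mem in auto)
  then show ?case by (simp add: Forces.simps)
next
  case (fmrel_Eq a a' E b b')
  have "fmrel (insert (x, y) P.Idn) (ForcesEq cQ cL x a' b') (ForcesEq cQ cL y a' b')"
    by (rule fmrel_ForcesEq) (use fmrel_Eq in auto)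
  then have "P.frc p (ForcesEq cQ cL x a' b') \<longleftrightarrow> P.frc p (ForcesEq cQ cL y a' b')"
    by (rule P.frc_cong) (use fmrel_Eq in auto)
  then show ?case by (simp add: Forces.simps)
next
  case (fmrel_Neg E \<phi> \<phi>')
  then show ?case using P.frc_BelowForall_cong by (simp add: Forces.simps)
next
  case (fmrel_Conj E \<phi> \<phi>' \<psi> \<psi>')
  then show ?case by (simp add: Forces.simps P.frc_Conj)
next
  case (fmrel_Forall E F F')
  have "P.frc q (Forces cQ cL (F' \<tau>) x) \<longleftrightarrow> P.frc q (Forces cQ cL (F' \<tau>) y)"
    if "P.isname \<tau>" "leq leP q p" for \<tau> q
    by (rule fmrel_Forall(2)) (use that fmrel_Forall(3-) P.below_cond P.eqn_mono in auto)
  then show ?case using fmrel_Forall(3) by (simp add: Forces.simps P.frc_Forall P.frc_Imp)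
qed

lemma small_image3:
  fixes g :: "'v \<Rightarrow> 'v \<Rightarrow> 'v \<Rightarrow> 'v"
  assumes "small A" "small B" "small C"
  shows "small {g x y z |x y z. x \<in> A \<and> y \<in> B \<and> z \<in> C}"
proof -
  have "{g x y z |x y z. x \<in> A \<and> y \<in> B \<and> z \<in> C} = (\<Union>x\<in>A. {g x y z |y z. y \<in> B \<and> z \<in> C})" by auto
  then show ?thesis using assms by (auto intro!: small_UN small_image2)
qed

text \<open>The closed set \<open>D\<close> only yields a name \<sigma> for the first coordinate
  that may be unrelated to \<tau>. An equal name \<rho> is found inside \<open>z\<close>, so that an
  induction along the transitive closure of \<tau> can use it.\<close>

lemma frc_IsName_elt:
  assumes "P.frc p (IsName cQ \<tau>)" "P.isname \<tau>" "vpair z s \<in> elts \<tau>" "leq leP p s"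
  shows "P.dns p (\<lambda>r. \<exists>\<rho> x. \<rho> \<in> trcl \<tau> \<and> P.isname \<rho> \<and> x \<in> elts Q \<and> P.frc r (IsName cQ \<rho>) \<and>
     P.feq r z (P.opn \<rho> (check P x)))"
proof (rule P.dnsI)
  fix q assume q: "leq leP q p"
  have nz: "P.isname z" using assms P.isname_pairD by blast
  obtain q1 D where q1: "leq leP q1 q" "P.isname D" "P.frc q1 (Conj (NameClosed cQ D) (Mem \<tau> D))"
    using P.dnsD[OF assms(1)[unfolded IsName_def P.frc_Exists] q] by blast
  have q1P: "q1 \<in> elts P" "leq leP q1 q1" using q1 P.below_cond P.below_refl by blast+
  have nc: "P.frc q1 (NameClosed cQ D)" and tD: "P.fmem q1 \<tau> D"
    using q1 assms(2) by (auto simp: P.frc_Conj P.frc_Mem)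
  have "leq leP q1 s" using q1 q assms(4) P.below_trans by blast
  then have zt: "P.fmem q1 z \<tau>" using P.fmem_elt assms(3) by blast
  from P.frc_BForallD[OF nc[unfolded NameClosed_def] q1(2) assms(2) q1P(2) tD]
  have "P.frc q1 (BForall \<tau> (\<lambda>z. BExists D (\<lambda>\<sigma>. BExists cQ (\<lambda>p. IsPair \<sigma> p z))))" .
  from P.frc_BForallD[OF this assms(2) nz q1P(2) zt]
  have "P.frc q1 (BExists D (\<lambda>\<sigma>. BExists cQ (\<lambda>p. IsPair \<sigma> p z)))" .
  then obtain q2 \<sigma> where q2: "leq leP q2 q1" "P.isname \<sigma>" "P.fmem q2 \<sigma> D" "P.frc q2 (BExists cQ (\<lambda>p. IsPair \<sigma> p z))"
    unfolding P.frc_BExists[OF q1(2)] using P.dns_ex q1P(1) by blast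
  have q2P: "q2 \<in> elts P" using q2 P.below_cond by blast
  obtain q3 \<rho>' where q3: "leq leP q3 q2" "P.isname \<rho>'" "P.fmem q3 \<rho>' cQ" "P.frc q3 (IsPair \<sigma> \<rho>' z)"
    using P.dns_ex[OF q2(4)[unfolded P.frc_BExists[OF P.isname_check]] q2P] by blast
  have q3P: "q3 \<in> elts P" using q3 P.below_cond by blast
  have z3: "P.feq q3 z (P.opn \<sigma> \<rho>')" using q3 q2 nz q3P by (simp add: P.frc_IsPair)
  obtain q4 x where q4: "leq leP q4 q3" "x \<in> elts Q" "P.feq q4 \<rho>' (check P x)"
    using P.dns_ex[OF q3(3)[unfolded P.fmem_check] q3P] by blast
  have q4P: "q4 \<in> elts P" using q4 P.below_cond by blast
  have "P.feq q4 z (P.opn \<sigma> (check P x))"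
    using P.feq_mono[OF z3 q4(1)] P.opn_cong[OF P.feq_refl q4(3)] P.feq_trans by blast
  note z4 = this
  \<comment> \<open>In a Kuratowski pair the first coordinate is a member of a member. Going down
    twice through listed members leads from \<open>z\<close> to a genuine subname equal to
    \<sigma>.\<close>
  have "P.fmem q4 (P.upn \<sigma> \<sigma>) z"
    using z4 P.feq_sym P.fmem_cong2 P.fmem_upn_left unfolding P.opn_def by blast
  then obtain q5 y s1 where q5: "leq leP q5 q4" "vpair y s1 \<in> elts z" "P.feq q5 y (P.upn \<sigma> \<sigma>)"
    unfolding P.fmem_def using P.dns_ex q4P by blast
  have q5P: "q5 \<in> elts P" using q5 P.below_cond by blast
  have "P.fmem q5 \<sigma> y" using q5(3) P.feq_sym P.fmem_cong2 P.fmem_upn_left by blast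
  then obtain q6 \<rho> s2 where q6: "leq leP q6 q5" "vpair \<rho> s2 \<in> elts y" "P.feq q6 \<rho> \<sigma>"
    unfolding P.fmem_def using P.dns_ex q5P by blast
  have q6P: "q6 \<in> elts P" "leq leP q6 q4" using q6 q5 P.below_cond P.below_trans by blast+
  have q62: "leq leP q6 q2" "leq leP q6 q1" using q6P q4 q3 q2 P.below_trans by meson+
  have tr: "\<rho> \<in> trcl \<tau>" using q6(2) q5(2) assms(3) vpair_mem_trcl trcl_trans by metis
  have n\<rho>: "P.isname \<rho>" using q6(2) q5(2) nz P.isname_pairD by blast
  have "P.fmem q6 \<rho> D" using q6(3) P.fmem_mono[OF q2(3) q62(1)] P.feq_sym P.fmem_cong1 by blast
  then have "P.frc q6 (Conj (NameClosed cQ D) (Mem \<rho> D))"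
    using P.frc_mono[OF nc q62(2)] n\<rho> q1(2) by (simp add: P.frc_Conj P.frc_Mem)
  then have "P.frc q6 (IsName cQ \<rho>)"
    unfolding IsName_def P.frc_Exists using P.frc_mono q1(2) by (intro P.dns_all) blast
  moreover have "P.feq q6 z (P.opn \<rho> (check P x))"
    using P.feq_mono[OF z4 q6P(2)] P.opn_cong[OF P.feq_sym[OF q6(3)] P.feq_refl] P.feq_trans by blast
  moreover have "leq leP q6 q" using q62 q1 P.below_trans by blast
  ultimately show "\<exists>r. leq leP r q \<and> (\<exists>\<rho> x. \<rho> \<in> trcl \<tau> \<and> P.isname \<rho> \<and> x \<in> elts Q \<and>
     P.frc r (IsName cQ \<rho>) \<and> P.feq r z (P.opn \<rho> (check P x)))"
    using tr n\<rho> q4(2) by blast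
qed

text \<open>Up to forced equality the translation \<open>st\<close> reaches every
  \<open>P\<close>-name of a \<open>Q\<close>-name. This is what allows a quantifier over
  \<open>Q\<close>-names of the extension to range over product names.\<close>

lemma ex_st_of_IsName:
  "P.isname \<tau> \<Longrightarrow> p \<in> elts P \<Longrightarrow> P.frc p (IsName cQ \<tau>) \<Longrightarrow> \<exists>a. PQ.isname a \<and> P.feq p \<tau> (st a)"
proof (induction \<tau> arbitrary: p rule: trcl_induct)
  case (1 \<tau>)
  define ok where "ok = (\<lambda>\<rho> r. \<rho> \<in> trcl \<tau> \<and> P.isname \<rho> \<and> r \<in> elts P \<and> P.frc r (IsName cQ \<rho>))"
  \<comment> \<open>The product name for a subname \<rho> depends on the condition that forces
    \<rho> to be a \<open>Q\<close>-name. Both range over sets, so all choices together form the set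
    \<open>Z\<close>.\<close>
  define rep where "rep = (\<lambda>\<rho> r. SOME a. PQ.isname a \<and> P.feq r \<rho> (st a))"
  have rep: "PQ.isname (rep \<rho> r) \<and> P.feq r \<rho> (st (rep \<rho> r))" if "ok \<rho> r" for \<rho> r
  proof -
    have "\<exists>a. PQ.isname a \<and> P.feq r \<rho> (st a)" using 1(1) that unfolding ok_def by blast
    then show ?thesis unfolding rep_def by (rule someI_ex)
  qed
  define Z where "Z = {rep \<rho> r |\<rho> r. \<rho> \<in> trcl \<tau> \<and> r \<in> elts P}"
  have sZ: "small Z" unfolding Z_def by (intro small_image2 small_trcl small_elts)
  \<comment> \<open>Listing whatever is forced into \<tau> makes one inclusion immediate; the other
    holds because \<open>Z\<close> contains a representative for each member of \<tau>.\<close>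
  define S where "S = {vpair b (vpair r x) |b r x. b \<in> Z \<and> r \<in> elts P \<and> x \<in> elts Q \<and> PQ.isname b \<and>
     P.fmem r (P.opn (st b) (check P x)) \<tau>}"
  have "small S"
    by (rule small_subset[OF small_image3[OF sZ small_elts[of P] small_elts[of Q], of "\<lambda>b r x. vpair b (vpair r x)"]])
      (auto simp: S_def)
  then have eS: "elts (vset S) = S" by simp
  have SI: "vpair b (vpair r x) \<in> S \<longleftrightarrow> b \<in> Z \<and> r \<in> elts P \<and> x \<in> elts Q \<and> PQ.isname b \<and>
     P.fmem r (P.opn (st b) (check P x)) \<tau>" for b r x by (auto simp: S_def)
  have na: "PQ.isname (vset S)"
    by (rule PQ.isnameI, unfold eS) (auto simp: S_def)
  have "P.feq p \<tau> (st (vset S))"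
    unfolding P.feq_iff
  proof (intro conjI allI impI)
    fix z s q assume z: "vpair z s \<in> elts \<tau>" "leq leP q p" "leq leP q s"
    have "P.frc q (IsName cQ \<tau>)" using 1(4) z P.frc_mono by blast
    from frc_IsName_elt[OF this 1(2) z(1,3)]
    show "P.fmem q z (st (vset S))"
    proof (intro P.fmem_dns, elim P.dns_mono exE conjE)
      fix r \<rho> x assume r: "leq leP r q" "\<rho> \<in> trcl \<tau>" "P.isname \<rho>" "x \<in> elts Q" "P.frc r (IsName cQ \<rho>)"
        "P.feq r z (P.opn \<rho> (check P x))"
      have rP: "r \<in> elts P" "leq leP r r" using r P.below_cond P.below_refl by blast+
      let ?b = "rep \<rho> r"
      have b: "PQ.isname ?b" "P.feq r \<rho> (st ?b)" using rep r rP unfolding ok_def by blast+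
      have zb: "P.feq r z (P.opn (st ?b) (check P x))"
        using r(6) P.opn_cong[OF b(2) P.feq_refl] P.feq_trans by blast
      have "leq leP r s" using r z P.below_trans by blast
      then have "P.fmem r z \<tau>" using P.fmem_elt z by blast
      then have "P.fmem r (P.opn (st ?b) (check P x)) \<tau>" using zb P.fmem_cong1 by blast
      moreover have "?b \<in> Z" using r rP unfolding Z_def by blast
      ultimately have "vpair ?b (vpair r x) \<in> elts (vset S)"
        using rP r b unfolding eS SI by blast
      from fmem_st_elt[OF this rP(2)] show "P.fmem r z (st (vset S))"
        using zb P.feq_sym P.fmem_cong1 by blast
    qed
  next
    fix z s q assume z: "vpair z s \<in> elts (st (vset S))" "leq leP q p" "leq leP q s"
    then obtain b x where "z = P.opn (st b) (check P x)" "vpair b (vpair s x) \<in> S"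
      by (auto simp: elts_st eS)
    then have "P.fmem s z \<tau>" by (simp add: SI)
    then show "P.fmem q z \<tau>" using z P.fmem_mono by blast
  qed
  with na show ?case by blast
qed

text \<open>The parameters need only be forced equal to translations, since at a universal
  quantifier the inner variable ranges over all names forced to be \<open>Q\<close>-names. Those are
  reached by \<open>ex_st_of_IsName\<close>, and every \<open>st a\<close> is one of them by
  \<open>frc_IsName_st\<close>.\<close>

theorem forces_forces_iff:
  "fmrel E \<phi> \<phi>' \<Longrightarrow> p \<in> elts P \<Longrightarrow> q \<in> elts Q \<Longrightarrow>
    (\<And>a \<tau>. (a, \<tau>) \<in> E \<Longrightarrow> PQ.isname a \<and> P.eqn p \<tau> (st a)) \<Longrightarrow>
    PQ.frc (vpair p q) \<phi> \<longleftrightarrow> P.frc p (Forces cQ cL \<phi>' (check P q))"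
proof (induction arbitrary: p q rule: fmrel.induct)
  case (fmrel_Mem a a' E b b')
  have n: "PQ.isname a" "PQ.isname b" "P.eqn p a' (st a)" "P.eqn p b' (st b)" using fmrel_Mem by blast+
  have "fmrel (insert (a', st a) (insert (b', st b) P.Idn)) (ForcesMem cQ cL (check P q) a' b')
      (ForcesMem cQ cL (check P q) (st a) (st b))"
    by (rule fmrel_ForcesMem) auto
  then have "P.frc p (ForcesMem cQ cL (check P q) a' b') \<longleftrightarrow> P.frc p (ForcesMem cQ cL (check P q) (st a) (st b))"
    by (rule P.frc_cong) (use n fmrel_Mem(3) in auto)
  then show ?case
    using n inner_mem[OF n(1,2) fmrel_Mem(3,4)] by (simp add: Forces.simps(1)[of cQ] PQ.frc_Mem)
next
  case (fmrel_Eq a a' E b b')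
  have n: "PQ.isname a" "PQ.isname b" "P.eqn p a' (st a)" "P.eqn p b' (st b)" using fmrel_Eq by blast+
  have "fmrel (insert (a', st a) (insert (b', st b) P.Idn)) (ForcesEq cQ cL (check P q) a' b')
      (ForcesEq cQ cL (check P q) (st a) (st b))"
    by (rule fmrel_ForcesEq) auto
  then have "P.frc p (ForcesEq cQ cL (check P q) a' b') \<longleftrightarrow> P.frc p (ForcesEq cQ cL (check P q) (st a) (st b))"
    by (rule P.frc_cong) (use n fmrel_Eq(3) in auto)
  then show ?case
    using n inner_eq[OF n(1,2) fmrel_Eq(3,4)] fmrel_Eq(3,4) by (simp add: Forces.simps(2)[of cQ] PQ.frc_Eq)
next
  case (fmrel_Neg E \<phi> \<phi>')
  have nE: "P.isname \<tau>" if "(a, \<tau>) \<in> E" for a \<tau> using fmrel_Neg(5) that unfolding P.eqn_def by blast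
  have resp: "P.resp p (\<lambda>x. Neg (Forces cQ cL \<phi>' x))"
    unfolding P.resp_def
  proof (intro allI impI)
    fix r x y assume r: "leq leP r p" "P.eqn r x y" "P.frc r (Neg (Forces cQ cL \<phi>' x))"
    have "P.frc r' (Forces cQ cL \<phi>' x) \<longleftrightarrow> P.frc r' (Forces cQ cL \<phi>' y)" if "leq leP r' r" for r'
    proof (rule frc_Forces_cong[OF fmrel_Neg(1)])
      show "r' \<in> elts P" using that P.below_cond by blast
      show "P.eqn r' x y" using that r P.eqn_mono by blast
    qed (rule nE)
    then show "P.frc r (Neg (Forces cQ cL \<phi>' y))" using r(3) unfolding P.frc_Neg by blast
  qed
  have IH: "PQ.frc (vpair p' q') \<phi> \<longleftrightarrow> P.frc p' (Forces cQ cL \<phi>' (check P q'))"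
    if "leq leP p' p" "q' \<in> elts Q" for p' q'
  proof (rule fmrel_Neg(2))
    show "p' \<in> elts P" using that P.below_cond by blast
    show "PQ.isname a \<and> P.eqn p' \<tau> (st a)" if "(a, \<tau>) \<in> E" for a \<tau>
      using fmrel_Neg(5)[OF that] \<open>leq leP p' p\<close> P.eqn_mono by blast
  qed (rule that(2))
  have "PQ.frc (vpair p q) (Neg \<phi>) \<longleftrightarrow> (\<forall>p' q'. leq leP p' p \<longrightarrow> leq leQ q' q \<longrightarrow> \<not> PQ.frc (vpair p' q') \<phi>)"
    unfolding PQ.frc_Neg by (metis leq_PQ leq_PQ_cases)
  also have "\<dots> \<longleftrightarrow> (\<forall>x. leq leQ x q \<longrightarrow> P.frc p (Neg (Forces cQ cL \<phi>' (check P x))))"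
    unfolding P.frc_Neg using IH Q.below_cond by metis
  also have "\<dots> \<longleftrightarrow> P.frc p (Forces cQ cL (Neg \<phi>') (check P q))"
    unfolding Forces.simps(3)[of cQ] frc_BelowForall_cQ[OF fmrel_Neg(3) resp] ..
  finally show ?case .
next
  case (fmrel_Conj E \<phi> \<phi>' \<psi> \<psi>')
  then show ?case by (simp add: Forces.simps(4)[of cQ] P.frc_Conj PQ.frc_Conj)
next
  case (fmrel_Forall E F F')
  have IH: "PQ.frc (vpair p' q) (F a) \<longleftrightarrow> P.frc p' (Forces cQ cL (F' \<tau>) (check P q))"
    if p': "leq leP p' p" and a: "PQ.isname a" "P.eqn p' \<tau> (st a)" for p' a \<tau>
  proof (rule fmrel_Forall(2))
    show "p' \<in> elts P" using p' P.below_cond by blast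
    show "PQ.isname b \<and> P.eqn p' \<sigma> (st b)" if "(b, \<sigma>) \<in> insert (a, \<tau>) E" for b \<sigma>
      using that fmrel_Forall(5) a P.eqn_mono[OF _ p'] by blast
  qed (rule fmrel_Forall(4))
  have r: "P.frc p (Forces cQ cL (Forall F') (check P q)) \<longleftrightarrow>
    (\<forall>\<tau>. P.isname \<tau> \<longrightarrow> (\<forall>p'. leq leP p' p \<longrightarrow> P.frc p' (IsName cQ \<tau>) \<longrightarrow> P.frc p' (Forces cQ cL (F' \<tau>) (check P q))))"
    unfolding Forces.simps(5)[of cQ] P.frc_Forall P.frc_Imp[OF fmrel_Forall(3)] ..
  show ?case
    unfolding PQ.frc_Forall r
  proof (intro iffI allI impI)
    fix \<tau> p' assume *: "\<forall>a. PQ.isname a \<longrightarrow> PQ.frc (vpair p q) (F a)" "P.isname \<tau>" "leq leP p' p"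
      "P.frc p' (IsName cQ \<tau>)"
    obtain a where a: "PQ.isname a" "P.feq p' \<tau> (st a)"
      using ex_st_of_IsName[OF *(2) _ *(4)] P.below_cond(1)[OF *(3)] by blast
    then have "P.eqn p' \<tau> (st a)" using * isname_st by (simp add: P.eqn_def)
    moreover have "PQ.frc (vpair p' q) (F a)"
      using * a(1) PQ.frc_mono[of _ "vpair p q" "vpair p' q"] fmrel_Forall(4) by auto
    ultimately show "P.frc p' (Forces cQ cL (F' \<tau>) (check P q))" using IH[OF *(3) a(1)] by blast
  next
    fix a assume *: "\<forall>\<tau>. P.isname \<tau> \<longrightarrow> (\<forall>p'. leq leP p' p \<longrightarrow> P.frc p' (IsName cQ \<tau>) \<longrightarrow>
       P.frc p' (Forces cQ cL (F' \<tau>) (check P q)))" "PQ.isname a"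
    have pp: "leq leP p p" using fmrel_Forall(3) by simp
    have "P.frc p (Forces cQ cL (F' (st a)) (check P q))"
      using * isname_st frc_IsName_st pp fmrel_Forall(3) by blast
    moreover have "P.eqn p (st a) (st a)" using isname_st *(2) by simp
    ultimately show "PQ.frc (vpair p q) (F a)" using IH[OF pp *(2)] by blast
  qed
qed

end

section \<open>Generic lower bounds\<close>

lemma num_mem: "m < n \<Longrightarrow> num m \<in> elts (num n)"
  by (induction n) (auto simp: less_Suc_eq)

lemma inj_num: "inj (num :: nat \<Rightarrow> 'v::zfc)"
proof
  fix m n :: nat assume "num m = (num n :: 'v)"
  then show "m = n" using num_mem[of m n] num_mem[of n m] mem_irrefl
    by (metis linorder_neqE_nat)
qed

text \<open>A cardinal above the numerals is uncountable, so it neither equals nor belongs to a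
  countable ordinal; comparability leaves one case.\<close>

lemma omega1_subset:
  fixes \<chi> :: "'v::zfc"
  assumes "ordinal \<chi>" "(range num :: 'v set) \<prec> elts \<chi>"
  shows "omega1 \<subseteq> elts \<chi>"
proof
  fix \<alpha> :: 'v assume "\<alpha> \<in> omega1"
  then have \<alpha>: "ordinal \<alpha>" "countable (elts \<alpha>)" by (auto simp: omega1_def)
  have "\<not> countable (elts \<chi>)"
  proof
    assume "countable (elts \<chi>)"
    then have "elts \<chi> \<lesssim> (UNIV :: nat set)" by (auto simp: countable_def lepoll_def)
    also have "(UNIV :: nat set) \<lesssim> range (num :: nat \<Rightarrow> 'v)"
      using inj_num by (auto simp: lepoll_def)
    finally have "elts \<chi> \<lesssim> range (num :: nat \<Rightarrow> 'v)" .
    then show False using assms(2) lepoll_antisym unfolding lesspoll_def by blast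
  qed
  moreover have "elts \<chi> \<subseteq> elts \<alpha>" if "\<chi> \<in> elts \<alpha>"
    using that \<alpha> by (auto simp: ordinal_def transitive_def)
  ultimately show "\<alpha> \<in> elts \<chi>"
    using ordinal_linear[OF \<alpha>(1) assms(1)] \<alpha>(2) countable_subset by blast
qed

lemma trcl_mono: "y \<in> trcl x \<Longrightarrow> trcl y \<subseteq> trcl x"
  using trcl_trans by blast

lemma ex_large_cardinal:
  fixes \<mu> x y :: "'v::zfc"
  assumes "cardinal \<mu>"
  shows "\<exists>\<chi>. cardinal \<chi> \<and> elts \<mu> \<subseteq> elts \<chi> \<and> omega1 \<subseteq> elts \<chi> \<and> x \<in> H \<chi> \<and> y \<in> H \<chi>"
proof -
  \<comment> \<open>The numerals are included to make the cardinal above \<open>B\<close>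
    uncountable, the transitive closures to bring \<open>x\<close> and \<open>y\<close> into
    \<open>H \<chi>\<close>.\<close>
  define B where "B = elts \<mu> \<union> range num \<union> trcl x \<union> trcl y"
  have "small B" unfolding B_def by (intro small_Un small_elts small_range_num small_trcl)
  then obtain \<chi> :: 'v where \<chi>: "cardinal \<chi>" "B \<prec> elts \<chi>" using ex_cardinal_gt by blast
  have sub: "A \<prec> elts \<chi>" if "A \<subseteq> B" for A
    using lesspoll_trans1[OF subset_imp_lepoll[OF that] \<chi>(2)] .
  have ord: "ordinal \<chi>" "ordinal \<mu>" using \<chi> assms by (auto simp: cardinal_def)
  have "elts \<mu> \<subseteq> elts \<chi>"
  proof -
    have "\<not> elts \<chi> \<subseteq> elts \<mu>"
    proof
      assume "elts \<chi> \<subseteq> elts \<mu>"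
      then have "elts \<chi> \<prec> elts \<chi>" by (intro sub) (auto simp: B_def)
      then show False by simp
    qed
    then show ?thesis
      using ordinal_linear[OF ord] ord by (auto simp: ordinal_def transitive_def)
  qed
  moreover have "omega1 \<subseteq> elts \<chi>" by (rule omega1_subset[OF ord(1) sub]) (auto simp: B_def)
  moreover have "x \<in> H \<chi>" "y \<in> H \<chi>" unfolding H_def by (auto intro!: sub simp: B_def)
  ultimately show ?thesis using \<chi> by blast
qed

lemma H_elt: "x \<in> H \<chi> \<Longrightarrow> y \<in> trcl x \<Longrightarrow> y \<in> H \<chi>"
  using lesspoll_trans1[OF subset_imp_lepoll[OF trcl_mono]] by (simp add: H_def)

text \<open>Closing off \<omega> times gives unboundedness; for unions of chains two arguments lie
  in a common member. The operation is set-valued so that it can return several values at once and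
  none outside its domain.\<close>

lemma club_closed_under:
  fixes X M0 :: "'a set" and g :: "'a \<Rightarrow> 'a \<Rightarrow> nat \<Rightarrow> 'a set"
  assumes M0: "M0 \<subseteq> X" "countable M0"
    and g: "\<And>x y k. x \<in> X \<Longrightarrow> y \<in> X \<Longrightarrow> g x y k \<subseteq> X" "\<And>x y k. countable (g x y k)"
  shows "club X {N \<in> countable_subsets X. M0 \<subseteq> N \<and> (\<forall>x\<in>N. \<forall>y\<in>N. \<forall>k. g x y k \<subseteq> N)}"
  unfolding club_def
proof (intro conjI ballI allI impI)
  fix M assume M: "M \<in> countable_subsets X"
  define N where "N = rec_nat (M \<union> M0) (\<lambda>_ N. N \<union> (\<Union>x\<in>N. \<Union>y\<in>N. \<Union>k. g x y k))"
  have N0: "N 0 = M \<union> M0" and NS: "N (Suc n) = N n \<union> (\<Union>x\<in>N n. \<Union>y\<in>N n. \<Union>k. g x y k)" for n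
    by (simp_all add: N_def)
  have NX: "N n \<subseteq> X \<and> countable (N n)" for n
  proof (induction n)
    case 0
    then show ?case using M M0 by (auto simp: N0 countable_subsets_def)
  next
    case (Suc n)
    have "(\<Union>x\<in>N n. \<Union>y\<in>N n. \<Union>k. g x y k) \<subseteq> X"
    proof (intro UN_least g(1))
      show "x \<in> X" if "x \<in> N n" for x using that Suc by blast
      then show "y \<in> X" if "y \<in> N n" for y using that Suc by blast
    qed
    with Suc show ?case using g(2) unfolding NS by auto
  qed
  have "mono N" unfolding mono_iff_le_Suc by (auto simp: NS)
  have cl: "g x y k \<subseteq> (\<Union>n. N n)" if xy: "x \<in> (\<Union>n. N n)" "y \<in> (\<Union>n. N n)" for x y k
  proof -
    obtain i j where "x \<in> N i" "y \<in> N j" using xy by blast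
    then have "x \<in> N (max i j)" "y \<in> N (max i j)"
      using monoD[OF \<open>mono N\<close>, of i "max i j"] monoD[OF \<open>mono N\<close>, of j "max i j"] by auto
    then have "g x y k \<subseteq> N (Suc (max i j))" by (auto simp: NS)
    then show ?thesis by blast
  qed
  have "(\<Union>n. N n) \<in> {N \<in> countable_subsets X. M0 \<subseteq> N \<and> (\<forall>x\<in>N. \<forall>y\<in>N. \<forall>k. g x y k \<subseteq> N)}"
    using NX cl N0 by (auto simp: countable_subsets_def)
  moreover have "M \<subseteq> (\<Union>n. N n)" using N0 by blast
  ultimately show "\<exists>N\<in>{N \<in> countable_subsets X. M0 \<subseteq> N \<and> (\<forall>x\<in>N. \<forall>y\<in>N. \<forall>k. g x y k \<subseteq> N)}. M \<subseteq> N" by blast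
next
  fix N :: "nat \<Rightarrow> 'a set"
  assume N: "range N \<subseteq> {N \<in> countable_subsets X. M0 \<subseteq> N \<and> (\<forall>x\<in>N. \<forall>y\<in>N. \<forall>k. g x y k \<subseteq> N)} \<and> mono N"
  then have "N n \<in> {N \<in> countable_subsets X. M0 \<subseteq> N \<and> (\<forall>x\<in>N. \<forall>y\<in>N. \<forall>k. g x y k \<subseteq> N)}" for n
    by blast
  then have Nn: "N n \<subseteq> X" "countable (N n)" "M0 \<subseteq> N n" "\<forall>x\<in>N n. \<forall>y\<in>N n. \<forall>k. g x y k \<subseteq> N n" for n
    by (simp_all add: countable_subsets_def)
  have cl: "g x y k \<subseteq> (\<Union>n. N n)" if xy: "x \<in> (\<Union>n. N n)" "y \<in> (\<Union>n. N n)" for x y k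
  proof -
    obtain i j where "x \<in> N i" "y \<in> N j" using xy by blast
    then have "x \<in> N (max i j)" "y \<in> N (max i j)"
      using monoD[of N i "max i j"] monoD[of N j "max i j"] N by auto
    then have "g x y k \<subseteq> N (max i j)" using Nn(4) by blast
    then show ?thesis by blast
  qed
  show "(\<Union>n. N n) \<in> {N \<in> countable_subsets X. M0 \<subseteq> N \<and> (\<forall>x\<in>N. \<forall>y\<in>N. \<forall>k. g x y k \<subseteq> N)}"
  proof -
    have "(\<Union>n. N n) \<subseteq> X" using Nn(1) by blast
    moreover have "countable (\<Union>n. N n)" using Nn(2) by simp
    moreover have "M0 \<subseteq> (\<Union>n. N n)" using Nn(3) by blast
    ultimately show ?thesis using cl unfolding countable_subsets_def by simp
  qed
qed auto

context two_forcing
begin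

text \<open>The conditions \<open>q\<^sub>j\<close> form a single descending sequence in the ground model, chosen so that for each
  \<open>k\<close> the conditions of \<open>N \<inter> P\<close> that decide \<open>k\<close> together with some \<open>q\<^sub>j\<close> are dense in \<open>N \<inter> P\<close>.\<close>

lemma strongly_proper_decide:
  fixes D :: "nat \<Rightarrow> 'v \<Rightarrow> 'v \<Rightarrow> bool"
  assumes sp: "strongly_proper_on_stationary P leP" and cl: "omega1_closed Q leQ"
    and p0: "p0 \<in> elts P" and q0: "q0 \<in> elts Q"
    and mono: "\<And>k p q p' q'. D k p q \<Longrightarrow> leq leP p' p \<Longrightarrow> leq leQ q' q \<Longrightarrow> D k p' q'"
    and dense: "\<And>k p q. leq leP p p0 \<Longrightarrow> leq leQ q q0 \<Longrightarrow> \<exists>p' q'. leq leP p' p \<and> leq leQ q' q \<and> D k p' q'"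
  shows "\<exists>p q. leq leP p p0 \<and> leq leQ q q0 \<and> (\<forall>k. P.dns p (\<lambda>r. D k r q))"
proof -
  \<comment> \<open>\<open>N\<close> also contains conditions incompatible with \<open>p0\<close>,
    where the density of \<open>D k\<close> is not assumed. They count as decided, which is harmless
    because in the end only conditions below \<open>p0\<close> are met.\<close>
  define D' where "D' = (\<lambda>k p q. (\<forall>r. leq leP r p \<longrightarrow> \<not> leq leP r p0) \<or> D k p q)"
  have "\<exists>p' q'. p \<in> elts P \<longrightarrow> leq leQ q q0 \<longrightarrow> leq leP p' p \<and> leq leQ q' q \<and> D' k p' q'" for p q k
  proof (cases "p \<in> elts P \<and> leq leQ q q0")
    case True
    show ?thesis
    proof (cases "\<exists>r. leq leP r p \<and> leq leP r p0")
      case True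
      then obtain r where r: "leq leP r p" "leq leP r p0" by blast
      obtain p' q' where "leq leP p' r" "leq leQ q' q" "D k p' q'"
        using dense[OF r(2)] \<open>p \<in> elts P \<and> leq leQ q q0\<close> by blast
      then show ?thesis using r P.below_trans unfolding D'_def by blast
    next
      case False
      then have "D' k p q" unfolding D'_def by blast
      then show ?thesis using \<open>p \<in> elts P \<and> leq leQ q q0\<close> P.below_refl Q.below_refl Q.below_cond by blast
    qed
  qed blast
  then obtain g1 g2 where g: "\<And>p q k. p \<in> elts P \<Longrightarrow> leq leQ q q0 \<Longrightarrow>
      leq leP (g1 p q k) p \<and> leq leQ (g2 p q k) q \<and> D' k (g1 p q k) (g2 p q k)"
    by metis
  \<comment> \<open>Both choice functions in one operation, empty off their domain so that its
    values stay inside \<open>H \<chi>\<close> for all arguments.\<close>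
  define g where "g = (\<lambda>p q k. if p \<in> elts P \<and> leq leQ q q0 then {g1 p q k, g2 p q k} else {})"
  obtain \<mu> :: 'v where \<mu>: "cardinal \<mu>" and stat: "\<And>\<chi>. cardinal \<chi> \<and> elts \<mu> \<subseteq> elts \<chi> \<and> omega1 \<subseteq> elts \<chi> \<and> vpair P leP \<in> H \<chi> \<Longrightarrow>
      stationary (H \<chi>) {N \<in> countable_subsets (H \<chi>).
         (\<exists>\<alpha>\<in>omega1. N \<inter> omega1 = elts \<alpha>) \<and> strongly_proper_for P leP N}"
    using sp unfolding strongly_proper_on_stationary_def by blast
  obtain \<chi> :: 'v where \<chi>: "cardinal \<chi>" "elts \<mu> \<subseteq> elts \<chi>" "omega1 \<subseteq> elts \<chi>" "vpair P leP \<in> H \<chi>" "Q \<in> H \<chi>"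
    using ex_large_cardinal[OF \<mu>] by metis
  have PH: "p \<in> H \<chi>" if "p \<in> elts P" for p
  proof -
    have "vset {P, leP} \<in> elts (vpair P leP)" "P \<in> elts (vset {P, leP})" by (auto simp: vpair_def)
    then have "P \<in> trcl (vpair P leP)" by (meson trcl_elts trcl_trans)
    then show ?thesis using H_elt[OF \<chi>(4)] trcl_elts[OF that] trcl_trans by blast
  qed
  have QH: "q \<in> H \<chi>" if "q \<in> elts Q" for q using H_elt[OF \<chi>(5) trcl_elts[OF that]] .
  define C where "C = {N \<in> countable_subsets (H \<chi>). {p0, q0} \<subseteq> N \<and> (\<forall>x\<in>N. \<forall>y\<in>N. \<forall>k. g x y k \<subseteq> N)}"
  have "club (H \<chi>) C"
    unfolding C_def
  proof (rule club_closed_under)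
    show "{p0, q0} \<subseteq> H \<chi>" using p0 q0 PH QH by blast
    fix x y k
    show "g x y k \<subseteq> H \<chi>"
    proof (cases "x \<in> elts P \<and> leq leQ y q0")
      case True
      then have "g1 x y k \<in> elts P" "g2 x y k \<in> elts Q"
        using g[of x y k] P.below_cond(1) Q.below_cond(1) by blast+
      then show ?thesis using PH QH by (auto simp: g_def)
    qed (auto simp: g_def)
    show "countable (g x y k)" by (simp add: g_def)
  qed simp
  moreover have "stationary (H \<chi>) {N \<in> countable_subsets (H \<chi>).
         (\<exists>\<alpha>\<in>omega1. N \<inter> omega1 = elts \<alpha>) \<and> strongly_proper_for P leP N}" (is "stationary _ ?S")
    by (rule stat) (use \<chi> in simp)
  ultimately have "?S \<inter> C \<noteq> {}" unfolding stationary_def by simp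
  then obtain N where N: "N \<in> C" "N \<in> countable_subsets (H \<chi>)" "strongly_proper_for P leP N"
    by auto
  have Ncl: "g1 p q k \<in> N" "g2 p q k \<in> N" if "p \<in> N" "p \<in> elts P" "q \<in> N" "leq leQ q q0" for p q k
  proof -
    have "g p q k \<subseteq> N" using N(1) that unfolding C_def by blast
    then show "g1 p q k \<in> N" "g2 p q k \<in> N" using that by (auto simp: g_def)
  qed
  have N0: "p0 \<in> N" "q0 \<in> N" "countable N" using N by (auto simp: C_def countable_subsets_def)
  obtain p where p: "leq leP p p0" "strongly_generic P leP N p"
    using N(3) N0(1) p0 unfolding strongly_proper_for_def by blast
  define W where "W = (N \<inter> elts P) \<times> (UNIV :: nat set)"
  define e where "e = from_nat_into W"
  have W: "W \<noteq> {}" "countable W" using N0 p0 by (auto simp: W_def)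
  have re: "range e = W" unfolding e_def using W by (rule range_from_nat_into)
  then have eP: "fst (e j) \<in> N" "fst (e j) \<in> elts P" for j unfolding W_def by (metis IntD1 IntD2 mem_Times_iff rangeI)+
  \<comment> \<open>Stage \<open>j\<close> treats the task \<open>e j\<close>, a condition of
    \<open>N\<close> and an index. Only the \<open>Q\<close>-coordinate of the answer is carried to
    the next stage; the \<open>P\<close>-coordinate becomes an element of \<open>Dk\<close>
    below.\<close>
  define s where "s = rec_nat q0 (\<lambda>j q. g2 (fst (e j)) q (snd (e j)))"
  have s0: "s 0 = q0" and sS: "s (Suc j) = g2 (fst (e j)) (s j) (snd (e j))" for j by (simp_all add: s_def)
  have sN: "s j \<in> N \<and> leq leQ (s j) q0" for j
  proof (induction j)
    case 0
    then show ?case using N0 q0 by (simp add: s0)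
  next
    case (Suc j)
    then show ?case using Ncl(2) eP g[OF eP(2)] Q.below_trans unfolding sS by blast
  qed
  have sdec: "leq leQ (s (Suc j)) (s j)" for j using g eP sN unfolding sS by blast
  have "range s \<subseteq> elts Q" using sN Q.below_cond by blast
  then obtain q where q: "\<And>j. leq leQ q (s j)"
    using cl sdec unfolding omega1_closed_def by blast
  have "P.dns p (\<lambda>r. D k r q)" for k
  proof (rule P.dnsI)
    fix r assume r: "leq leP r p"
    \<comment> \<open>Defined from the whole sequence \<open>s\<close>, this set need not be an
      element of \<open>N\<close>; strong genericity applies to it nevertheless.\<close>
    define Dk where "Dk = {d \<in> N \<inter> elts P. \<exists>j. D' k d (s j)}"
    have "dense_in leP (N \<inter> elts P) Dk"
      unfolding dense_in_def
    proof (intro conjI ballI)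
      fix u assume u: "u \<in> N \<inter> elts P"
      then have "(u, k) \<in> range e" using re by (simp add: W_def)
      then obtain j where j: "e j = (u, k)" by (metis rangeE)
      have "g1 u (s j) k \<in> N" using Ncl(1) u sN by blast
      moreover have gu: "leq leP (g1 u (s j) k) u" "D' k (g1 u (s j) k) (g2 u (s j) k)" using g u sN by blast+
      moreover have "g2 u (s j) k = s (Suc j)" using j sS by simp
      ultimately have "g1 u (s j) k \<in> Dk" unfolding Dk_def using P.below_cond(1)[OF gu(1)] by auto
      then show "\<exists>d\<in>Dk. leq leP d u" using gu by blast
    qed (auto simp: Dk_def)
    then have "predense_below P leP Dk p" using p(2) unfolding strongly_generic_def by blast
    then obtain d u where d: "d \<in> Dk" "leq leP u d" "leq leP u r"
      using r P.below_cond unfolding predense_below_def compatible_def by blast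
    then obtain j where "D' k d (s j)" unfolding Dk_def by blast
    moreover have "leq leP u p0" using d r p P.below_trans by blast
    \<comment> \<open>\<open>u\<close> is a common extension of \<open>d\<close> and
      \<open>p0\<close>, which excludes the exceptional alternative of \<open>D'\<close>.\<close>
    ultimately have "D k d (s j)" using d unfolding D'_def by blast
    then show "\<exists>r'. leq leP r' r \<and> D k r' q" using mono d q by blast
  qed
  moreover have "leq leQ q q0" using q[of 0] s0 by simp
  ultimately show ?thesis using p(1) by blast
qed

section \<open>Canonical names in the extension\<close>

text \<open>\<open>CQ y\<close> is a \<open>P\<close>-name for the canonical \<open>Q\<close>-name, computed in the extension, of the set named by
  \<open>y\<close>.\<close>

definition CQ :: "'v \<Rightarrow> 'v" where
  "CQ = wfrec ({(x, y). x \<in> elts y}\<^sup>+)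
     (\<lambda>f y. vset {vpair (P.opn (f z) (check P r)) p |z p r. vpair z p \<in> elts y \<and> r \<in> elts Q})"

lemma elts_CQ: "elts (CQ y) = {vpair (P.opn (CQ z) (check P r)) p |z p r. vpair z p \<in> elts y \<and> r \<in> elts Q}"
proof -
  let ?R = "{(x, y). x \<in> elts y}\<^sup>+ :: ('v \<times> 'v) set"
  have "CQ y = vset {vpair (P.opn (cut CQ ?R y z) (check P r)) p |z p r. vpair z p \<in> elts y \<and> r \<in> elts Q}"
    unfolding CQ_def by (subst wfrec[OF wf_trancl[OF foundation]]) simp
  also have "{vpair (P.opn (cut CQ ?R y z) (check P r)) p |z p r. vpair z p \<in> elts y \<and> r \<in> elts Q} =
      {vpair (P.opn (CQ z) (check P r)) p |z p r. vpair z p \<in> elts y \<and> r \<in> elts Q}"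
  proof -
    have "cut CQ ?R y b = CQ b" if "vpair b c \<in> elts y" for b c
      using vpair_mem_trcl(1)[OF that] by (simp add: cut_def trcl_def)
    then show ?thesis by (intro Collect_cong ex_cong1) auto
  qed
  finally have "CQ y = vset {vpair (P.opn (CQ z) (check P r)) p |z p r. vpair z p \<in> elts y \<and> r \<in> elts Q}"
    (is "_ = vset ?S") .
  then have "elts (CQ y) = elts (vset ?S)" by (rule arg_cong)
  moreover have "small ?S"
    by (rule small_subset[OF small_image3[OF small_trcl[of y] small_trcl[of y] small_elts[of Q],
        of "\<lambda>z p r. vpair (P.opn (CQ z) (check P r)) p"]]) (use vpair_mem_trcl in blast)
  then have "elts (vset ?S) = ?S" by (rule elts_vset)
  ultimately show ?thesis by (rule trans)
qed

lemma isname_CQ: "P.isname y \<Longrightarrow> P.isname (CQ y)"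
proof (induction y rule: trcl_induct)
  case (1 y)
  show ?case
  proof (rule P.isnameI)
    fix u assume "u \<in> elts (CQ y)"
    then obtain z p r where z: "u = vpair (P.opn (CQ z) (check P r)) p" "vpair z p \<in> elts y"
      by (auto simp: elts_CQ)
    then have "P.isname (CQ z)" "p \<in> elts P" using 1 P.isname_pairD vpair_mem_trcl by blast+
    then show "\<exists>\<sigma> p. u = vpair \<sigma> p \<and> p \<in> elts P \<and> P.isname \<sigma>" using z by auto
  qed
qed

lemma fmem_CQ: "P.fmem p \<tau> (CQ y) \<longleftrightarrow> P.dns p (\<lambda>q. \<exists>z s r. vpair z s \<in> elts y \<and> leq leP q s \<and>
    r \<in> elts Q \<and> P.feq q \<tau> (P.opn (CQ z) (check P r)))"
  unfolding P.fmem_def by (rule P.dns_cong) (auto simp: elts_CQ P.feq_commute[of _ \<tau>]; metis)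

text \<open>The canonical name depends only on the set that is named. This makes the graph of
  \<open>CQ\<close> on a set of names a forced function.\<close>

lemma CQ_cong: "P.feq p y y' \<Longrightarrow> P.feq p (CQ y) (CQ y')"
proof (induction y arbitrary: p y' rule: trcl_induct)
  case (1 y)
  have fwd: "P.fmem q u (CQ y2)"
    if u: "vpair u s \<in> elts (CQ y1)" "leq leP q p" "leq leP q s" and eq: "P.feq p y1 y2"
      and IH: "\<And>z z' s s' q. vpair z s \<in> elts y1 \<Longrightarrow> vpair z' s' \<in> elts y2 \<Longrightarrow> P.feq q z z' \<Longrightarrow> P.feq q (CQ z) (CQ z')"
    for y1 y2 u s q
  proof -
    obtain z r where z: "u = P.opn (CQ z) (check P r)" "vpair z s \<in> elts y1" "r \<in> elts Q"
      using u(1) by (auto simp: elts_CQ)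
    show ?thesis
      unfolding fmem_CQ using P.feqE1[OF eq z(2) u(2,3), unfolded P.fmem_def]
    proof (elim P.dns_mono exE conjE)
      fix q' z' s' assume q': "leq leP q' q" "vpair z' s' \<in> elts y2" "leq leP q' s'" "P.feq q' z' z"
      have "P.feq q' (CQ z) (CQ z')" using IH[OF z(2) q'(2)] P.feq_sym q'(4) by blast
      then have "P.feq q' u (P.opn (CQ z') (check P r))" unfolding z(1) by (intro P.opn_cong) auto
      then show "\<exists>z s r. vpair z s \<in> elts y2 \<and> leq leP q' s \<and> r \<in> elts Q \<and> P.feq q' u (P.opn (CQ z) (check P r))"
        using q' z by blast
    qed
  qed
  show ?case
    unfolding P.feq_iff[of p "CQ y"]
  proof (intro conjI allI impI)
    fix u s q assume u: "vpair u s \<in> elts (CQ y)" "leq leP q p" "leq leP q s"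
    show "P.fmem q u (CQ y')"
      by (rule fwd[OF u 1(2)]) (use 1(1) vpair_mem_trcl in blast)
  next
    fix u s q assume u: "vpair u s \<in> elts (CQ y')" "leq leP q p" "leq leP q s"
    show "P.fmem q u (CQ y)"
    proof (rule fwd[OF u P.feq_sym[OF 1(2)]])
      fix z z' s s' q assume "vpair z s \<in> elts y'" "vpair z' s' \<in> elts y" "P.feq q z z'"
      then show "P.feq q (CQ z) (CQ z')" using 1(1)[of z' q z] vpair_mem_trcl P.feq_sym by blast
    qed
  qed
qed

lemma fmem_CQ_I:
  assumes "P.fmem p z y" "r \<in> elts Q"
  shows "P.fmem p (P.opn (CQ z) (check P r)) (CQ y)"
  unfolding fmem_CQ using assms(1)[unfolded P.fmem_def]
proof (elim P.dns_mono exE conjE)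
  fix q z' s' assume q: "leq leP q p" "vpair z' s' \<in> elts y" "leq leP q s'" "P.feq q z' z"
  have "P.feq q (P.opn (CQ z) (check P r)) (P.opn (CQ z') (check P r))"
    using CQ_cong[OF q(4)] P.feq_sym by (intro P.opn_cong) auto
  then show "\<exists>z' s r'. vpair z' s \<in> elts y \<and> leq leP q s \<and> r' \<in> elts Q \<and>
      P.feq q (P.opn (CQ z) (check P r)) (P.opn (CQ z') (check P r'))"
    using q assms by blast
qed

text \<open>An identity of names, since all three canonical-name operations attach every condition.
  It links ground-model ordinals in the extension with those of the product.\<close>

lemma CQ_check: "CQ (check P x) = st (check PQ x)"
proof (induction x rule: elts_induct)
  case (1 x)
  have "elts (CQ (check P x)) = elts (st (check PQ x))"
    unfolding elts_CQ elts_st using 1 by (auto simp: elts_check; metis)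
  then show ?case by (simp add: elts_inject)
qed

end

section \<open>The countable set of ordinals as a set of the extension\<close>

context two_forcing
begin

text \<open>The transitive set and the function that \<open>IsCheck\<close> asks for are named by
  the subnames of \<open>x\<close> and by the pairs of a subname with its \<open>CQ\<close>.\<close>

lemma frc_IsCheck_CQ:
  assumes x: "P.isname x" and p: "p \<in> elts P"
  shows "P.frc p (IsCheck cQ x (CQ x))"
proof -
  define S where "S = P.subnames x"
  define D where "D = P.pn S (\<lambda>_ _. True)"
  define T where "T = (\<lambda>y. P.opn y (CQ y)) ` S"
  define f where "f = P.pn T (\<lambda>_ _. True)"
  define B where "B = (\<lambda>y e. BExists y (\<lambda>z. BExists cQ (\<lambda>p. Exists (\<lambda>v.
     Conj (PairIn z v f) (IsPair v p e)))))"
  have sS: "small S" "small T" using P.small_subnames by (auto simp: S_def T_def)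
  have nS: "P.isname y" if "y \<in> S" for y using that P.subnames_isname by (simp add: S_def)
  have nD: "P.isname D" unfolding D_def using sS nS by (intro P.isname_pn)
  have nf: "P.isname f" unfolding f_def using sS nS isname_CQ by (intro P.isname_pn) (auto simp: T_def)
  have mD: "P.fmem q u D \<longleftrightarrow> P.dns q (\<lambda>r. \<exists>y\<in>S. P.feq r u y)" for q u
    unfolding D_def by (subst P.fmem_pn[OF sS(1)]) auto
  have mf: "P.fmem q u f \<longleftrightarrow> P.dns q (\<lambda>r. \<exists>y\<in>S. P.feq r u (P.opn y (CQ y)))" for q u
    unfolding f_def by (subst P.fmem_pn[OF sS(2)]) (auto simp: T_def)
  \<comment> \<open>A name in \<open>D\<close> may equal several listed subnames; by
    \<open>CQ_cong\<close> their listed values are forced equal, so \<open>f\<close> is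
    single-valued.\<close>
  have fp: "P.fmem q (P.opn y v) f \<longleftrightarrow> P.feq q v (CQ y)" if y: "P.fmem q y D" for q y v
  proof
    assume "P.fmem q (P.opn y v) f"
    then have "P.dns q (\<lambda>r. P.feq r v (CQ y))"
      unfolding mf
    proof (elim P.dns_mono bexE)
      fix r y' assume r: "P.feq r (P.opn y v) (P.opn y' (CQ y'))"
      show "P.feq r v (CQ y)"
        using P.opn_inj[OF r] CQ_cong P.feq_sym P.feq_trans by blast
    qed
    then show "P.feq q v (CQ y)" by (rule P.feq_dns)
  next
    assume v: "P.feq q v (CQ y)"
    show "P.fmem q (P.opn y v) f"
      using y unfolding mf mD
    proof (elim P.dns_mono bexE)
      fix r y' assume r: "leq leP r q" "y' \<in> S" "P.feq r y y'"
      have "P.feq r v (CQ y')" using P.feq_mono[OF v r(1)] CQ_cong[OF r(3)] P.feq_trans by blast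
      then show "\<exists>y'\<in>S. P.feq r (P.opn y v) (P.opn y' (CQ y'))" using r P.opn_cong by blast
    qed
  qed
  have trD: "P.fmem q z D" if yz: "P.fmem q y D" "P.fmem q z y" for q y z
  proof (rule P.fmem_dns, rule P.dnsI)
    fix q1 assume q1: "leq leP q1 q"
    obtain q2 y' where q2: "leq leP q2 q1" "y' \<in> S" "P.feq q2 y y'"
      using P.dnsD[OF yz(1)[unfolded mD] q1] by blast
    have q2q: "leq leP q2 q" "q2 \<in> elts P" using q2 q1 P.below_trans P.below_cond by blast+
    have "P.fmem q2 z y'" using P.fmem_mono[OF yz(2) q2q(1)] q2(3) P.fmem_cong2 by blast
    then obtain q3 z' s where q3: "leq leP q3 q2" "vpair z' s \<in> elts y'" "P.feq q3 z' z"
      unfolding P.fmem_def using P.dns_ex q2q(2) by blast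
    have "z' \<in> S" using q2(2) q3(2) P.subnames_step unfolding S_def by blast
    then have "P.fmem q3 z D"
      unfolding mD using q3(3) P.feq_sym P.feq_mono by (intro P.dns_all) blast
    then show "\<exists>r. leq leP r q1 \<and> P.fmem r z D" using q3 q2 P.below_trans by blast
  qed
  have xD: "P.fmem q x D" for q
    unfolding mD by (rule P.dns_all) (use x P.subnames_self P.feq_refl in \<open>unfold S_def, blast\<close>)
  have c1: "P.frc q (Trans D)" if q: "q \<in> elts P" for q
    unfolding Trans_def P.frc_BForall[OF q nD]
  proof (intro allI impI)
    fix y r assume y: "P.isname y" "leq leP r q" "P.fmem r y D"
    show "P.frc r (BForall y (\<lambda>z. Mem z D))"
      unfolding P.frc_BForall[OF P.below_cond(1)[OF y(2)] y(1)]
      using trD[OF P.fmem_mono[OF y(3)]] nD by (simp add: P.frc_Mem)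
  qed
  have c3: "P.frc q (BForall D (\<lambda>y. Exists (\<lambda>u. Forall (\<lambda>v. Iff (PairIn y v f) (Eq v u)))))"
    if q: "q \<in> elts P" for q
    unfolding P.frc_BForall[OF q nD]
  proof (intro allI impI)
    fix y r assume y: "P.isname y" "leq leP r q" "P.fmem r y D"
    have "P.frc r' (Forall (\<lambda>v. Iff (PairIn y v f) (Eq v (CQ y))))" if r': "leq leP r' r" for r'
    proof -
      have r'P: "r' \<in> elts P" using r' P.below_cond by blast
      have "P.frc r'' (PairIn y v f) \<longleftrightarrow> P.frc r'' (Eq v (CQ y))" if v: "P.isname v" "leq leP r'' r'" for v r''
      proof -
        have "P.fmem r'' y D" "r'' \<in> elts P" using v r' P.fmem_mono[OF y(3)] P.below_cond P.below_trans by blast+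
        then show ?thesis using fp v y nf isname_CQ by (simp add: P.frc_PairIn P.frc_Eq)
      qed
      then show ?thesis unfolding P.frc_Forall P.frc_Iff[OF r'P] by blast
    qed
    then show "P.frc r (Exists (\<lambda>u. Forall (\<lambda>v. Iff (PairIn y v f) (Eq v u))))"
      unfolding P.frc_Exists using isname_CQ[OF y(1)] by (intro P.dns_all) blast
  qed
  have body: "P.frc q (B y e) \<longleftrightarrow>
      P.fmem q e (CQ y)"
    if h: "q \<in> elts P" "P.isname y" "P.isname e" "P.fmem q y D" for q y e
  proof
    assume "P.frc q (B y e)"
    then show "P.fmem q e (CQ y)"
      unfolding B_def P.frc_BExists[OF h(2)]
    proof (intro P.fmem_dns, elim P.dns_mono exE conjE)
      fix r z assume z: "leq leP r q" "P.isname z" "P.fmem r z y"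
        and "P.frc r (BExists cQ (\<lambda>p. Exists (\<lambda>v. Conj (PairIn z v f) (IsPair v p e))))"
      from this(4) show "P.fmem r e (CQ y)"
        unfolding P.frc_BExists[OF P.isname_check]
      proof (intro P.fmem_dns, elim P.dns_mono exE conjE)
        fix r1 \<rho> assume \<rho>: "leq leP r1 r" "P.isname \<rho>" "P.fmem r1 \<rho> cQ"
          and "P.frc r1 (Exists (\<lambda>v. Conj (PairIn z v f) (IsPair v \<rho> e)))"
        from this(4) show "P.fmem r1 e (CQ y)"
          unfolding P.frc_Exists
        proof (intro P.fmem_dns, elim P.dns_mono exE conjE)
          fix r2 v assume v: "leq leP r2 r1" "P.isname v" "P.frc r2 (Conj (PairIn z v f) (IsPair v \<rho> e))"
          have r2: "r2 \<in> elts P" "leq leP r2 r" "leq leP r2 q" using v z \<rho> P.below_cond P.below_trans by meson+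
          have "P.fmem r2 z D" using trD P.fmem_mono[OF h(4) r2(3)] P.fmem_mono[OF z(3) r2(2)] by blast
          then have e2: "P.feq r2 v (CQ z)" "P.feq r2 e (P.opn v \<rho>)"
            using v(2,3) r2(1) z(2) \<rho>(2) h(3) nf fp by (auto simp: P.frc_Conj P.frc_PairIn P.frc_IsPair)
          have "P.fmem r2 \<rho> cQ" using \<rho>(3) v(1) P.fmem_mono by blast
          then show "P.fmem r2 e (CQ y)"
            unfolding P.fmem_check
          proof (intro P.fmem_dns, elim P.dns_mono bexE)
            fix r3 w assume w: "leq leP r3 r2" "w \<in> elts Q" "P.feq r3 \<rho> (check P w)"
            have "leq leP r3 r" using w r2 P.below_trans by blast
            then have "P.fmem r3 (P.opn (CQ z) (check P w)) (CQ y)"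
              using fmem_CQ_I P.fmem_mono[OF z(3)] w(2) by blast
            moreover have "P.feq r3 (P.opn v \<rho>) (P.opn (CQ z) (check P w))"
              using P.feq_mono[OF e2(1) w(1)] w(3) by (rule P.opn_cong)
            then have "P.feq r3 (P.opn (CQ z) (check P w)) e"
              using P.feq_mono[OF e2(2) w(1)] P.feq_trans P.feq_sym by blast
            ultimately show "P.fmem r3 e (CQ y)" using P.fmem_cong1 by blast
          qed
        qed
      qed
    qed
  next
    assume "P.fmem q e (CQ y)"
    then show "P.frc q (B y e)"
      unfolding B_def P.frc_BExists[OF h(2)] fmem_CQ
    proof (elim P.dns_mono exE conjE)
      fix r z s w assume z: "leq leP r q" "vpair z s \<in> elts y" "leq leP r s" "w \<in> elts Q"
        "P.feq r e (P.opn (CQ z) (check P w))"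
      have nz: "P.isname z" using h z P.isname_pairD by blast
      have zy: "P.fmem r z y" using P.fmem_elt z by blast
      then have zD: "P.fmem r z D" using trD P.fmem_mono[OF h(4) z(1)] by blast
      have cj: "P.frc r' (Conj (PairIn z (CQ z) f) (IsPair (CQ z) (check P w) e))" if r': "leq leP r' r" for r'
      proof -
        have "r' \<in> elts P" "P.fmem r' z D" "P.feq r' e (P.opn (CQ z) (check P w))"
          using r' zD z(5) P.below_cond P.fmem_mono P.feq_mono by blast+
        then show ?thesis
          using fp nz h(3) nf isname_CQ by (simp add: P.frc_Conj P.frc_PairIn P.frc_IsPair)
      qed
      have "P.frc r' (Exists (\<lambda>v. Conj (PairIn z v f) (IsPair v (check P w) e)))" if "leq leP r' r" for r'
        unfolding P.frc_Exists using cj that P.below_trans isname_CQ[OF nz] by (intro P.dns_all) blast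
      then have "P.frc r (BExists cQ (\<lambda>p. Exists (\<lambda>v. Conj (PairIn z v f) (IsPair v p e))))"
        unfolding P.frc_BExists[OF P.isname_check]
        using P.fmem_checkI[OF z(4)] P.isname_check by (intro P.dns_all) blast
      then show "\<exists>z. P.isname z \<and> P.fmem r z y \<and> P.frc r (BExists cQ (\<lambda>p. Exists (\<lambda>v. Conj (PairIn z v f) (IsPair v p e))))"
        using nz zy by blast
    qed
  qed
  have c4: "P.frc q (BForall D (\<lambda>y. Forall (\<lambda>u. Imp (PairIn y u f)
             (Forall (\<lambda>e. Iff (Mem e u)
                (B y e))))))" if q: "q \<in> elts P" for q
    unfolding P.frc_BForall[OF q nD]
  proof (intro allI impI)
    fix y r assume y: "P.isname y" "leq leP r q" "P.fmem r y D"
    have rP: "r \<in> elts P" using y P.below_cond by blast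
    show "P.frc r (Forall (\<lambda>u. Imp (PairIn y u f) (Forall (\<lambda>e. Iff (Mem e u)
                (B y e)))))"
      unfolding P.frc_Forall[where p = r] P.frc_Imp[OF rP]
    proof (intro allI impI)
      fix u r1 assume u: "P.isname u" "leq leP r1 r" "P.frc r1 (PairIn y u f)"
      have r1: "r1 \<in> elts P" "P.fmem r1 y D" using u y P.below_cond P.fmem_mono by blast+
      have fu: "P.feq r1 u (CQ y)" using u y r1 nf fp by (simp add: P.frc_PairIn)
      show "P.frc r1 (Forall (\<lambda>e. Iff (Mem e u)
                (B y e)))"
        unfolding P.frc_Forall[where p = r1] P.frc_Iff[OF r1(1)]
      proof (intro allI impI)
        fix e r2 assume e: "P.isname e" "leq leP r2 r1"
        have r2: "r2 \<in> elts P" "P.fmem r2 y D" "P.feq r2 u (CQ y)"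
          using e r1 fu P.below_cond P.fmem_mono P.feq_mono by blast+
        have "P.frc r2 (Mem e u) \<longleftrightarrow> P.fmem r2 e (CQ y)"
          using P.fmem_cong[OF P.feq_refl r2(3)] e u by (simp add: P.frc_Mem)
        then show "P.frc r2 (Mem e u) \<longleftrightarrow>
           P.frc r2 (B y e)"
          using body[OF r2(1) y(1) e(1) r2(2)] by simp
      qed
    qed
  qed
  have all: "P.frc q (Conj (Trans D) (Conj (Mem x D)
    (Conj (BForall D (\<lambda>y. Exists (\<lambda>u. Forall (\<lambda>v. Iff (PairIn y v f) (Eq v u)))))
    (Conj (BForall D (\<lambda>y. Forall (\<lambda>u. Imp (PairIn y u f)
             (Forall (\<lambda>e. Iff (Mem e u)
                (B y e))))))
          (PairIn x (CQ x) f)))))" if q: "q \<in> elts P" for q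
  proof -
    have "P.frc q (Mem x D)" using xD x nD by (simp add: P.frc_Mem)
    moreover have "P.frc q (PairIn x (CQ x) f)"
      using fp[OF xD] x nf isname_CQ q by (simp add: P.frc_PairIn)
    ultimately show ?thesis unfolding P.frc_Conj using c1[OF q] c3[OF q] c4[OF q] by blast
  qed
  show ?thesis
    unfolding IsCheck_def P.frc_Exists
    by (intro P.dns_all exI[of _ D] exI[of _ f] conjI nD nf all[unfolded B_def]) (rule P.below_cond)
qed

text \<open>\<open>x\<close> names the set of all \<open>\<alpha>\<close> whose membership in \<open>t\<close> is forced by \<open>q'\<close> and a condition of the
  \<open>P\<close>-generic filter. It need not belong to the ground model.\<close>

lemma ex_check_name:
  assumes sp: "strongly_proper_on_stationary P leP" and cl: "omega1_closed Q leQ"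
    and t: "PQ.isname t" and p: "p \<in> elts P" and q: "q \<in> elts Q"
    and cso: "PQ.frc (vpair p q) (CountableSetOfOrdinals t)"
  shows "\<exists>p' q' x a. leq leP p' p \<and> leq leQ q' q \<and> P.isname x \<and> PQ.isname a \<and> CQ x = st a \<and>
    PQ.feq (vpair p' q') t a"
proof -
  have "vpair p q \<in> elts PQ" using p q by simp
  from PQ.frc_CountableSetOfOrdinals_enum[OF cso t this]
  obtain c G where c: "leq lePQ c (vpair p q)"
    and G1: "\<forall>d d' k \<alpha>. G d k \<alpha> \<longrightarrow> leq lePQ d' d \<longrightarrow> G d' k \<alpha>"
    and G2: "\<forall>d k \<alpha>. G d k \<alpha> \<longrightarrow> PQ.fmem d (check PQ \<alpha>) t"
    and G3: "\<forall>d y. leq lePQ d c \<longrightarrow> PQ.isname y \<longrightarrow> PQ.fmem d y t \<longrightarrow>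
       PQ.dns d (\<lambda>s. \<exists>k \<alpha>. PQ.feq s y (check PQ \<alpha>) \<and> G s k \<alpha>)"
    and G4: "\<forall>d k \<alpha> \<beta>. leq lePQ d c \<longrightarrow> G d k \<alpha> \<longrightarrow> G d (k::nat) \<beta> \<longrightarrow> \<alpha> = \<beta>"
    by (elim exE conjE) (rule that)
  note Gmono = G1[rule_format] and Gmem = G2[rule_format] and Gtot = G3[rule_format]
    and Ginj = G4[rule_format]
  obtain p0 q0 where c0: "c = vpair p0 q0" "leq leP p0 p" "leq leQ q0 q" using c by (rule leq_PQ_cases)
  \<comment> \<open>An index may be the index of nothing; the second alternative decides this case.
    Together the alternatives are dense, and both persist to stronger pairs.\<close>
  define D where "D = (\<lambda>k p q. (\<exists>\<alpha>. G (vpair p q) k \<alpha>) \<or> (\<forall>d. leq lePQ d (vpair p q) \<longrightarrow> (\<forall>\<alpha>. \<not> G d k \<alpha>)))"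
  have "\<exists>p q. leq leP p p0 \<and> leq leQ q q0 \<and> (\<forall>k. P.dns p (\<lambda>r. D k r q))"
  proof (rule strongly_proper_decide[OF sp cl])
    show "p0 \<in> elts P" "q0 \<in> elts Q" using c0 P.below_cond Q.below_cond by blast+
    show "D k p' q'" if "D k p q" "leq leP p' p" "leq leQ q' q" for k p q p' q'
    proof -
      have "leq lePQ (vpair p' q') (vpair p q)" using that by simp
      then show ?thesis using that(1) Gmono PQ.below_trans unfolding D_def by blast
    qed
    show "\<exists>p' q'. leq leP p' p \<and> leq leQ q' q \<and> D k p' q'" if pq: "leq leP p p0" "leq leQ q q0" for k p q
    proof (cases "\<exists>d \<alpha>. leq lePQ d (vpair p q) \<and> G d k \<alpha>")
      case True
      then obtain d \<alpha> where d: "leq lePQ d (vpair p q)" "G d k \<alpha>" by blast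
      obtain p' q' where "d = vpair p' q'" "leq leP p' p" "leq leQ q' q" using d(1) by (rule leq_PQ_cases)
      then show ?thesis using d(2) unfolding D_def by blast
    next
      case False
      then have "D k p q" unfolding D_def by blast
      then show ?thesis using pq P.below_cond Q.below_cond P.below_refl Q.below_refl by blast
    qed
  qed
  then obtain p1 q1 where p1: "leq leP p1 p0" and q1: "leq leQ q1 q0" and dec: "\<And>k. P.dns p1 (\<lambda>r. D k r q1)"
    by blast
  \<comment> \<open>All ordinals that any pair can force into \<open>t\<close>; a set, so that the
    names \<open>x\<close> and \<open>vset S\<close> exist.\<close>
  define \<Gamma> where "\<Gamma> = {x. \<exists>\<pi>\<in>trcl t. \<exists>r\<in>elts PQ. PQ.feq r \<pi> (check PQ x)}"
  have s\<Gamma>: "small \<Gamma>" unfolding \<Gamma>_def by (intro PQ.small_check_values small_trcl)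
  have \<Gamma>I: "\<alpha> \<in> \<Gamma>" if m: "PQ.fmem d (check PQ \<alpha>) t" "d \<in> elts PQ" for d \<alpha>
  proof -
    obtain r \<pi> s where "leq lePQ r d" "vpair \<pi> s \<in> elts t" "PQ.feq r \<pi> (check PQ \<alpha>)"
      using PQ.dns_ex[OF m(1)[unfolded PQ.fmem_def] m(2)] by blast
    then show ?thesis unfolding \<Gamma>_def using vpair_mem_trcl PQ.below_cond by blast
  qed
  \<comment> \<open>With the \<open>Q\<close>-coordinate frozen at \<open>q1\<close>, membership
    depends on the condition of \<open>P\<close> alone and can be named by a
    \<open>P\<close>-name.\<close>
  define M where "M = (\<lambda>\<alpha> p. PQ.fmem (vpair p q1) (check PQ \<alpha>) t)"
  define x where "x = P.pn (check P ` \<Gamma>) (\<lambda>y p. \<exists>\<alpha>\<in>\<Gamma>. y = check P \<alpha> \<and> M \<alpha> p)"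
  \<comment> \<open>Every condition \<open>r\<close> of \<open>Q\<close> is listed because
    \<open>CQ\<close> attaches all of them; this makes \<open>st (vset S)\<close> and
    \<open>CQ x\<close> identical.\<close>
  define S where "S = {vpair (check PQ \<alpha>) (vpair p r) |\<alpha> p r. \<alpha> \<in> \<Gamma> \<and> p \<in> elts P \<and> r \<in> elts Q \<and> M \<alpha> p}"
  have "small S"
    by (rule small_subset[OF small_image3[OF s\<Gamma> small_elts[of P] small_elts[of Q],
        of "\<lambda>\<alpha> p r. vpair (check PQ \<alpha>) (vpair p r)"]]) (auto simp: S_def)
  then have eS: "elts (vset S) = S" by simp
  have ex: "elts x = {vpair (check P \<alpha>) p |\<alpha> p. \<alpha> \<in> \<Gamma> \<and> p \<in> elts P \<and> M \<alpha> p}"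
    unfolding x_def P.elts_pn[OF small_image[OF s\<Gamma>]] by auto
  have nx: "P.isname x" unfolding x_def using s\<Gamma> by (intro P.isname_pn) auto
  have na: "PQ.isname (vset S)" by (rule PQ.isnameI, unfold eS) (auto simp: S_def)
  have "elts (CQ x) = elts (st (vset S))"
  proof -
    have "elts (CQ x) = {vpair (P.opn (st (check PQ \<alpha>)) (check P r)) p |\<alpha> p r.
        \<alpha> \<in> \<Gamma> \<and> p \<in> elts P \<and> r \<in> elts Q \<and> M \<alpha> p}"
      unfolding elts_CQ ex CQ_check[symmetric] by auto
    also have "\<dots> = elts (st (vset S))"
      unfolding elts_st eS by (auto simp: S_def)
    finally show ?thesis .
  qed
  then have CQx: "CQ x = st (vset S)" by (simp add: elts_inject)
  have c1: "leq lePQ (vpair p1 q1) c" unfolding c0 using p1 q1 by simp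
  have "PQ.feq (vpair p1 q1) t (vset S)"
    unfolding PQ.feq_iff
  proof (intro conjI allI impI)
    fix \<pi> s d assume d: "vpair \<pi> s \<in> elts t" "leq lePQ d (vpair p1 q1)" "leq lePQ d s"
    have n\<pi>: "PQ.isname \<pi>" using t d PQ.isname_pairD by blast
    have m: "PQ.fmem d \<pi> t" using d PQ.fmem_elt by blast
    have dc: "leq lePQ d c" using d(2) c1 PQ.below_trans by blast
    show "PQ.fmem d \<pi> (vset S)"
    proof (rule PQ.fmem_dns, rule PQ.dnsI)
      fix d1 assume d1: "leq lePQ d1 d"
      obtain d2 k \<alpha> where d2: "leq lePQ d2 d1" "PQ.feq d2 \<pi> (check PQ \<alpha>)" "G d2 k \<alpha>"
        using PQ.dnsD[OF Gtot[OF dc n\<pi> m] d1] by blast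
      have d2': "leq lePQ d2 (vpair p1 q1)" "leq lePQ d2 c" using d2 d1 d dc PQ.below_trans by meson+
      obtain p2 q2 where p2: "d2 = vpair p2 q2" "leq leP p2 p1" "leq leQ q2 q1"
        using d2'(1) by (rule leq_PQ_cases)
      obtain r where r: "leq leP r p2" "D k r q1" using P.dnsD[OF dec p2(2)] by blast
      have rP: "r \<in> elts P" "q2 \<in> elts Q" using r p2 P.below_cond Q.below_cond by blast+
      let ?e = "vpair r q2"
      have e: "leq lePQ ?e d2" "leq lePQ ?e (vpair r q1)" using r p2 rP by auto
      have ec: "leq lePQ ?e c" "leq lePQ ?e d1" using e d2 d2' PQ.below_trans by blast+
      have Ge: "G ?e k \<alpha>" using Gmono d2(3) e(1) by blast
      \<comment> \<open>\<open>?e\<close> lies below \<open>vpair r q1\<close> and has a value at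
        the index \<open>k\<close>, so the negative alternative of \<open>D\<close> fails
        there.\<close>
      then obtain \<beta> where \<beta>: "G (vpair r q1) k \<beta>" using r(2) e(2) unfolding D_def by blast
      \<comment> \<open>The value \<alpha> was found with the stronger condition \<open>q2\<close>,
        but it is the one already decided with \<open>q1\<close>; hence \<open>q1\<close> suffices
        to force \<alpha> into \<open>t\<close>.\<close>
      have "\<beta> = \<alpha>" using Ginj[OF ec(1) _ Ge] Gmono[OF \<beta> e(2)] by blast
      then have "M \<alpha> r" using Gmem[OF \<beta>] by (simp add: M_def)
      moreover have "\<alpha> \<in> \<Gamma>" using \<Gamma>I Gmem[OF Ge] PQ.below_cond(1)[OF ec(1)] by blast
      ultimately have "vpair (check PQ \<alpha>) ?e \<in> elts (vset S)"
        unfolding eS using rP by (auto simp: S_def)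
      then have "PQ.fmem ?e (check PQ \<alpha>) (vset S)"
        using PQ.fmem_elt PQ.below_refl PQ.below_cond(1)[OF ec(1)] by blast
      moreover have "PQ.feq ?e (check PQ \<alpha>) \<pi>" using PQ.feq_mono[OF d2(2) e(1)] PQ.feq_sym by blast
      ultimately have "PQ.fmem ?e \<pi> (vset S)" using PQ.fmem_cong1 by blast
      then show "\<exists>r. leq lePQ r d1 \<and> PQ.fmem r \<pi> (vset S)" using ec(2) by blast
    qed
  next
    fix \<pi> s d assume d: "vpair \<pi> s \<in> elts (vset S)" "leq lePQ d (vpair p1 q1)" "leq lePQ d s"
    then obtain \<alpha> u r where s: "\<pi> = check PQ \<alpha>" "s = vpair u r" "M \<alpha> u"
      unfolding eS by (auto simp: S_def)
    obtain p2 q2 where p2: "d = vpair p2 q2" "leq leP p2 p1" "leq leQ q2 q1"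
      using d(2) by (rule leq_PQ_cases)
    have "leq lePQ d (vpair u q1)" using d(3) s p2 by simp
    then show "PQ.fmem d \<pi> t" using s(1,3) PQ.fmem_mono unfolding M_def by blast
  qed
  moreover have "leq leP p1 p" "leq leQ q1 q" using p1 q1 c0 P.below_trans Q.below_trans by blast+
  ultimately show ?thesis using nx na CQx by blast
qed

end

text \<open>The condition and the set of ordinals are given by arbitrary \<open>P\<close>-names. The
  former is densely canonical, the latter equals a translation \<open>st t\<close>, so
  \<open>forces_forces_iff\<close> moves the hypothesis to the product, \<open>ex_check_name\<close>
  supplies a stronger pair there, and \<open>inner_eq\<close> carries the resulting equality
  back.\<close>

theorem theorem2p3:
  fixes P leP Q leQ :: "'v::zfc"
  assumes "forcing_poset P leP"
    and "strongly_proper_on_stationary P leP"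
    and "forcing_poset Q leQ"
    and "omega1_closed Q leQ"
  shows "forced P leP (Omega1Distributive (check P Q) (check P leQ))"
proof -
  interpret two_forcing P leP Q leQ
    by unfold_locales (fact assms)+
  define F where "F = (\<lambda>\<tau> r. Exists (\<lambda>x. Exists (\<lambda>c. Conj (IsCheck cQ x c) (ForcesEq cQ cL r \<tau> c))))"
  have body: "P.frc p (DenseBelow cQ cL \<rho> (F \<tau>))"
    if \<rho>: "P.isname \<rho>" "P.fmem p \<rho> cQ" and \<tau>: "P.isname \<tau>" "P.frc p (IsName cQ \<tau>)"
      and cso: "P.frc p (Forces cQ cL (CountableSetOfOrdinals \<tau>) \<rho>)" and p: "p \<in> elts P" for p \<rho> \<tau>
  proof (rule P.frc_dns[OF p])
    obtain t where t: "PQ.isname t" "P.feq p \<tau> (st t)" using ex_st_of_IsName[OF \<tau>(1) p \<tau>(2)] by blast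
    show "P.dns p (\<lambda>r. P.frc r (DenseBelow cQ cL \<rho> (F \<tau>)))"
      using \<rho>(2) unfolding P.fmem_check
    proof (elim P.dns_mono bexE)
      fix p3 q assume p3: "leq leP p3 p" and q: "q \<in> elts Q" and eq: "P.feq p3 \<rho> (check P q)"
      have p3P: "p3 \<in> elts P" using p3 P.below_cond by blast
      have e\<rho>: "P.eqn p3 \<rho> (check P q)" using \<rho> eq by (simp add: P.eqn_def)
      have e\<tau>: "P.eqn p3 \<tau> (st t)" using \<tau> t p3 isname_st P.feq_mono by (simp add: P.eqn_def)
      have fm: "fmrel {(t, \<tau>)} (CountableSetOfOrdinals t) (CountableSetOfOrdinals \<tau>)"
        by (rule fmrel_CountableSetOfOrdinals) simp
      have "P.frc p3 (Forces cQ cL (CountableSetOfOrdinals \<tau>) \<rho>)" using cso p3 P.frc_mono by blast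
      moreover have "P.frc p3 (Forces cQ cL (CountableSetOfOrdinals \<tau>) \<rho>) \<longleftrightarrow>
          P.frc p3 (Forces cQ cL (CountableSetOfOrdinals \<tau>) (check P q))"
        by (rule frc_Forces_cong[OF fm p3P]) (use \<tau> e\<rho> in auto)
      moreover have "PQ.frc (vpair p3 q) (CountableSetOfOrdinals t) \<longleftrightarrow>
          P.frc p3 (Forces cQ cL (CountableSetOfOrdinals \<tau>) (check P q))"
        by (rule forces_forces_iff[OF fm p3P q]) (use t e\<tau> in auto)
      ultimately have c3: "PQ.frc (vpair p3 q) (CountableSetOfOrdinals t)" by blast
      have resp: "P.resp p3 (F \<tau>)"
        unfolding F_def
        by (rule P.respI_fmrel, intro fmrel_intros fmrel_IsCheck fmrel_ForcesEq) (use \<tau> in auto)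
      have "P.frc p3 (DenseBelow cQ cL (check P q) (F \<tau>))"
        unfolding frc_DenseBelow_cQ[OF p3P resp] PQ_dns
      proof (intro allI impI)
        fix p4 q4 assume p4: "leq leP p4 p3" "leq leQ q4 q"
        have p4P: "p4 \<in> elts P" "q4 \<in> elts Q" using p4 P.below_cond Q.below_cond by blast+
        have "PQ.frc (vpair p4 q4) (CountableSetOfOrdinals t)" by (rule PQ.frc_mono[OF c3]) (use p4 in simp)
        from ex_check_name[OF assms(2,4) t(1) p4P this]
        obtain p5 q5 x a where p5: "leq leP p5 p4" "leq leQ q5 q4" "P.isname x" "PQ.isname a" "CQ x = st a"
          "PQ.feq (vpair p5 q5) t a" by blast
        have q5Q: "q5 \<in> elts Q" using p5 Q.below_cond by blast
        have leaf: "P.frc r (Conj (IsCheck cQ x (st a)) (ForcesEq cQ cL (check P q5) \<tau> (st a)))"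
          if r: "leq leP r p5" for r
        proof -
          have rP: "r \<in> elts P" "leq leP r p3" using r p5 p4 P.below_cond P.below_trans by meson+
          have "PQ.feq (vpair r q5) t a" by (rule PQ.feq_mono[OF p5(6)]) (use r q5Q in simp)
          then have "P.frc r (ForcesEq cQ cL (check P q5) (st t) (st a))"
            using inner_eq[OF t(1) p5(4) rP(1) q5Q] by blast
          moreover have "P.frc r (ForcesEq cQ cL (check P q5) \<tau> (st a)) \<longleftrightarrow>
              P.frc r (ForcesEq cQ cL (check P q5) (st t) (st a))"
            by (rule P.frc_cong[where E = "insert (\<tau>, st t) P.Idn"], rule fmrel_ForcesEq)
              (use P.eqn_mono[OF e\<tau> rP(2)] isname_st[OF p5(4)] rP in auto)
          ultimately show ?thesis
            using frc_IsCheck_CQ[OF p5(3) rP(1)] p5(5) by (simp add: P.frc_Conj)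
        qed
        have "P.frc r (Exists (\<lambda>c. Conj (IsCheck cQ x c) (ForcesEq cQ cL (check P q5) \<tau> c)))"
          if r: "leq leP r p5" for r
          unfolding P.frc_Exists
          using leaf[OF P.below_trans[OF _ r]] isname_st[OF p5(4)] by (intro P.dns_all) blast
        then have "P.frc p5 (F \<tau> (check P q5))"
          unfolding F_def P.frc_Exists[where p = p5] using p5(3) by (intro P.dns_all) blast
        then show "\<exists>p'' q''. leq leP p'' p4 \<and> leq leQ q'' q4 \<and>
            (\<exists>r x. vpair p'' q'' = vpair r x \<and> P.frc r (F \<tau> (check P x)))"
          using p5 by blast
      qed
      \<comment> \<open>The canonical name of \<open>q\<close> is exchanged for the given name of
        the condition; \<open>F\<close> is uniform, so forced equality suffices.\<close>
      moreover have "P.frc p3 (DenseBelow cQ cL \<rho> (F \<tau>)) \<longleftrightarrow> P.frc p3 (DenseBelow cQ cL (check P q) (F \<tau>))"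
        unfolding F_def
        by (rule P.frc_cong[where E = "insert (\<rho>, check P q) P.Idn"],
            intro fmrel_DenseBelow fmrel_intros fmrel_IsCheck fmrel_ForcesEq)
          (use e\<rho> \<tau> p3P in auto)
      ultimately show "P.frc p3 (DenseBelow cQ cL \<rho> (F \<tau>))" by blast
    qed
  qed
  show ?thesis
    unfolding forced_def
  proof
    fix p0 assume p0: "p0 \<in> elts P"
    have od: "Omega1Distributive cQ cL = BForall cQ (\<lambda>q. Forall (\<lambda>\<tau>.
      Imp (Conj (IsName cQ \<tau>) (Forces cQ cL (CountableSetOfOrdinals \<tau>) q)) (DenseBelow cQ cL q (F \<tau>))))"
      unfolding Omega1Distributive_def F_def by (simp add: Forces.simps)
    show "P.frc p0 (Omega1Distributive cQ cL)"
      unfolding od P.frc_BForall[OF p0 P.isname_check]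
    proof (intro allI impI)
      fix \<rho> p assume \<rho>: "P.isname \<rho>" "leq leP p p0" "P.fmem p \<rho> cQ"
      have p: "p \<in> elts P" using \<rho> P.below_cond by blast
      show "P.frc p (Forall (\<lambda>\<tau>. Imp (Conj (IsName cQ \<tau>) (Forces cQ cL (CountableSetOfOrdinals \<tau>) \<rho>))
          (DenseBelow cQ cL \<rho> (F \<tau>))))"
        unfolding P.frc_Forall[where p = p] P.frc_Imp[OF p] P.frc_Conj
      proof (intro allI impI, elim conjE)
        fix \<tau> r assume r: "P.isname \<tau>" "leq leP r p" "P.frc r (IsName cQ \<tau>)"
          "P.frc r (Forces cQ cL (CountableSetOfOrdinals \<tau>) \<rho>)"
        show "P.frc r (DenseBelow cQ cL \<rho> (F \<tau>))"
          by (rule body[OF \<rho>(1) P.fmem_mono[OF \<rho>(3) r(2)] r(1,3,4) P.below_cond(1)[OF r(2)]])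
      qed
    qed
  qed
qed

end
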